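(* Fix $\alpha > \frac{2}{3}$ and a constant $C>0$ independent of $k$. Then there is a constant $C_\alpha>0$, depending on $\alpha$ (with $C$ fixed) but not on $k$ or $p$, such that the following holds for every wavenumber $k>C$ and every integer $p\ge 1$. Set $r_0 = C/k$, so that $0<r_0<1$. Let $$\tilde K(r) = \frac{ik}{2r}\, H^{(1)}_1(kr)\ \text{ for } r\in[r_0,1], \qquad \tilde K(r)=0 \ \text{ for all other } r\ge 0.$$ Let $\tilde K_p$ be the best uniform approximation of $\tilde K$ on $[r_0,1]$ (i.e. the minimizer of $\sup_{r_0\le r\le 1}|\tilde K(r)-F(r)|$) among functions $F$ in the complex linear span $$\mathrm{span}\left\{ \frac{e^{ikr}}{r^{j/\alpha}} : j=1,\dots,p \right\}, \qquad r_0\le r\le 1,$$ extended by $\tilde K_p(r)=0$ for $r\notin[r_0,1]$. Let $\tilde D$ and $\tilde D_p$ be the integral operators with kernels $\tilde K(|x-x'|)$ and $\tilde K_p(|x-x'|)$ respectively. Then, in the $L^2\to L^2$ operator norm, $$\| \tilde D - \tilde D_p \| \le C_\alpha \, p^{\,1-\lfloor 3\alpha/2\rfloor}\, \|\tilde K\|_\infty .$$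
   Context: $H^{(1)}_1$ denotes the Hankel function of the first kind of order 1. The function $K(r)=\frac{ik}{2r}H_1^{(1)}(kr)$, $r>0$, is the kernel of the Dirichlet-to-Neumann map $D$ of the half-space $\{y>0\}\subset\mathbb{R}^2$ for the Helmholtz equation $\Delta u + k^2u=0$ with the Sommerfeld radiation condition: $\partial_y u(x,y)|_{y=0}=\int_{-\infty}^{\infty}K(|x-x'|)\,u(x',0)\,dx'$. The function $\tilde K$ is $K$ with the near-diagonal part $r<r_0$ and the far part $r>1$ cut off. For a kernel function $k_0:[0,\infty)\to\mathbb{C}$ that is bounded and supported in $[r_0,1]$, the associated integral operator acts by $g\mapsto \int_{-\infty}^{\infty} k_0(|x-x'|)\,g(x')\,dx'$ on $L^2(\mathbb{R})$. The norm $\|\cdot\|$ is the operator norm on $L^2$, and $\|\tilde K\|_\infty=\sup_{r_0\le r\le 1}|\tilde K(r)|$. The symbol $\lfloor\cdot\rfloor$ denotes the floor function. *)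

theory Defs
  imports "HOL-Analysis.Analysis"
begin

text \<open>Bessel functions of real order on the positive half-line. The reciprocal Gamma function
  vanishes at the poles of Gamma, so the series also covers negative integer orders.\<close>

definition Bessel_J :: "real \<Rightarrow> real \<Rightarrow> real" where
  "Bessel_J \<nu> x =
     (\<Sum>m. (-1) ^ m / fact m * rGamma (real m + \<nu> + 1) * (x / 2) powr (2 * real m + \<nu>))"

text \<open>Weber's formula, with the usual limit at integer orders.\<close>

definition Bessel_Y :: "real \<Rightarrow> real \<Rightarrow> real" where
  "Bessel_Y \<nu> x =
     (let W = (\<lambda>\<mu>. (Bessel_J \<mu> x * cos (\<mu> * pi) - Bessel_J (- \<mu>) x) / sin (\<mu> * pi))
      in if \<nu> \<in> \<int> then Lim (at \<nu>) W else W \<nu>)"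

definition Hankel1 :: "real \<Rightarrow> real \<Rightarrow> complex" where
  "Hankel1 \<nu> x = of_real (Bessel_J \<nu> x) + \<i> * of_real (Bessel_Y \<nu> x)"

definition zero_ext :: "real set \<Rightarrow> (real \<Rightarrow> complex) \<Rightarrow> real \<Rightarrow> complex" where
  "zero_ext S f r = (if r \<in> S then f r else 0)"

definition K_trunc :: "real \<Rightarrow> real \<Rightarrow> real \<Rightarrow> complex" where
  "K_trunc k r0 =
     zero_ext {r0..1} (\<lambda>r. \<i> * of_real k / (2 * of_real r) * Hankel1 1 (k * r))"

definition approx_space :: "real \<Rightarrow> real \<Rightarrow> nat \<Rightarrow> (real \<Rightarrow> complex) set" where
  "approx_space k \<alpha> p =
     {\<lambda>r. \<Sum>j=1..p. c j * (exp (\<i> * of_real (k * r)) / of_real (r powr (real j / \<alpha>))) |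
        c :: nat \<Rightarrow> complex. True}"

definition sup_norm_on :: "real set \<Rightarrow> (real \<Rightarrow> complex) \<Rightarrow> real" where
  "sup_norm_on S f = (SUP r\<in>S. cmod (f r))"

definition best_uniform_approx ::
    "real set \<Rightarrow> (real \<Rightarrow> complex) \<Rightarrow> (real \<Rightarrow> complex) set \<Rightarrow> (real \<Rightarrow> complex) \<Rightarrow> bool" where
  "best_uniform_approx S f V F \<longleftrightarrow>
     F \<in> V \<and> (\<forall>G\<in>V. sup_norm_on S (\<lambda>r. f r - F r) \<le> sup_norm_on S (\<lambda>r. f r - G r))"

definition kernel_op :: "(real \<Rightarrow> complex) \<Rightarrow> (real \<Rightarrow> complex) \<Rightarrow> real \<Rightarrow> complex" where
  "kernel_op k0 g x = (\<integral>x'. k0 \<bar>x - x'\<bar> * g x' \<partial>lborel)"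

definition L2_fun :: "(real \<Rightarrow> complex) set" where
  "L2_fun = {g \<in> borel_measurable lborel. integrable lborel (\<lambda>x. (cmod (g x))\<^sup>2)}"

definition L2_norm :: "(real \<Rightarrow> complex) \<Rightarrow> real" where
  "L2_norm g = sqrt (\<integral>x. (cmod (g x))\<^sup>2 \<partial>lborel)"

text \<open>The operator norm takes values in the extended non-negative reals: it is infinite when the
  operator does not map square-integrable functions boundedly to square-integrable functions.\<close>

definition L2_opnorm :: "((real \<Rightarrow> complex) \<Rightarrow> real \<Rightarrow> complex) \<Rightarrow> ennreal" where
  "L2_opnorm T =
     Inf {ennreal c | c. 0 \<le> c \<and> (\<forall>g\<in>L2_fun. T g \<in> L2_fun \<and> L2_norm (T g) \<le> c * L2_norm g)}"

end

theory Submission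
  imports Defs "HOL-Computational_Algebra.Polynomial" "HOL-Real_Asymp.Real_Asymp"
begin

text \<open>
  Two reductions turn the claim into a question about polynomials. First, a kernel that vanishes
  for \<open>r > 1\<close> and is bounded by \<open>M\<close> gives an operator of norm at most \<open>2 * M\<close> on
  \<open>L\<^sup>2\<close>, so the operator error is controlled by the uniform error of the best
  approximation, which is at most the uniform error of any approximation that can be exhibited
  (\<open>L2_opnorm_truncated_le\<close>). Second, put \<open>t = (C / (k r)) powr (1 / \<alpha>)\<close>. As
  \<open>r\<close> runs through \<open>[C / k, 1]\<close>, \<open>t\<close> stays in \<open>(0, 1]\<close>, and the functions
  \<open>exp (\<i> k r) / r powr (j / \<alpha>)\<close> become, up to constants,
  \<open>exp (\<i> k r) * t ^ j\<close>.

  The kernel has the same shape because the Hankel function is outgoing: \<open>H\<^sub>1 (x)\<close> equals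
  \<open>exp (\<i> x) / sqrt x\<close> times a function of \<open>1 / x\<close> that is smooth up to
  \<open>1 / x = 0\<close>, with no admixture of \<open>exp (- \<i> x)\<close>. Hence the kernel is
  \<open>const * k\<^sup>2 * exp (\<i> k r) * t * (t powr \<beta> * G (t powr \<alpha>))\<close> with
  \<open>\<beta> = 3 \<alpha> / 2 - 1\<close> and \<open>G\<close> smooth (\<open>K_trunc_factor\<close>). What remains is
  to approximate \<open>t powr \<beta> * G (t powr \<alpha>)\<close> on \<open>(0, 1]\<close> by polynomials of
  degree below \<open>p\<close>. Each derivative lowers the exponent by one and replaces \<open>G\<close> by
  another smooth function, so the first \<open>m = \<lfloor>3 \<alpha> / 2\<rfloor> - 1 \<le> \<beta>\<close>
  derivatives stay bounded, and Jackson's theorem gives an error of order \<open>p ^ (- m)\<close>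
  (\<open>powr_smooth_approximation\<close>). The factor \<open>k\<^sup>2\<close> disappears on comparison with
  the supremum of the kernel, because at \<open>r = C / k\<close> the kernel has modulus
  \<open>const * k\<^sup>2 * cmod (G 1)\<close> and \<open>G\<close> has no zero (\<open>hankel_laplace_nonzero\<close>).

  Jackson's theorem is proved by convolution with an algebraic kernel, the fourth power of a
  Chebyshev-type polynomial, for Lipschitz functions, and by induction on the number of
  derivatives (\<open>jackson_lipschitz\<close>, \<open>jackson_smooth\<close>).

  The representation of the Hankel function has to be derived from the power series of
  \<open>J\<close> and the limit in the order that defines \<open>Y\<close>. The function
  \<open>x * H\<^sub>1 (x)\<close>, together with \<open>H\<^sub>0 (x)\<close>, solves a first-order linear
  system, and so does a pair of explicit Laplace integrals whose exponential behaviour is visible.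
  Near \<open>x = 0\<close> both pairs have the same limits, including the constant
  \<open>\<i> pi / 2 - \<gamma>\<close> next to the logarithm. The system has a nonincreasing energy, so a
  solution that tends to zero at the origin vanishes, and the two pairs agree
  (\<open>bessel_ode_unique\<close>, \<open>Hankel1_1_eq_outgoing1\<close>).
\<close>

section \<open>Jackson kernel\<close>

text \<open>With \<open>u = sin t\<close> the value at \<open>u\<close> is the Dirichlet kernel
  \<open>sin ((2 n + 1) t) / sin t\<close>, the \<open>(2 n + 1)\<close>-st Chebyshev polynomial divided by its
  variable, up to sign. Being a polynomial in \<open>u\<close> and not only in \<open>cos t\<close>, it produces
  algebraic approximations on an interval directly.\<close>

fun dirichlet_poly :: "nat \<Rightarrow> real poly" where
  "dirichlet_poly 0 = 1"
| "dirichlet_poly (Suc 0) = [:3, 0, -4:]"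
| "dirichlet_poly (Suc (Suc n)) = [:2, 0, -4:] * dirichlet_poly (Suc n) - dirichlet_poly n"

lemma dirichlet_poly_sin:
  "poly (dirichlet_poly n) (sin t) * sin t = sin (real (2 * n + 1) * t)"
proof (induction n rule: dirichlet_poly.induct)
  case 1
  then show ?case by simp
next
  case 2
  have "sin (3 * t) = sin (2 * t + t)" by (simp add: algebra_simps)
  also have "\<dots> = 3 * sin t - 4 * sin t ^ 3"
    unfolding sin_add sin_double cos_double
    using sin_cos_squared_add[of t] by algebra
  finally show ?case by (simp add: algebra_simps power3_eq_cube)
next
  case (3 n)
  define A where "A = real (2 * n + 3) * t"
  have e: "real (2 * n + 1) * t = A - 2 * t" "real (2 * Suc (Suc n) + 1) * t = A + 2 * t"
    "real (2 * Suc n + 1) * t = A"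
    by (auto simp: A_def algebra_simps)
  have "(2 - 4 * sin t ^ 2) * sin A = sin (A + 2 * t) + sin (A - 2 * t)"
    unfolding sin_add sin_diff cos_double
    using sin_cos_squared_add[of t] by algebra
  moreover have "poly (dirichlet_poly (Suc (Suc n))) (sin t) * sin t
      = (2 - 4 * sin t ^ 2) * (poly (dirichlet_poly (Suc n)) (sin t) * sin t)
        - poly (dirichlet_poly n) (sin t) * sin t"
    by (simp add: algebra_simps power2_eq_square)
  ultimately show ?case using 3 unfolding e by simp
qed

lemma dirichlet_poly_0: "poly (dirichlet_poly n) 0 = real (2 * n + 1)"
  by (induction n rule: dirichlet_poly.induct) (auto simp: algebra_simps)

lemma degree_dirichlet_poly: "degree (dirichlet_poly n) \<le> 2 * n"
proof (induction n rule: dirichlet_poly.induct)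
  case (3 n)
  have "degree ([:2, 0, -4:] * dirichlet_poly (Suc n)) \<le> 2 + 2 * Suc n"
    by (rule order_trans[OF degree_mult_le]) (use 3 in auto)
  then show ?case
    unfolding dirichlet_poly.simps using 3 by (intro degree_diff_le) auto
qed auto

lemma abs_sin_mult_nat_le: "\<bar>sin (real n * t)\<bar> \<le> real n * \<bar>sin t\<bar>"
proof (induction n)
  case (Suc n)
  have "\<bar>sin (real (Suc n) * t)\<bar> = \<bar>sin (real n * t) * cos t + cos (real n * t) * sin t\<bar>"
    using sin_add[of "real n * t" t] by (simp add: distrib_right add.commute)
  also have "\<dots> \<le> \<bar>sin (real n * t)\<bar> * 1 + 1 * \<bar>sin t\<bar>"
    by (rule order_trans[OF abs_triangle_ineq], unfold abs_mult)
       (intro add_mono mult_mono, auto)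
  also have "\<dots> \<le> real (Suc n) * \<bar>sin t\<bar>"
    using Suc by (simp add: algebra_simps)
  finally show ?case .
qed auto

lemma abs_dirichlet_poly_le:
  assumes "\<bar>u\<bar> \<le> 1"
  shows "\<bar>poly (dirichlet_poly n) u\<bar> \<le> real (2 * n + 1)"
    and "\<bar>poly (dirichlet_poly n) u * u\<bar> \<le> 1"
proof -
  define t where "t = arcsin u"
  have u: "sin t = u" using assms by (simp add: t_def abs_le_iff)
  show "\<bar>poly (dirichlet_poly n) u * u\<bar> \<le> 1"
    using dirichlet_poly_sin[of n t] unfolding u by simp
  show "\<bar>poly (dirichlet_poly n) u\<bar> \<le> real (2 * n + 1)"
  proof (cases "u = 0")
    case False
    have "\<bar>poly (dirichlet_poly n) u\<bar> * \<bar>u\<bar> \<le> real (2 * n + 1) * \<bar>u\<bar>"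
      using dirichlet_poly_sin[of n t] abs_sin_mult_nat_le[of "2 * n + 1" t]
      unfolding u by (simp add: abs_mult[symmetric])
    then show ?thesis using False by simp
  qed (simp add: dirichlet_poly_0)
qed

lemma sin_ge_half:
  fixes y :: real
  assumes "0 \<le> y" "y \<le> 1"
  shows "y / 2 \<le> sin y"
proof -
  have "\<bar>sin y - (\<Sum>m<3. sin_coeff m * y ^ m)\<bar> \<le> inverse (fact 3) * \<bar>y\<bar> ^ 3"
    by (rule Maclaurin_sin_bound)
  then have "\<bar>sin y - y\<bar> \<le> y ^ 3 / 6"
    using assms by (simp add: numeral_eq_Suc sin_coeff_def fact_reduce)
  moreover have "y ^ 3 \<le> y" using assms power_decreasing[of 1 3 y] by simp
  ultimately show ?thesis by linarith
qed

text \<open>On a neighbourhood of width comparable to \<open>1 / (2 n + 1)\<close> the sine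
  in the numerator has not yet turned, so the kernel keeps at least half of its central value. This
  is the source of the mass of the Jackson kernel.\<close>

lemma dirichlet_poly_ge:
  assumes "\<bar>u\<bar> \<le> 1 / (2 * real (2 * n + 1))"
  shows "real (2 * n + 1) / 2 \<le> poly (dirichlet_poly n) u"
proof -
  define N where "N = real (2 * n + 1)"
  have N: "N \<ge> 1" by (simp add: N_def)
  have pos: "N / 2 \<le> poly (dirichlet_poly n) u" if u: "0 < u" "u \<le> 1 / (2 * N)" for u
  proof -
    define t where "t = arcsin u"
    have "1 / (2 * N) \<le> 1 / 2" using N by (simp add: field_simps)
    with u have u2: "u \<le> 1 / 2" by linarith
    have sint: "sin t = u" using u u2 by (simp add: t_def)
    have t0: "0 < t" unfolding t_def using arcsin_less_arcsin[of 0 u] u u2 by simp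
    have "arcsin u \<le> arcsin (1 / 2)" by (rule arcsin_le_arcsin) (use u u2 in auto)
    also have "arcsin (1 / 2 :: real) = pi / 6"
      using arcsin_sin[of "pi / 6"] sin_30 pi_gt_zero by simp
    also have "pi / 6 \<le> 1" using pi_less_4 by simp
    finally have t1: "t \<le> 1" by (simp add: t_def)
    from sin_ge_half[of t] t0 t1 sint have t2u: "t \<le> 2 * u" by simp
    have ut: "u \<le> t" using sin_x_le_x[of t] t0 sint by simp
    have Nt: "N * t \<le> 1"
    proof -
      have "N * t \<le> N * (2 * u)" using t2u N by simp
      also have "\<dots> \<le> 1" using u N by (simp add: field_simps)
      finally show ?thesis .
    qed
    have "N / 2 * u \<le> N * t / 2" using ut N by simp
    also have "\<dots> \<le> sin (N * t)" using sin_ge_half[of "N * t"] Nt t0 N by simp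
    also have "\<dots> = poly (dirichlet_poly n) u * u"
      using dirichlet_poly_sin[of n t] sint by (simp add: N_def)
    finally show ?thesis using u by simp
  qed
  have even: "poly (dirichlet_poly n) (- u) = poly (dirichlet_poly n) u" for u
    by (induction n rule: dirichlet_poly.induct) auto
  consider "u = 0" | "u > 0" | "- u > 0" by linarith
  then have "N / 2 \<le> poly (dirichlet_poly n) u"
  proof cases
    case 1
    then show ?thesis by (simp add: dirichlet_poly_0 N_def)
  next
    case 2
    then show ?thesis using pos[of u] assms by (simp add: N_def)
  next
    case 3
    then show ?thesis using pos[of "- u"] assms even[of u] by (simp add: N_def)
  qed
  then show ?thesis by (simp add: N_def)
qed

text \<open>The fourth power makes the kernel decay like \<open>u powr (- 4)\<close>, so
  that its first absolute moment is a factor \<open>n\<close> smaller than its mass. The square would lose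
  a logarithm.\<close>

definition jackson_kernel :: "nat \<Rightarrow> real poly" where
  "jackson_kernel n = dirichlet_poly n ^ 4"

lemma degree_jackson_kernel: "degree (jackson_kernel n) \<le> 8 * n"
proof -
  have "degree (jackson_kernel n) \<le> degree (dirichlet_poly n) * 4"
    unfolding jackson_kernel_def by (rule degree_power_le)
  with degree_dirichlet_poly[of n] show ?thesis by linarith
qed

lemma jackson_kernel_nonneg: "poly (jackson_kernel n) u \<ge> 0"
  by (simp add: jackson_kernel_def)

text \<open>The two bounds \<open>d \<le> N\<close> and \<open>d * \<bar>u\<bar> \<le> 1\<close> on the
  modulus \<open>d\<close> of the Dirichlet polynomial are merged into one majorant with the antiderivative
  arctan, which avoids cutting the interval at \<open>1 / N\<close>.\<close>

lemma jackson_kernel_second_moment: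
  fixes n :: nat and u :: real
  assumes "\<bar>u\<bar> \<le> 1"
  defines "N \<equiv> real (2 * n + 1)"
  shows "u\<^sup>2 * poly (jackson_kernel n) u \<le> 2 * N\<^sup>2 / (1 + (N * u)\<^sup>2)"
proof -
  define d where "d = \<bar>poly (dirichlet_poly n) u\<bar>"
  have d: "0 \<le> d" "d \<le> N" "(d * \<bar>u\<bar>)\<^sup>2 \<le> 1"
    using abs_dirichlet_poly_le[OF assms(1), of n] by (auto simp: d_def N_def abs_mult power_le_one)
  have K: "poly (jackson_kernel n) u = d ^ 4"
    unfolding jackson_kernel_def d_def poly_power by (rule power_even_abs[symmetric]) simp
  have "u\<^sup>2 * d ^ 4 * (1 + (N * u)\<^sup>2) = d\<^sup>2 * (d * \<bar>u\<bar>)\<^sup>2 + N\<^sup>2 * ((d * \<bar>u\<bar>)\<^sup>2 * (d * \<bar>u\<bar>)\<^sup>2)"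
    by (simp add: power_mult_distrib algebra_simps power4_eq_xxxx power2_eq_square)
  also have "\<dots> \<le> N\<^sup>2 * 1 + N\<^sup>2 * (1 * 1)"
    using d by (intro add_mono mult_mono power_mono) auto
  finally have "u\<^sup>2 * d ^ 4 * (1 + (N * u)\<^sup>2) \<le> 2 * N\<^sup>2" by simp
  moreover have "1 + (N * u)\<^sup>2 > 0" by (smt (verit) zero_le_power2)
  ultimately show ?thesis unfolding K by (simp add: pos_le_divide_eq)
qed

lemma jackson_kernel_integrable [simp, intro]:
  "(\<lambda>u. poly (jackson_kernel n) u) integrable_on {a..b}"
  "(\<lambda>u. \<bar>u\<bar> * poly (jackson_kernel n) u) integrable_on {a..b}"
  "(\<lambda>u. u\<^sup>2 * poly (jackson_kernel n) u) integrable_on {a..b}"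
  by (intro integrable_continuous_interval continuous_intros)+

lemma jackson_kernel_mass:
  fixes n :: nat
  defines "N \<equiv> real (2 * n + 1)"
  shows "N ^ 3 / 16 \<le> integral {-1..1} (poly (jackson_kernel n))"
proof -
  define h where "h = 1 / (2 * N)"
  have N: "N \<ge> 1" by (simp add: N_def)
  have h: "0 < h" "h \<le> 1" using N by (auto simp: h_def field_simps)
  have "N ^ 3 / 16 = integral {-h..h} (\<lambda>u. (N / 2) ^ 4)"
    using N h by (simp add: h_def power3_eq_cube power4_eq_xxxx)
  also have "\<dots> \<le> integral {-h..h} (poly (jackson_kernel n))"
  proof (rule integral_le)
    fix u assume "u \<in> {-h..h}"
    then have "N / 2 \<le> poly (dirichlet_poly n) u"
      unfolding N_def by (intro dirichlet_poly_ge) (auto simp: h_def N_def abs_le_iff)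
    then show "(N / 2) ^ 4 \<le> poly (jackson_kernel n) u"
      unfolding jackson_kernel_def poly_power using N by (intro power_mono) auto
  qed auto
  also have "\<dots> \<le> integral {-1..1} (poly (jackson_kernel n))"
    by (rule integral_subset_le) (use h jackson_kernel_nonneg in auto)
  finally show ?thesis .
qed

text \<open>The absolute value is removed by
  \<open>\<bar>u\<bar> \<le> 1 / (2 N) + N u\<^sup>2 / 2\<close>: both terms are of order \<open>1 / N\<close> times the
  mass, the second one by the bound on the second moment.\<close>

lemma jackson_kernel_first_moment:
  fixes n :: nat
  defines "N \<equiv> real (2 * n + 1)"
  shows "integral {-1..1} (\<lambda>u. \<bar>u\<bar> * poly (jackson_kernel n) u)
           \<le> 65 / N * integral {-1..1} (poly (jackson_kernel n))"
proof -
  define K where "K = poly (jackson_kernel n)"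
  define M where "M = integral {-1..1} K"
  have N: "N \<ge> 1" by (simp add: N_def)
  have K0: "K u \<ge> 0" for u by (simp add: K_def jackson_kernel_nonneg)
  have intK: "K integrable_on {a..b}" "(\<lambda>u. \<bar>u\<bar> * K u) integrable_on {a..b}"
     "(\<lambda>u. u\<^sup>2 * K u) integrable_on {a..b}" for a b
    by (simp_all add: K_def)
  have N3: "N ^ 3 / 16 \<le> M" using jackson_kernel_mass[of n] by (simp add: M_def N_def K_def)
  have sec: "integral {-1..1} (\<lambda>u. u\<^sup>2 * K u) \<le> 8 * N"
  proof -
    have nz: "1 + (N * u)\<^sup>2 \<noteq> 0" for u by (smt (verit) zero_le_power2)
    have hi: "((\<lambda>u. 2 * N\<^sup>2 / (1 + (N * u)\<^sup>2)) has_integral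
           (2 * N * arctan (N * 1) - 2 * N * arctan (N * -1))) {-1..1}"
      by (rule fundamental_theorem_of_calculus)
         (auto intro!: derivative_eq_intros simp: nz has_real_derivative_iff_has_vector_derivative[symmetric]
           power2_eq_square field_simps)
    have "integral {-1..1} (\<lambda>u. u\<^sup>2 * K u) \<le> integral {-1..1} (\<lambda>u. 2 * N\<^sup>2 / (1 + (N * u)\<^sup>2))"
      by (rule integral_le)
         (use intK hi jackson_kernel_second_moment[of _ n] in \<open>auto simp: K_def N_def has_integral_integrable abs_le_iff\<close>)
    also have "\<dots> = 4 * N * arctan N" using integral_unique[OF hi] by (simp add: arctan_minus)
    also have "\<dots> \<le> 4 * N * 2" using N arctan_ubound[of N] pi_less_4 by (intro mult_left_mono) auto
    finally show ?thesis by simp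
  qed
  have pw: "\<bar>u\<bar> * K u \<le> (1 / (2 * N)) * K u + (N / 2) * (u\<^sup>2 * K u)" for u
  proof -
    have "0 \<le> (1 - N * \<bar>u\<bar>)\<^sup>2" by simp
    then have "\<bar>u\<bar> \<le> 1 / (2 * N) + N / 2 * u\<^sup>2"
      using N by (simp add: power2_eq_square field_simps)
    from mult_right_mono[OF this K0[of u]] show ?thesis by (simp add: algebra_simps)
  qed
  have "integral {-1..1} (\<lambda>u. \<bar>u\<bar> * K u)
     \<le> integral {-1..1} (\<lambda>u. (1 / (2 * N)) * K u + (N / 2) * (u\<^sup>2 * K u))"
    by (intro integral_le integrable_add intK integrable_on_mult_right pw)
  also have "\<dots> = (1 / (2 * N)) * M + (N / 2) * integral {-1..1} (\<lambda>u. u\<^sup>2 * K u)"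
    using integral_add[OF integrable_on_mult_right[OF intK(1), of "1 / (2 * N)"]
        integrable_on_mult_right[OF intK(3), of "N / 2"]]
    by (simp only: integral_mult_right M_def)
  also have "\<dots> \<le> (1 / (2 * N)) * M + (N / 2) * (8 * N)"
    using sec N by (intro add_left_mono mult_left_mono) auto
  also have "(N / 2) * (8 * N) = 64 / N * (N ^ 3 / 16)"
    using N by (simp add: power3_eq_cube)
  also have "\<dots> \<le> 64 / N * M" using N3 N by (intro mult_left_mono) auto
  also have "(1 / (2 * N)) * M + 64 / N * M \<le> 65 / N * M"
  proof -
    have "M \<ge> 0" using N3 N by (smt (verit) divide_nonneg_nonneg zero_le_power)
    then show ?thesis using N by (simp add: field_simps)
  qed
  finally show ?thesis by (simp add: M_def K_def)
qed

section \<open>Polynomial approximation of differentiable functions\<close>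

text \<open>Convolution with a polynomial over a fixed interval is a polynomial in the
  outer variable. In the induction on the polynomial, the factor \<open>x - y\<close> is split, and the
  part \<open>y\<close> is absorbed into the density.\<close>

lemma ex_poly_convolution:
  fixes g :: "real \<Rightarrow> complex" and k :: "real poly"
  assumes "continuous_on {a..b} g"
  shows "\<exists>P. degree P \<le> degree k \<and>
    (\<forall>x. ((\<lambda>y. g y * of_real (poly k (x - y))) has_integral poly P (of_real x)) {a..b})"
  using assms
proof (induction k arbitrary: g)
  case 0
  then show ?case by (intro exI[of _ 0]) simp
next
  case (pCons c k)
  have g: "g integrable_on {a..b}" by (intro integrable_continuous_interval pCons)
  have cont: "continuous_on {a..b} (\<lambda>y. of_real y * g y)" by (intro continuous_intros pCons)
  obtain P where P: "degree P \<le> degree k"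
    "\<And>x. ((\<lambda>y. g y * of_real (poly k (x - y))) has_integral poly P (of_real x)) {a..b}"
    using pCons.IH[OF pCons.prems] by blast
  obtain Q where Q: "degree Q \<le> degree k"
    "\<And>x. ((\<lambda>y. of_real y * g y * of_real (poly k (x - y))) has_integral poly Q (of_real x)) {a..b}"
    using pCons.IH[OF cont] by blast
  define R where "R = [:of_real c * integral {a..b} g:] + [:0, 1:] * P - Q"
  have "((\<lambda>y. g y * of_real (poly (pCons c k) (x - y))) has_integral poly R (of_real x)) {a..b}" for x
  proof -
    have "((\<lambda>y. of_real c * g y + of_real x * (g y * of_real (poly k (x - y)))
        - of_real y * g y * of_real (poly k (x - y))) has_integral
        (of_real c * integral {a..b} g + of_real x * poly P (of_real x) - poly Q (of_real x))) {a..b}"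
      by (intro has_integral_diff has_integral_add has_integral_mult_right
            integrable_integral[OF g] P Q)
    then show ?thesis by (simp add: R_def algebra_simps)
  qed
  moreover have "degree R \<le> degree (pCons c k)"
  proof (cases "k = 0")
    case True
    have "poly P (of_real x) = 0" "poly Q (of_real x) = 0" for x
      using has_integral_unique[OF P(2)[of x], of 0] has_integral_unique[OF Q(2)[of x], of 0] True
      by auto
    moreover have "degree P = 0" "degree Q = 0" using P Q True by auto
    then obtain p q where "P = [:p:]" "Q = [:q:]" by (metis degree_eq_zeroE)
    ultimately show ?thesis by (simp add: R_def)
  next
    case False
    have "degree ([:0, 1:] * P) \<le> Suc (degree k)"
      by (rule order_trans[OF degree_mult_le]) (use P in auto)
    then show ?thesis
      using False P Q unfolding R_def by (intro degree_diff_le degree_add_le) auto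
  qed
  ultimately show ?case by blast
qed

text \<open>The function is made constant beyond its interval and shifted to vanish at
  its left end, so that it is bounded by \<open>L\<close>. It is then integrated against the kernel over
  the fixed interval \<open>{-1..2}\<close>, which contains all points at distance at most 1 from
  \<open>{0..1}\<close>. The error is the first moment of the kernel times \<open>L\<close>, divided by the mass.\<close>

lemma jackson_lipschitz:
  fixes f :: "real \<Rightarrow> complex"
  assumes ab: "0 \<le> a" "a \<le> b" "b \<le> 1"
    and lip: "\<And>x y. x \<in> {a..b} \<Longrightarrow> y \<in> {a..b} \<Longrightarrow> cmod (f x - f y) \<le> L * \<bar>x - y\<bar>"
    and L: "L \<ge> 0"
  shows "\<exists>P. degree P \<le> 8 * n \<and>
    (\<forall>x\<in>{a..b}. cmod (f x - poly P (of_real x)) \<le> 130 / real (2 * n + 1) * L)"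
proof -
  define N where "N = real (2 * n + 1)"
  define g where "g y = f (max a (min b y)) - f a" for y
  define K where "K = poly (jackson_kernel n)"
  define M where "M = integral {-1..1} K"
  have K0: "K u \<ge> 0" for u by (simp add: K_def jackson_kernel_nonneg)
  have N: "N \<ge> 1" by (simp add: N_def)
  have M: "M > 0"
    using jackson_kernel_mass[of n] N zero_less_power[of N 3] unfolding M_def K_def N_def by linarith
  have g_lip: "cmod (g x - g y) \<le> L * \<bar>x - y\<bar>" for x y
  proof -
    have "cmod (g x - g y) \<le> L * \<bar>max a (min b x) - max a (min b y)\<bar>"
      unfolding g_def using lip[of "max a (min b x)" "max a (min b y)"] ab by simp
    also have "\<dots> \<le> L * \<bar>x - y\<bar>" using L by (intro mult_left_mono) auto
    finally show ?thesis .
  qed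
  have g_bound: "cmod (g x) \<le> L" for x
  proof -
    have "cmod (g x) \<le> L * \<bar>max a (min b x) - a\<bar>"
      unfolding g_def using lip[of "max a (min b x)" a] ab by simp
    also have "\<dots> \<le> L * 1" using L ab by (intro mult_left_mono) auto
    finally show ?thesis by simp
  qed
  have g_cont: "continuous_on A g" for A
  proof (rule continuous_on_subset)
    show "continuous_on UNIV g"
      by (rule lipschitz_on_continuous_on[of L]) (auto intro!: lipschitz_onI simp: g_lip L dist_norm)
  qed auto
  define k where "k = pcompose (jackson_kernel n) [:0, -1/2:]"
  have k: "poly k (x - y) = K ((y - x) / 2)" for x y
    by (simp add: k_def K_def poly_pcompose diff_divide_distrib algebra_simps)
  have dk: "degree k \<le> 8 * n"
  proof -
    have "degree k \<le> degree (jackson_kernel n) * degree [:0, -1/2 :: real:]"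
      unfolding k_def by (rule degree_pcompose_le)
    also have "\<dots> \<le> 8 * n" using degree_jackson_kernel[of n] by simp
    finally show ?thesis .
  qed
  obtain Q where Q: "degree Q \<le> 8 * n"
    "\<And>x. ((\<lambda>y. g y * of_real (K ((y - x) / 2))) has_integral poly Q (of_real x)) {-1..2}"
    using ex_poly_convolution[OF g_cont, where k = k and a = "-1" and b = 2] dk unfolding k by (meson order_trans)
  have shift: "((\<lambda>y. h ((y - x) / 2)) has_integral 2 * i) {x-2..x+2}"
    if "(h has_integral i) {-1..1}" for h :: "real \<Rightarrow> real" and i x
  proof -
    have "((\<lambda>y. h ((1/2) *\<^sub>R y + (- x / 2))) has_integral i /\<^sub>R (1/2) ^ DIM(real))
       (cbox ((-1 - (- x / 2)) /\<^sub>R (1/2)) ((1 - (- x / 2)) /\<^sub>R (1/2)))"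
      using has_integral_affinity'[of h i "-1" 1 "1/2" "- x / 2"] that by simp
    then show ?thesis by (simp add: diff_divide_distrib algebra_simps)
  qed
  \<comment> \<open>The factor \<open>2 * M\<close> is the mass of the kernel on \<open>{-1..1}\<close> stretched to \<open>{-2..2}\<close>.\<close>
  have err: "cmod (of_real (2 * M) * g x - poly Q (of_real x)) \<le> L * (4 * (65 / N * M))"
    if x: "x \<in> {0..1}" for x
  proof -
    define I where "I = integral {-1..1} (\<lambda>u. \<bar>u\<bar> * K u)"
    have 1: "((\<lambda>y. g x * of_real (K ((y - x) / 2))) has_integral g x * of_real (2 * M)) {x-2..x+2}"
      unfolding M_def
      by (intro has_integral_mult_right has_integral_of_real shift integrable_integral)
         (simp add: K_def)
    have 2: "((\<lambda>y. if y \<in> {-1..2} then g y * of_real (K ((y - x) / 2)) else 0)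
        has_integral poly Q (of_real x)) {x-2..x+2}"
      by (subst has_integral_restrict) (use x Q in auto)
    have 3: "((\<lambda>y. L * (2 * (\<bar>(y - x) / 2\<bar> * K ((y - x) / 2)))) has_integral L * (2 * (2 * I))) {x-2..x+2}"
      unfolding I_def
      by (intro has_integral_mult_right shift[of "\<lambda>u. \<bar>u\<bar> * K u"] integrable_integral) (simp add: K_def)
    have "cmod (integral {x-2..x+2} (\<lambda>y. g x * of_real (K ((y - x) / 2))
        - (if y \<in> {-1..2} then g y * of_real (K ((y - x) / 2)) else 0)))
      \<le> integral {x-2..x+2} (\<lambda>y. L * (2 * (\<bar>(y - x) / 2\<bar> * K ((y - x) / 2))))"
    proof (rule integral_norm_bound_integral)
      fix y
      \<comment> \<open>Outside \<open>{-1..2}\<close> the two points are at distance at least 1, so there the bound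
        on \<open>g\<close> itself does what the Lipschitz bound does inside.\<close>
      have "cmod (g x - (if y \<in> {-1..2} then g y else 0)) \<le> L * \<bar>y - x\<bar>"
      proof (cases "y \<in> {-1..2}")
        case True
        then show ?thesis using g_lip[of x y] by (simp add: abs_minus_commute)
      next
        case False
        then have "L * 1 \<le> L * \<bar>y - x\<bar>" using x L by (intro mult_left_mono) auto
        then show ?thesis using False g_bound[of x] by auto
      qed
      from mult_right_mono[OF this K0[of "(y - x) / 2"]]
      show "cmod (g x * of_real (K ((y - x) / 2))
        - (if y \<in> {-1..2} then g y * of_real (K ((y - x) / 2)) else 0))
        \<le> L * (2 * (\<bar>(y - x) / 2\<bar> * K ((y - x) / 2)))"
        using K0[of "(y - x) / 2"]
        by (auto simp: norm_mult left_diff_distrib[symmetric] abs_of_nonneg mult.assoc split: if_splits)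
    qed (use has_integral_diff[OF 1 2] 3 in \<open>blast intro: has_integral_integrable\<close>)+
    then have "cmod (g x * of_real (2 * M) - poly Q (of_real x)) \<le> L * (2 * (2 * I))"
      unfolding integral_unique[OF has_integral_diff[OF 1 2]] integral_unique[OF 3] .
    also have "\<dots> \<le> L * (4 * (65 / N * M))"
      using jackson_kernel_first_moment[of n] L
      by (intro mult_left_mono) (auto simp: I_def M_def N_def K_def)
    finally show ?thesis by (simp add: mult.commute)
  qed
  define P where "P = [:f a:] + smult (1 / of_real (2 * M)) Q"
  have "degree P \<le> 8 * n"
    unfolding P_def by (intro degree_add_le order_trans[OF degree_smult_le]) (use Q in auto)
  moreover have "cmod (f x - poly P (of_real x)) \<le> 130 / N * L" if x: "x \<in> {a..b}" for x
  proof -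
    have "f x - poly P (of_real x) = (of_real (2 * M) * g x - poly Q (of_real x)) / of_real (2 * M)"
      using x M by (simp add: P_def g_def field_simps)
    also have "cmod \<dots> = cmod (of_real (2 * M) * g x - poly Q (of_real x)) / (2 * M)"
      unfolding norm_divide norm_of_real using M by simp
    also have "\<dots> \<le> L * (4 * (65 / N * M)) / (2 * M)"
      by (intro divide_right_mono err) (use x ab M in auto)
    also have "\<dots> = 130 / N * L" using M N by (simp add: field_simps)
    finally show ?thesis .
  qed
  ultimately show ?thesis unfolding N_def by blast
qed

lemma ex_pderiv_eq:
  fixes Q :: "complex poly"
  shows "\<exists>P. pderiv P = Q \<and> degree P \<le> Suc (degree Q)"
proof (intro exI conjI)
  define P where "P = (\<Sum>i\<le>degree Q. monom (coeff Q i / of_nat (Suc i)) (Suc i))"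
  have "coeff P (Suc i) = coeff Q i / of_nat (Suc i)" for i
  proof -
    have "coeff P (Suc i) = (\<Sum>j\<le>degree Q. if i = j then coeff Q i / of_nat (Suc i) else 0)"
      unfolding P_def coeff_sum coeff_monom by (intro sum.cong) auto
    then show ?thesis by (auto simp: coeff_eq_0)
  qed
  then show "pderiv P = Q"
    by (intro poly_eqI) (simp add: coeff_pderiv del: of_nat_Suc)
  show "degree P \<le> Suc (degree Q)"
    unfolding P_def
    by (intro degree_sum_le) (auto intro!: order_trans[OF degree_monom_le])
qed

lemma norm_diff_le_of_vector_derivative_bound:
  fixes f :: "real \<Rightarrow> 'a::real_normed_vector"
  assumes "convex S"
    and "\<And>x. x \<in> S \<Longrightarrow> (f has_vector_derivative f' x) (at x within S)"
    and "\<And>x. x \<in> S \<Longrightarrow> norm (f' x) \<le> B"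
    and "x \<in> S" "y \<in> S"
  shows "norm (f x - f y) \<le> B * \<bar>x - y\<bar>"
proof -
  have "norm (f x - f y) \<le> B * norm (x - y)"
  proof (rule differentiable_bound[OF assms(1)])
    fix z assume z: "z \<in> S"
    show "(f has_derivative (\<lambda>h. h *\<^sub>R f' z)) (at z within S)"
      using assms(2)[OF z] by (simp add: has_vector_derivative_def)
    show "onorm (\<lambda>h. h *\<^sub>R f' z) \<le> B"
      using assms(3)[OF z] by (intro onorm_le) (simp add: mult.commute[of "norm (f' z)"] mult_left_mono mult.commute[of B])
  qed (use assms in auto)
  then show ?thesis by simp
qed

text \<open>If \<open>Q\<close> approximates the derivative with error \<open>E\<close>, then
  subtracting an antiderivative of \<open>Q\<close> leaves a function with Lipschitz constant \<open>E\<close>,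
  and the Lipschitz case improves \<open>E\<close> by a factor of order \<open>1 / n\<close>. The degrees do not
  add up along the induction, because the polynomials are summed and not composed.\<close>

lemma jackson_smooth:
  fixes F :: "nat \<Rightarrow> real \<Rightarrow> complex"
  assumes ab: "0 \<le> a" "a \<le> b" "b \<le> 1"
    and deriv: "\<And>j x. j < m \<Longrightarrow> x \<in> {a..b} \<Longrightarrow>
      (F j has_vector_derivative F (Suc j) x) (at x within {a..b})"
    and bound: "\<And>x. x \<in> {a..b} \<Longrightarrow> cmod (F m x) \<le> B"
  shows "\<exists>P. degree P \<le> 8 * n + m \<and>
    (\<forall>x\<in>{a..b}. cmod (F 0 x - poly P (of_real x)) \<le> (130 / real (2 * n + 1)) ^ m * B)"
  using deriv bound
proof (induction m arbitrary: F)
  case 0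
  then show ?case by (intro exI[of _ 0]) auto
next
  case (Suc m)
  define E where "E = (130 / real (2 * n + 1)) ^ m * B"
  obtain Q where Q: "degree Q \<le> 8 * n + m"
    "\<And>x. x \<in> {a..b} \<Longrightarrow> cmod (F 1 x - poly Q (of_real x)) \<le> E"
    using Suc.IH[of "\<lambda>j. F (Suc j)"] Suc.prems unfolding E_def One_nat_def by auto
  obtain R where R: "pderiv R = Q" "degree R \<le> Suc (degree Q)"
    using ex_pderiv_eq by blast
  define h where "h x = F 0 x - poly R (of_real x)" for x
  have E: "E \<ge> 0" using Q(2)[of a] ab norm_ge_zero[of "F 1 a - poly Q (of_real a)"]
    by (metis atLeastAtMost_iff order_refl order_trans)
  have "(h has_vector_derivative (F 1 x - poly Q (of_real x))) (at x within {a..b})"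
    if "x \<in> {a..b}" for x
  proof -
    have "((\<lambda>x. poly R (of_real x)) has_vector_derivative poly Q (of_real x)) (at x within {a..b})"
      using has_vector_derivative_real_field[OF poly_DERIV[of R "of_real x"]] R(1) by simp
    then show ?thesis
      unfolding h_def using Suc.prems(1)[of 0 x] that by (intro has_vector_derivative_diff) auto
  qed
  from norm_diff_le_of_vector_derivative_bound[OF _ this Q(2)]
  have "cmod (h x - h y) \<le> E * \<bar>x - y\<bar>" if "x \<in> {a..b}" "y \<in> {a..b}" for x y
    using that by auto
  from jackson_lipschitz[OF ab this E, of n] obtain P where P: "degree P \<le> 8 * n"
    "\<And>x. x \<in> {a..b} \<Longrightarrow> cmod (h x - poly P (of_real x)) \<le> 130 / real (2 * n + 1) * E"
    by blast
  have "degree (P + R) \<le> 8 * n + Suc m"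
    by (intro degree_add_le) (use P R Q in auto)
  moreover have "cmod (F 0 x - poly (P + R) (of_real x)) \<le> (130 / real (2 * n + 1)) ^ Suc m * B"
    if "x \<in> {a..b}" for x
    using P(2)[OF that] by (simp add: h_def E_def algebra_simps)
  ultimately show ?case by blast
qed

section \<open>Integrals over the half-line depending on a parameter\<close>

text \<open>Dominated convergence for a real parameter tending to a point, obtained
  from the sequential version.\<close>

lemma tendsto_lebesgue_integral_at:
  fixes f :: "real \<Rightarrow> 'a \<Rightarrow> 'b::{banach,second_countable_topology}"
  assumes meas: "eventually (\<lambda>x. f x \<in> borel_measurable M) (at x0 within A)"
      "l \<in> borel_measurable M"
    and ev: "eventually (\<lambda>x. \<forall>u\<in>space M. norm (f x u) \<le> g u) (at x0 within A)"
    and lim: "\<And>u. u \<in> space M \<Longrightarrow> ((\<lambda>x. f x u) \<longlongrightarrow> l u) (at x0 within A)"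
    and g: "integrable M g"
  shows "((\<lambda>x. \<integral>u. f x u \<partial>M) \<longlongrightarrow> (\<integral>u. l u \<partial>M)) (at x0 within A)"
  unfolding tendsto_at_iff_sequentially
proof (intro allI impI)
  fix X :: "nat \<Rightarrow> real" assume X: "\<forall>i. X i \<in> A - {x0}" "X \<longlonglongrightarrow> x0"
  then have F: "filterlim X (at x0 within A) sequentially"
    by (auto simp: filterlim_at)
  from eventually_compose_filterlim[OF eventually_conj[OF meas(1) ev] F] obtain N where
    N: "\<And>n. n \<ge> N \<Longrightarrow> f (X n) \<in> borel_measurable M"
      "\<And>n u. n \<ge> N \<Longrightarrow> u \<in> space M \<Longrightarrow> norm (f (X n) u) \<le> g u"
    unfolding eventually_sequentially by blast
  have "(\<lambda>n. \<integral>u. f (X (n + N)) u \<partial>M) \<longlonglongrightarrow> (\<integral>u. l u \<partial>M)"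
  proof (rule integral_dominated_convergence[where w = g])
    show "AE u in M. (\<lambda>n. f (X (n + N)) u) \<longlonglongrightarrow> l u"
      using LIMSEQ_ignore_initial_segment[OF filterlim_compose[OF lim F]] by (intro AE_I2) auto
  qed (use meas g N in auto)
  then show "((\<lambda>x. \<integral>u. f x u \<partial>M) \<circ> X) \<longlonglongrightarrow> (\<integral>u. l u \<partial>M)"
    unfolding o_def by (rule LIMSEQ_offset)
qed

lemma has_vector_derivative_iff_quotient:
  fixes f :: "real \<Rightarrow> 'a::real_normed_vector"
  shows "(f has_vector_derivative D) (at x) \<longleftrightarrow>
    ((\<lambda>y. (f y - f x) /\<^sub>R (y - x)) \<longlongrightarrow> D) (at x)"
proof -
  have "(f has_vector_derivative D) (at x) \<longleftrightarrow>
      ((\<lambda>y. ((f y - f x) - (y - x) *\<^sub>R D) /\<^sub>R \<bar>y - x\<bar>) \<longlongrightarrow> 0) (at x)"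
    unfolding has_vector_derivative_def has_derivative_at_within
    by (simp add: bounded_linear_scaleR_left diff_diff_eq)
  also have "\<dots> \<longleftrightarrow> ((\<lambda>y. (f y - f x) /\<^sub>R (y - x) - D) \<longlongrightarrow> 0) (at x)"
    unfolding tendsto_norm_zero_iff[symmetric, of "\<lambda>y. ((f y - f x) - (y - x) *\<^sub>R D) /\<^sub>R \<bar>y - x\<bar>"]
      tendsto_norm_zero_iff[symmetric, of "\<lambda>y. (f y - f x) /\<^sub>R (y - x) - D"]
  proof (intro filterlim_cong refl)
    have "norm (((f y - f x) - (y - x) *\<^sub>R D) /\<^sub>R \<bar>y - x\<bar>) = norm ((f y - f x) /\<^sub>R (y - x) - D)"
      if "y \<noteq> x" for y
    proof -
      have "(f y - f x) /\<^sub>R (y - x) - D = ((f y - f x) - (y - x) *\<^sub>R D) /\<^sub>R (y - x)"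
        using that by (simp add: scaleR_diff_right)
      then show ?thesis by simp
    qed
    then show "\<forall>\<^sub>F y in at x. norm (((f y - f x) - (y - x) *\<^sub>R D) /\<^sub>R \<bar>y - x\<bar>)
        = norm ((f y - f x) /\<^sub>R (y - x) - D)"
      by (auto simp: eventually_at intro!: exI[of _ 1])
  qed
  also have "\<dots> \<longleftrightarrow> ((\<lambda>y. (f y - f x) /\<^sub>R (y - x)) \<longlongrightarrow> D) (at x)"
    by (rule LIM_zero_iff)
  finally show ?thesis .
qed

text \<open>Differentiation under the integral sign: the mean value inequality turns the
  majorant of the derivative into a majorant of the difference quotients.\<close>

lemma has_vector_derivative_lebesgue_integral:
  fixes f :: "real \<Rightarrow> 'a \<Rightarrow> 'b::{banach,second_countable_topology}"
  assumes d: "d > 0"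
    and int: "\<And>x. \<bar>x - x0\<bar> < d \<Longrightarrow> integrable M (f x)"
    and deriv: "\<And>x u. \<bar>x - x0\<bar> < d \<Longrightarrow> u \<in> space M \<Longrightarrow>
      ((\<lambda>x. f x u) has_vector_derivative f' x u) (at x)"
    and bound: "\<And>x u. \<bar>x - x0\<bar> < d \<Longrightarrow> u \<in> space M \<Longrightarrow> norm (f' x u) \<le> g u"
    and g: "integrable M g"
    and meas: "f' x0 \<in> borel_measurable M"
  shows "((\<lambda>x. \<integral>u. f x u \<partial>M) has_vector_derivative (\<integral>u. f' x0 u \<partial>M)) (at x0)"
proof -
  have near: "eventually P (at x0)" if "\<And>x. x \<noteq> x0 \<Longrightarrow> \<bar>x - x0\<bar> < d \<Longrightarrow> P x" for P
    unfolding eventually_at using d that by (intro exI[of _ d]) (auto simp: dist_real_def)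
  have "((\<lambda>x. \<integral>u. (f x u - f x0 u) /\<^sub>R (x - x0) \<partial>M) \<longlongrightarrow> (\<integral>u. f' x0 u \<partial>M)) (at x0)"
  proof (rule tendsto_lebesgue_integral_at[OF _ meas _ _ g])
    show "\<forall>\<^sub>F x in at x0. (\<lambda>u. (f x u - f x0 u) /\<^sub>R (x - x0)) \<in> borel_measurable M"
      using int d by (intro near borel_measurable_scaleR borel_measurable_diff borel_measurable_integrable) auto
    show "((\<lambda>x. (f x u - f x0 u) /\<^sub>R (x - x0)) \<longlongrightarrow> f' x0 u) (at x0)" if "u \<in> space M" for u
      using deriv[of x0 u] that d by (simp add: has_vector_derivative_iff_quotient)
    have "norm ((f x u - f x0 u) /\<^sub>R (x - x0)) \<le> g u"
      if "x \<noteq> x0" "\<bar>x - x0\<bar> < d" "u \<in> space M" for x u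
    proof -
      have "norm (f x u - f x0 u) \<le> g u * \<bar>x - x0\<bar>"
        by (rule norm_diff_le_of_vector_derivative_bound[of "ball x0 d"])
           (use that d in \<open>auto simp: dist_real_def abs_minus_commute
              intro!: has_vector_derivative_at_within[OF deriv] bound\<close>)
      then show ?thesis using that by (simp add: divide_simps mult.commute)
    qed
    then show "\<forall>\<^sub>F x in at x0. \<forall>u\<in>space M. norm ((f x u - f x0 u) /\<^sub>R (x - x0)) \<le> g u"
      by (intro near) auto
  qed
  moreover have "\<forall>\<^sub>F x in at x0. (\<integral>u. (f x u - f x0 u) /\<^sub>R (x - x0) \<partial>M)
      = ((\<integral>u. f x u \<partial>M) - (\<integral>u. f x0 u \<partial>M)) /\<^sub>R (x - x0)"
  proof (rule near)
    fix x assume "\<bar>x - x0\<bar> < d"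
    then have "integrable M (f x)" "integrable M (f x0)" using int d by auto
    then show "(\<integral>u. (f x u - f x0 u) /\<^sub>R (x - x0) \<partial>M)
      = ((\<integral>u. f x u \<partial>M) - (\<integral>u. f x0 u \<partial>M)) /\<^sub>R (x - x0)"
      by (simp only: integral_scaleR_right Bochner_Integration.integral_diff)
  qed
  ultimately show ?thesis
    unfolding has_vector_derivative_iff_quotient by (simp only: tendsto_cong)
qed

abbreviation halfline :: "real measure" where
  "halfline \<equiv> restrict_space lborel {0<..}"

lemma continuous_on_measurable_halfline:
  fixes f :: "real \<Rightarrow> 'a::euclidean_space"
  assumes "continuous_on {0<..} f"
  shows "f \<in> borel_measurable halfline"
  using borel_measurable_continuous_on_restrict[OF assms]
    measurable_cong_sets[OF sets_restrict_space_cong[OF sets_lborel] refl] by blast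

lemma integrable_halfline_iff:
  fixes f :: "real \<Rightarrow> 'a::euclidean_space"
  shows "integrable halfline f \<longleftrightarrow> set_integrable lborel {0<..} f"
  by (simp add: integrable_restrict_space set_integrable_def)

lemma integral_halfline_eq:
  fixes f :: "real \<Rightarrow> 'a::euclidean_space"
  shows "integral\<^sup>L halfline f = (LINT u:{0<..}|lborel. f u)"
  by (simp add: integral_restrict_space set_lebesgue_integral_def)

lemma integrable_halfline_bound:
  fixes f :: "real \<Rightarrow> 'a::euclidean_space"
  assumes "integrable halfline g" "continuous_on {0<..} f"
    and "\<And>u. u > 0 \<Longrightarrow> norm (f u) \<le> g u"
  shows "integrable halfline f"
  by (rule Bochner_Integration.integrable_bound[OF assms(1)])
     (use assms in \<open>auto intro!: continuous_on_measurable_halfline AE_I2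
        intro: order_trans[OF _ abs_ge_self]\<close>)

lemma integral_halfline_FTC:
  fixes f F :: "real \<Rightarrow> 'a::euclidean_space"
  assumes deriv: "\<And>u. u > 0 \<Longrightarrow> (F has_vector_derivative f u) (at u)"
    and cont: "continuous_on {0<..} f"
    and int: "integrable halfline f"
    and lim0: "(F \<longlongrightarrow> A) (at_right 0)"
    and liminf: "(F \<longlongrightarrow> B) at_top"
  shows "(\<integral>u. f u \<partial>halfline) = B - A"
proof -
  have e: "einterval 0 \<infinity> = {0<..}" by (metis einterval_eq_Ici zero_ereal_def)
  have "(LBINT x=0..\<infinity>. f x) = B - A"
  proof (rule interval_integral_FTC_integrable)
    show "(0::ereal) < \<infinity>" by simp
    show "set_integrable lborel (einterval 0 \<infinity>) f" using int e by (simp add: integrable_halfline_iff)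
    show "((F \<circ> real_of_ereal) \<longlongrightarrow> A) (at_right 0)" 
      using lim0 unfolding zero_ereal_def ereal_tendsto_simps1 .
    show "((F \<circ> real_of_ereal) \<longlongrightarrow> B) (at_left \<infinity>)"
      using liminf by (simp add: ereal_tendsto_simps1)
    show "isCont f x" if "0 < ereal x" for x
      using cont that by (simp add: continuous_on_eq_continuous_at)
    show "(F has_vector_derivative f x) (at x)" if "0 < ereal x" for x
      using deriv that by simp
  qed
  then show ?thesis
    by (simp add: interval_lebesgue_integral_def e integral_halfline_eq)
qed

text \<open>Every majorant used below is a combination of these integrands.\<close>

lemma Gamma_halfline:
  assumes "a > -1"
  shows "integrable halfline (\<lambda>u. exp (- u) * u powr a)"
    and "(\<integral>u. exp (- u) * u powr a \<partial>halfline) = Gamma (a + 1)"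
proof -
  have cont: "continuous_on {0<..} (\<lambda>u. exp (- u) * u powr a)"
    by (intro continuous_intros) auto
  have eq: "u powr (a + 1 - 1) / exp u = exp (- u) * u powr a" for u
    by (simp add: exp_minus field_simps)
  have I: "((\<lambda>u. exp (- u) * u powr a) has_integral Gamma (a + 1)) {0..}"
    using Gamma_integral_real[of "a + 1"] assms unfolding eq by simp
  have I': "((\<lambda>u. exp (- u) * u powr a) has_integral Gamma (a + 1)) {0<..}"
  proof -
    have "((\<lambda>u. if u \<in> {0<..} then exp (- u) * u powr a else 0) has_integral Gamma (a + 1)) {0..}"
      using I by (rule has_integral_spike [of "{0}", rotated 2]) auto
    then show ?thesis by (subst (asm) has_integral_restrict) auto
  qed
  have "(\<lambda>u. exp (- u) * u powr a) absolutely_integrable_on {0<..}"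
    by (rule nonnegative_absolutely_integrable_1) (use I' in auto)
  then have "set_integrable lborel {0<..} (\<lambda>u. exp (- u) * u powr a)"
    unfolding set_integrable_def
    by (subst integrable_completion[symmetric])
       (auto intro!: borel_measurable_continuous_on_indicator cont)
  then show *: "integrable halfline (\<lambda>u. exp (- u) * u powr a)"
    by (simp add: integrable_halfline_iff)
  show "(\<integral>u. exp (- u) * u powr a \<partial>halfline) = Gamma (a + 1)"
    using set_borel_integral_eq_integral(2)[of "{0<..}" "\<lambda>u. exp (- u) * u powr a"]
      * integral_unique[OF I'] by (simp add: integral_halfline_eq integrable_halfline_iff)
qed

section \<open>The Laplace integral behind the Hankel function\<close>

lemma has_vector_derivative_complex_of_real:
  assumes "(f has_real_derivative D) F"
  shows "((\<lambda>x. complex_of_real (f x)) has_vector_derivative of_real D) F"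
  using bounded_linear.has_vector_derivative[OF bounded_linear_of_real] assms
  unfolding has_real_derivative_iff_has_vector_derivative by blast

text \<open>For \<open>s = 1 / (2 x)\<close> and \<open>a = b = 1 / 2\<close> this is, up to an
  elementary factor, Hankel's integral for \<open>H\<^sub>1 (x)\<close>; the large argument
  \<open>x = \<infinity>\<close> corresponds to \<open>s = 0\<close>. The base is \<open>u s - \<i>\<close> rather than
  \<open>1 + \<i> u s\<close>, so that a real factor relates it to \<open>u - 2 \<i> x\<close> and the complex power
  never meets its branch cut.\<close>

definition hankel_laplace :: "real \<Rightarrow> real \<Rightarrow> real \<Rightarrow> complex" where
  "hankel_laplace a b s =
     (\<integral>u. of_real (exp (- u) * u powr a) * (of_real (u * s) - \<i>) powr of_real b \<partial>halfline)"

lemma shifted_real_not_nonpos [simp]: "of_real x - \<i> \<notin> \<real>\<^sub>\<le>\<^sub>0" "of_real x - \<i> \<noteq> 0"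
  "of_real x * of_real y - \<i> \<notin> \<real>\<^sub>\<le>\<^sub>0" "of_real x * of_real y \<noteq> \<i>"
  by (auto simp: complex_nonpos_Reals_iff complex_eq_iff)

text \<open>The base has modulus at least 1, since its imaginary part is \<open>-1\<close>, so
  that all exponents up to 1 are dominated by the first power.\<close>

lemma norm_shifted_powr_le:
  assumes "b \<le> 1"
  shows "cmod ((of_real x - \<i>) powr of_real b) \<le> 1 + \<bar>x\<bar>"
proof -
  have 1: "1 \<le> cmod (of_real x - \<i>)"
    using abs_Im_le_cmod[of "of_real x - \<i>"] by simp
  have "cmod ((of_real x - \<i>) powr of_real b) = cmod (of_real x - \<i>) powr b"
    by (simp add: norm_powr_real_powr')
  also have "\<dots> \<le> cmod (of_real x - \<i>) powr 1"
    using assms 1 by (intro powr_mono) auto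
  also have "\<dots> \<le> 1 + \<bar>x\<bar>"
    using norm_triangle_ineq4[of "of_real x" \<i>] 1 by simp
  finally show ?thesis .
qed

lemma continuous_on_shifted_powr:
  "continuous_on {0<..} (\<lambda>u. of_real (exp (- u) * u powr a) * (of_real (u * s) - \<i>) powr of_real b)"
  by (intro continuous_intros) auto

lemma hankel_laplace_majorant:
  assumes "a > -1"
  shows "integrable halfline (\<lambda>u. exp (- u) * u powr a * (1 + u * R))"
proof -
  have "integrable halfline (\<lambda>u. exp (- u) * u powr a + R * (exp (- u) * u powr (a + 1)))"
    using assms by (intro Bochner_Integration.integrable_add integrable_mult_right Gamma_halfline) auto
  then show ?thesis
    by (rule Bochner_Integration.integrable_cong[THEN iffD1, rotated 2])
       (auto simp: space_restrict_space powr_add algebra_simps)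
qed

lemma hankel_laplace_integrand_le:
  assumes "b \<le> 1" "u > 0" "\<bar>s\<bar> \<le> R"
  shows "cmod (of_real (exp (- u) * u powr a) * (of_real (u * s) - \<i>) powr of_real b)
           \<le> exp (- u) * u powr a * (1 + u * R)"
proof -
  have "1 + \<bar>u * s\<bar> \<le> 1 + u * R"
    using assms by (simp add: abs_mult)
  with norm_shifted_powr_le[OF assms(1), of "u * s"]
  have "cmod ((of_real (u * s) - \<i>) powr of_real b) \<le> 1 + u * R" by linarith
  then show ?thesis using assms unfolding norm_mult norm_of_real
    by (intro mult_mono) auto
qed

lemma hankel_laplace_integrable:
  assumes "a > -1" "b \<le> 1"
  shows "integrable halfline
    (\<lambda>u. of_real (exp (- u) * u powr a) * (of_real (u * s) - \<i>) powr of_real b :: complex)"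
proof (rule integrable_halfline_bound[OF hankel_laplace_majorant[OF assms(1), of "\<bar>s\<bar>"]
      continuous_on_shifted_powr])
  fix u :: real assume "u > 0"
  with assms show "cmod (of_real (exp (- u) * u powr a) * (of_real (u * s) - \<i>) powr of_real b)
      \<le> exp (- u) * u powr a * (1 + u * \<bar>s\<bar>)"
    by (intro hankel_laplace_integrand_le) auto
qed

text \<open>The derivative stays in the family, with exponents \<open>a + 1\<close> and
  \<open>b - 1\<close>. Hence the integral is a smooth function of \<open>s\<close> on the whole line, including
  \<open>s = 0\<close>, and this one formula yields both the differential equation and the smoothness
  needed for the approximation.\<close>

lemma hankel_laplace_has_vector_derivative:
  assumes "a > -1" "b \<le> 1"
  shows "(hankel_laplace a b has_vector_derivative
           of_real b * hankel_laplace (a + 1) (b - 1) s) (at s)"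
proof -
  have "((\<lambda>s. \<integral>u. of_real (exp (- u) * u powr a) * (of_real (u * s) - \<i>) powr of_real b \<partial>halfline)
     has_vector_derivative
      (\<integral>u. of_real b * (of_real (exp (- u) * u powr (a + 1))
         * (of_real (u * s) - \<i>) powr of_real (b - 1)) \<partial>halfline)) (at s)"
  proof (rule has_vector_derivative_lebesgue_integral[where d = 1 and
        g = "\<lambda>u. \<bar>b\<bar> * (exp (- u) * u powr (a + 1) * (1 + u * (\<bar>s\<bar> + 1)))"])
    show "integrable halfline (\<lambda>u. of_real (exp (- u) * u powr a) * (of_real (u * x) - \<i>) powr of_real b :: complex)" for x
      by (rule hankel_laplace_integrable[OF assms])
    show "integrable halfline (\<lambda>u. \<bar>b\<bar> * (exp (- u) * u powr (a + 1) * (1 + u * (\<bar>s\<bar> + 1))))"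
      using assms by (intro integrable_mult_right hankel_laplace_majorant) auto
    show "(\<lambda>u. of_real b * (of_real (exp (- u) * u powr (a + 1)) *
        (of_real (u * s) - \<i>) powr of_real (b - 1))) \<in> borel_measurable halfline"
      by (intro continuous_on_measurable_halfline continuous_on_mult continuous_on_const continuous_on_shifted_powr)
  next
    fix x u :: real assume x: "\<bar>x - s\<bar> < 1" and "u \<in> space halfline"
    then have u: "u > 0" by (simp add: space_restrict_space)
    have "\<bar>x\<bar> \<le> \<bar>s\<bar> + 1" using x by linarith
    then have "cmod (of_real (exp (- u) * u powr (a + 1)) * (of_real (u * x) - \<i>) powr of_real (b - 1))
      \<le> exp (- u) * u powr (a + 1) * (1 + u * (\<bar>s\<bar> + 1))"
      using assms u by (intro hankel_laplace_integrand_le) auto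
    then show "cmod (of_real b * (of_real (exp (- u) * u powr (a + 1)) * (of_real (u * x) - \<i>) powr of_real (b - 1)))
      \<le> \<bar>b\<bar> * (exp (- u) * u powr (a + 1) * (1 + u * (\<bar>s\<bar> + 1)))"
      unfolding norm_mult[of "of_real b"] norm_of_real by (intro mult_left_mono) auto
    have "((\<lambda>x. of_real (u * x) - \<i>) has_vector_derivative of_real u) (at x)"
      by (auto intro!: derivative_eq_intros)
    from field_vector_diff_chain_at[OF this has_field_derivative_powr[of "of_real (u * x) - \<i>" "of_real b"]]
    have "((\<lambda>x. (of_real (u * x) - \<i>) powr of_real b) has_vector_derivative
      of_real u * (of_real b * (of_real (u * x) - \<i>) powr (of_real b - 1))) (at x)"
      by (simp add: o_def)
    from has_vector_derivative_mult_right[OF this, of "of_real (exp (- u) * u powr a)"]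
    show "((\<lambda>x. of_real (exp (- u) * u powr a) * (of_real (u * x) - \<i>) powr of_real b) has_vector_derivative
      of_real b * (of_real (exp (- u) * u powr (a + 1)) * (of_real (u * x) - \<i>) powr of_real (b - 1))) (at x)"
      using u by (simp add: powr_add algebra_simps)
  qed simp
  then show ?thesis
    unfolding hankel_laplace_def by (subst (asm) integral_mult_right_zero)
qed

text \<open>The boundary terms of \<open>exp (- u) * u powr (a + 1) * (u s - \<i>) powr b\<close>
  vanish at both ends. Together with \<open>hankel_laplace_split\<close> this is a contiguity relation that
  closes the system satisfied by the outgoing pair.\<close>

lemma hankel_laplace_by_parts:
  assumes "a > -1" "b \<le> 1"
  shows "of_real (a + 1) * hankel_laplace a b s - hankel_laplace (a + 1) b s
           + of_real (b * s) * hankel_laplace (a + 1) (b - 1) s = 0"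
proof -
  define w where "w u b = (of_real (u * s) - \<i>) powr of_real b" for u b :: real
  define e where "e a u = complex_of_real (exp (- u) * u powr a)" for a u
  define F where "F u = e (a + 1) u * w u b" for u
  define f where "f u = of_real (a + 1) * (e a u * w u b) - e (a + 1) u * w u b
      + of_real (b * s) * (e (a + 1) u * w u (b - 1))" for u
  have int: "integrable halfline (\<lambda>u. e a' u * w u b')" if "a' > -1" "b' \<le> 1" for a' b'
    using hankel_laplace_integrable[OF that, of s] by (simp add: e_def w_def)
  have "(\<integral>u. f u \<partial>halfline) = 0 - 0"
  proof (rule integral_halfline_FTC)
    show "continuous_on {0<..} f"
      unfolding f_def e_def w_def
      by (intro continuous_on_add continuous_on_diff continuous_on_mult continuous_on_const continuous_on_shifted_powr)
    show "integrable halfline f"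
      unfolding f_def using assms
      by (intro Bochner_Integration.integrable_add Bochner_Integration.integrable_diff
          integrable_mult_right int) auto
    have bnd: "cmod (F u) \<le> exp (- u) * u powr (a + 1) * (1 + u * \<bar>s\<bar>)" if "u > 0" for u
      unfolding F_def e_def w_def using that assms by (intro hankel_laplace_integrand_le) auto
    have "((\<lambda>u. exp (- u) * u powr (a + 1) * (1 + u * \<bar>s\<bar>)) \<longlongrightarrow> 0) (at_right 0)"
      using assms by real_asymp
    then show "(F \<longlongrightarrow> 0) (at_right 0)"
      by (rule Lim_null_comparison[rotated]) (auto simp: eventually_at_right_less bnd intro: eventually_mono[OF eventually_at_right_less])
    have "((\<lambda>u. exp (- u) * u powr (a + 1) * (1 + u * \<bar>s\<bar>)) \<longlongrightarrow> 0) at_top"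
      by real_asymp
    then show "(F \<longlongrightarrow> 0) at_top"
      by (rule Lim_null_comparison[rotated]) (auto simp: bnd intro: eventually_mono[OF eventually_gt_at_top[of 0]])
  next
    fix u :: real assume u: "u > 0"
    have "((\<lambda>u. of_real (u * s) - \<i>) has_vector_derivative of_real s) (at u)"
      by (auto intro!: derivative_eq_intros)
    from field_vector_diff_chain_at[OF this has_field_derivative_powr[of "of_real (u * s) - \<i>" "of_real b"]]
    have w': "((\<lambda>u. w u b) has_vector_derivative of_real s * (of_real b * w u (b - 1))) (at u)"
      by (simp add: o_def w_def)
    have "((\<lambda>u. exp (- u) * u powr (a + 1)) has_real_derivative
        (a + 1) * (exp (- u) * u powr a) - exp (- u) * u powr (a + 1)) (at u)"
      using DERIV_mult[OF DERIV_fun_exp[OF DERIV_minus[OF DERIV_ident]] has_real_derivative_powr[OF u, of "a + 1"]]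
      by (simp add: algebra_simps)
    from has_vector_derivative_complex_of_real[OF this]
    have e': "(e (a + 1) has_vector_derivative (of_real (a + 1) * e a u - e (a + 1) u)) (at u)"
      unfolding e_def by simp
    show "(F has_vector_derivative f u) (at u)"
      unfolding F_def using has_vector_derivative_mult[OF e' w']
      by (rule has_vector_derivative_eq_rhs) (simp add: f_def algebra_simps)
  qed
  also have "(\<integral>u. f u \<partial>halfline) = of_real (a + 1) * hankel_laplace a b s - hankel_laplace (a + 1) b s
           + of_real (b * s) * hankel_laplace (a + 1) (b - 1) s"
    unfolding f_def hankel_laplace_def e_def[symmetric] w_def[symmetric] using int assms by simp
  finally show ?thesis by simp
qed

lemma hankel_laplace_split:
  assumes "a > -1" "b \<le> 1"
  shows "hankel_laplace a b s
    = of_real s * hankel_laplace (a + 1) (b - 1) s - \<i> * hankel_laplace a (b - 1) s"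
proof -
  define w where "w u b = (of_real (u * s) - \<i>) powr of_real b" for u b :: real
  define e where "e a u = complex_of_real (exp (- u) * u powr a)" for a u
  have int: "integrable halfline (\<lambda>u. e a' u * w u b')" if "a' > -1" "b' \<le> 1" for a' b'
    using hankel_laplace_integrable[OF that, of s] by (simp add: e_def w_def)
  have "e a u * w u b = of_real s * (e (a + 1) u * w u (b - 1)) - \<i> * (e a u * w u (b - 1))"
    if "u > 0" for u
  proof -
    have "w u b = (of_real (u * s) - \<i>) * w u (b - 1)"
      unfolding w_def using powr_add[of "of_real (u * s) - \<i>" 1 "of_real (b - 1)"] by simp
    moreover have "e (a + 1) u = of_real u * e a u"
      using that by (simp add: e_def powr_add)
    ultimately show ?thesis by (simp add: left_diff_distrib right_diff_distrib mult_ac)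
  qed
  then have "hankel_laplace a b s
      = (\<integral>u. of_real s * (e (a + 1) u * w u (b - 1)) - \<i> * (e a u * w u (b - 1)) \<partial>halfline)"
    unfolding hankel_laplace_def e_def[symmetric] w_def[symmetric]
    by (intro Bochner_Integration.integral_cong) (auto simp: space_restrict_space)
  also have "\<dots> = of_real s * hankel_laplace (a + 1) (b - 1) s - \<i> * hankel_laplace a (b - 1) s"
    unfolding hankel_laplace_def e_def[symmetric] w_def[symmetric] using int assms by simp
  finally show ?thesis .
qed

section \<open>The outgoing pair of solutions of the Bessel system\<close>

text \<open>This is \<open>\<i> pi / 2 * x * H\<^sub>1 (x)\<close>, or \<open>z K\<^sub>1 (z)\<close> at
  \<open>z = - \<i> x\<close> in terms of the Macdonald function.\<close>

definition outgoing1 :: "real \<Rightarrow> complex" where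
  "outgoing1 x = exp (\<i> * of_real x) * of_real (sqrt (2 * x)) * hankel_laplace (1/2) (1/2) (1 / (2 * x))"

text \<open>This is \<open>\<i> pi / 2 * H\<^sub>0 (x) = K\<^sub>0 (- \<i> x)\<close>. Working with the
  pair of orders 0 and 1 replaces the second-order Bessel equation by a first-order system.\<close>

definition outgoing0 :: "real \<Rightarrow> complex" where
  "outgoing0 x = exp (\<i> * of_real x) * of_real (1 / sqrt (2 * x)) * hankel_laplace (-1/2) (-1/2) (1 / (2 * x))"

lemma outgoing_has_vector_derivative:
  assumes x: "x > 0"
  shows "(outgoing1 has_vector_derivative of_real x * outgoing0 x) (at x)"
    and "(outgoing0 has_vector_derivative - outgoing1 x / of_real x) (at x)"
proof -
  define r where "r = sqrt (2 * x)"
  define s where "s = 1 / (2 * x)"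
  have r: "r > 0" and xr: "x = r\<^sup>2 / 2" and sr: "s = 1 / r\<^sup>2"
    using x by (auto simp: r_def s_def)
  define t0 where "t0 = hankel_laplace (-1/2) (-1/2) s"
  define t1 where "t1 = hankel_laplace (1/2) (1/2) s"
  define V where "V = hankel_laplace (1/2) (-1/2) s"
  define W where "W = hankel_laplace (3/2) (-1/2) s"
  define Z where "Z = hankel_laplace (1/2) (-3/2) s"
  define R where "R = complex_of_real r"
  define S where "S = complex_of_real s"
  have R: "R \<noteq> 0" and S: "S = 1 / R\<^sup>2" using r by (auto simp: R_def S_def sr)
  have V: "V = R\<^sup>2 * t1 + \<i> / 2 * R\<^sup>2 * t0"
  proof -
    define U where "U = hankel_laplace (-1/2) (1/2) s"
    have "U / 2 - t1 + S * V / 2 = 0"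
      using hankel_laplace_by_parts[of "-1/2" "1/2" s] by (simp add: U_def t1_def V_def S_def)
    then have "2 * t1 = U + S * V" by (simp add: field_simps)
    moreover have "U = S * V - \<i> * t0"
      using hankel_laplace_split[of "-1/2" "1/2" s] by (simp add: U_def t0_def V_def S_def)
    ultimately have "2 * t1 + \<i> * t0 = 2 * (S * V)"
      by (simp add: algebra_simps)
    then have "R\<^sup>2 * (2 * t1 + \<i> * t0) = 2 * V" using R by (simp add: S)
    then show ?thesis by (simp add: field_simps)
  qed
  have W: "S * W = t1 + \<i> * V"
    using hankel_laplace_split[of "1/2" "1/2" s]
    by (simp add: t1_def V_def W_def S_def algebra_simps)
  have Z: "S * Z = t0 - 2 * V"
    using hankel_laplace_by_parts[of "-1/2" "-1/2" s]
    by (simp add: t0_def V_def Z_def S_def algebra_simps)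
  have e': "((\<lambda>x. exp (\<i> * of_real x)) has_vector_derivative \<i> * exp (\<i> * of_real x)) (at x)"
    by (rule has_vector_derivative_real_field[where f = "\<lambda>z. exp (\<i> * z)"])
       (auto intro!: derivative_eq_intros)
  have dr: "((\<lambda>x. complex_of_real (sqrt (2 * x))) has_vector_derivative 1 / R) (at x)"
    and dri: "((\<lambda>x. complex_of_real (1 / sqrt (2 * x))) has_vector_derivative - 1 / R ^ 3) (at x)"
  proof -
    have "((\<lambda>x. sqrt (2 * x)) has_real_derivative 1 / r) (at x)"
      using x by (auto intro!: derivative_eq_intros simp: r_def field_simps)
    from has_vector_derivative_complex_of_real[OF this]
    show "((\<lambda>x. complex_of_real (sqrt (2 * x))) has_vector_derivative 1 / R) (at x)"
      by (simp add: R_def)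
    have "((\<lambda>x. 1 / sqrt (2 * x)) has_real_derivative - 1 / r ^ 3) (at x)"
      using x by (auto intro!: derivative_eq_intros simp: r_def field_simps power3_eq_cube)
    from has_vector_derivative_complex_of_real[OF this]
    show "((\<lambda>x. complex_of_real (1 / sqrt (2 * x))) has_vector_derivative - 1 / R ^ 3) (at x)"
      by (simp add: R_def)
  qed
  have ds: "((\<lambda>x. 1 / (2 * x)) has_vector_derivative - 2 * s\<^sup>2) (at x)"
    unfolding has_real_derivative_iff_has_vector_derivative[symmetric]
    using x by (auto intro!: derivative_eq_intros simp: s_def power2_eq_square field_simps)
  have dt1: "((\<lambda>x. hankel_laplace (1/2) (1/2) (1 / (2 * x))) has_vector_derivative - S\<^sup>2 * W) (at x)"
    using vector_diff_chain_at[OF ds hankel_laplace_has_vector_derivative[of "1/2" "1/2"]]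
    by (simp add: o_def s_def[symmetric] W_def S_def scaleR_conv_of_real)
  have dt0: "((\<lambda>x. hankel_laplace (-1/2) (-1/2) (1 / (2 * x))) has_vector_derivative S\<^sup>2 * Z) (at x)"
    using vector_diff_chain_at[OF ds hankel_laplace_has_vector_derivative[of "-1/2" "-1/2"]]
    by (simp add: o_def s_def[symmetric] Z_def S_def scaleR_conv_of_real)
  define E where "E = exp (\<i> * of_real x)"
  have X: "of_real x = R\<^sup>2 / 2" by (simp add: xr R_def)
  have "(outgoing1 has_vector_derivative
      E * R * (- S\<^sup>2 * W) + (E * (1 / R) + \<i> * E * R) * t1) (at x)"
    using has_vector_derivative_mult[OF has_vector_derivative_mult[OF e' dr] dt1]
    unfolding outgoing1_def by (simp add: E_def R_def r_def s_def t1_def)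
  moreover have "E * R * (- S\<^sup>2 * W) + (E * (1 / R) + \<i> * E * R) * t1 = of_real x * outgoing0 x"
  proof -
    have "E * R * (- S\<^sup>2 * W) = - (E * R * (S * (S * W)))" by (simp add: power2_eq_square)
    also have "\<dots> = - (E * R * (S * (t1 + \<i> * V)))" unfolding W ..
    finally have 1: "E * R * (- S\<^sup>2 * W) = - (E * R * (S * (t1 + \<i> * V)))" .
    have 2: "of_real x * outgoing0 x = (R\<^sup>2 / 2) * (E * (1 / R) * t0)"
      by (simp add: outgoing0_def X[symmetric] E_def t0_def s_def[symmetric]) (simp add: R_def r_def)
    show ?thesis
      unfolding 1 2 unfolding V S using R by (simp add: field_simps power2_eq_square)
  qed
  ultimately show "(outgoing1 has_vector_derivative of_real x * outgoing0 x) (at x)" by simp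
  have "(outgoing0 has_vector_derivative
      E * (1 / R) * (S\<^sup>2 * Z) + (E * (- 1 / R ^ 3) + \<i> * E * (1 / R)) * t0) (at x)"
    using has_vector_derivative_mult[OF has_vector_derivative_mult[OF e' dri] dt0]
    unfolding outgoing0_def by (simp add: E_def R_def r_def s_def t0_def)
  moreover have "E * (1 / R) * (S\<^sup>2 * Z) + (E * (- 1 / R ^ 3) + \<i> * E * (1 / R)) * t0 = - outgoing1 x / of_real x"
  proof -
    have 1: "S\<^sup>2 * Z = S * (t0 - 2 * V)" unfolding Z[symmetric] by (simp add: power2_eq_square)
    have 2: "- outgoing1 x / of_real x = - (E * R * t1) / (R\<^sup>2 / 2)"
      by (simp add: outgoing1_def X[symmetric] E_def t1_def s_def[symmetric]) (simp add: R_def r_def)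
    show ?thesis
      unfolding 1 2 unfolding V S using R by (simp add: field_simps power2_eq_square power3_eq_cube)
  qed
  ultimately show "(outgoing0 has_vector_derivative - outgoing1 x / of_real x) (at x)" by simp
qed

text \<open>In the variable \<open>u - 2 \<i> x\<close> the limit \<open>x \<rightarrow> 0\<close> can be taken inside
  the integral, while in the variable \<open>u s - \<i>\<close> it would correspond to \<open>s \<rightarrow> \<infinity>\<close>.\<close>

lemma rescaled_shifted_powr:
  assumes "x > 0"
  shows "of_real ((2 * x) powr b) * (of_real (u * (1 / (2 * x))) - \<i>) powr of_real b
    = (of_real u - 2 * \<i> * of_real x) powr of_real b"
proof -
  have "of_real u - 2 * \<i> * of_real x = of_real (2 * x) * (of_real (u * (1 / (2 * x))) - \<i>)"
    using assms by (simp add: field_simps)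
  then have "(of_real u - 2 * \<i> * of_real x) powr of_real b
    = of_real (2 * x) powr of_real b * (of_real (u * (1 / (2 * x))) - \<i>) powr of_real b"
    using assms by (simp only: powr_times_real_left Reals_of_real Re_complex_of_real less_imp_le zero_less_mult_iff zero_less_numeral)
  then show ?thesis using assms powr_of_real[of "2 * x" b] by simp
qed

lemma outgoing1_tendsto: "(outgoing1 \<longlongrightarrow> 1) (at_right 0)"
proof -
  define f where "f x u = complex_of_real (exp (- u) * u powr (1/2)) * (of_real u - 2 * \<i> * of_real x) powr of_real (1/2)" for x u :: real
  have eq: "outgoing1 x = exp (\<i> * of_real x) * (\<integral>u. f x u \<partial>halfline)" if "x > 0" for x
  proof -
    have "f x u = of_real (sqrt (2 * x)) * (of_real (exp (- u) * u powr (1/2)) * (of_real (u * (1 / (2 * x))) - \<i>) powr of_real (1/2))" for u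
      unfolding f_def rescaled_shifted_powr[OF that, symmetric] using that by (simp add: powr_half_sqrt)
    then show ?thesis
      unfolding outgoing1_def hankel_laplace_def mult.assoc by (simp only: integral_mult_right_zero)
  qed
  have cont: "continuous_on {0<..} (f x)" if "x \<ge> 0" for x
    unfolding f_def using that by (intro continuous_intros) (auto simp: complex_nonpos_Reals_iff complex_eq_iff)
  have "((\<lambda>x. \<integral>u. f x u \<partial>halfline) \<longlongrightarrow> (\<integral>u. of_real (exp (- u) * u powr 1) \<partial>halfline)) (at_right 0)"
  proof (rule tendsto_lebesgue_integral_at[where g = "\<lambda>u. 3 * (exp (- u) * u powr (1/2)) + exp (- u) * u powr (3/2)"])
    show "\<forall>\<^sub>F x in at_right 0. f x \<in> borel_measurable halfline"
      by (rule eventually_mono[OF eventually_at_right_less]) (auto intro!: continuous_on_measurable_halfline cont)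
    show "(\<lambda>u. complex_of_real (exp (- u) * u powr 1)) \<in> borel_measurable halfline"
      by (intro continuous_on_measurable_halfline continuous_intros) auto
    show "integrable halfline (\<lambda>u. 3 * (exp (- u) * u powr (1/2)) + exp (- u) * u powr (3/2))"
      by (intro Bochner_Integration.integrable_add integrable_mult_right Gamma_halfline) auto
    show "((\<lambda>x. f x u) \<longlongrightarrow> of_real (exp (- u) * u powr 1)) (at_right 0)" if "u \<in> space halfline" for u
    proof -
      have u: "u > 0" using that by (simp add: space_restrict_space)
      have "((\<lambda>x. f x u) \<longlongrightarrow> complex_of_real (exp (- u) * u powr (1/2)) * (of_real u - 2 * \<i> * of_real 0) powr of_real (1/2)) (at_right 0)"
        unfolding f_def using u by (intro tendsto_intros) (auto simp: complex_nonpos_Reals_iff)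
      also have "complex_of_real (exp (- u) * u powr (1/2)) * (of_real u - 2 * \<i> * of_real 0) powr of_real (1/2)
        = of_real (exp (- u) * u powr 1)"
        using u powr_add[of u "1/2" "1/2"] powr_of_real[of u "1/2"]
        by (simp flip: of_real_mult)
      finally show ?thesis .
    qed
    have "cmod (f x u) \<le> 3 * (exp (- u) * u powr (1/2)) + exp (- u) * u powr (3/2)" if "0 < x" "x < 1" "u > 0" for x u
    proof -
      have "cmod (of_real u - 2 * \<i> * of_real x) \<le> u + 2"
        using norm_triangle_ineq4[of "of_real u" "2 * \<i> * of_real x"] that by (simp add: norm_mult)
      then have "cmod (of_real u - 2 * \<i> * of_real x) powr (1/2) \<le> (u + 3) powr (1/2)"
        by (intro powr_mono2) auto
      also have "\<dots> \<le> (u + 3) powr 1" using that by (intro powr_mono) auto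
      finally have "cmod (of_real u - 2 * \<i> * of_real x) powr (1/2) \<le> u + 3" using that by simp
      then have "cmod (f x u) \<le> exp (- u) * u powr (1/2) * (u + 3)"
        unfolding f_def norm_mult norm_of_real using that by (simp add: norm_powr_real_powr')
      also have "\<dots> = 3 * (exp (- u) * u powr (1/2)) + exp (- u) * u powr (3/2)"
        using that powr_add[of u 1 "1/2"] by (simp add: algebra_simps)
      finally show ?thesis .
    qed
    then show "\<forall>\<^sub>F x in at_right 0. \<forall>u\<in>space halfline. cmod (f x u) \<le> 3 * (exp (- u) * u powr (1/2)) + exp (- u) * u powr (3/2)"
      unfolding eventually_at by (intro exI[of _ 1]) (auto simp: space_restrict_space)
  qed
  also have "(\<integral>u. complex_of_real (exp (- u) * u powr 1) \<partial>halfline) = 1"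
    using Gamma_halfline(2)[of 1] Gamma_fact[of 1, where 'a = real] by (simp only: integral_complex_of_real) simp
  finally have "((\<lambda>x. exp (\<i> * of_real x) * (\<integral>u. f x u \<partial>halfline)) \<longlongrightarrow> exp (\<i> * of_real 0) * 1) (at_right 0)"
    by (intro tendsto_intros)
  then show ?thesis
    by (rule Lim_transform_eventually[THEN back_subst[of "\<lambda>l. (_ \<longlongrightarrow> l) _"]])
       (auto simp: eq intro: eventually_mono[OF eventually_at_right_less])
qed

section \<open>The logarithmic behaviour at the origin\<close>

lemma abs_ln_le:
  fixes u c :: real
  assumes "u > 0" "c > 0"
  shows "\<bar>ln u\<bar> \<le> u powr (- c) / c + u"
proof -
  have "ln (u powr (- c)) \<le> u powr (- c)" using assms ln_le_minus_one[of "u powr (- c)"] by simp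
  then have 1: "- ln u \<le> u powr (- c) / c"
    using assms by (simp add: ln_powr field_simps)
  have 2: "ln u \<le> u" using ln_le_minus_one[OF assms(1)] by simp
  show ?thesis using 1 2 assms by (smt (verit) divide_nonneg_pos powr_ge_zero)
qed

text \<open>The integral is the derivative of the Gamma integral at 1, and
  \<open>Digamma 1 = - \<gamma>\<close>.\<close>

lemma integral_exp_ln:
  "integrable halfline (\<lambda>u. exp (- u) * ln u)"
  "(\<integral>u. exp (- u) * ln u \<partial>halfline) = - euler_mascheroni"
proof -
  have maj: "integrable halfline (\<lambda>u. 4 * (exp (- u) * u powr (1/4)) + exp (- u) * u powr (3/2)
     + 4 * (exp (- u) * u powr (-3/4)) + exp (- u) * u powr (1/2))"
    by (intro Bochner_Integration.integrable_add integrable_mult_right Gamma_halfline) auto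
  have bnd: "\<bar>exp (- u) * u powr x * ln u\<bar> \<le> 4 * (exp (- u) * u powr (1/4)) + exp (- u) * u powr (3/2)
     + 4 * (exp (- u) * u powr (-3/4)) + exp (- u) * u powr (1/2)" if "u > 0" "\<bar>x\<bar> < 1/2" for x u :: real
  proof -
    \<comment> \<open>Exponents near 0 are dominated by \<open>1/2\<close> for large and by \<open>-1/2\<close> for small \<open>u\<close>.\<close>
    have "u powr x \<le> u powr (1/2) + u powr (-1/2)"
    proof (cases "u \<ge> 1")
      case True
      then have "u powr x \<le> u powr (1/2)" using that by (intro powr_mono) auto
      then show ?thesis by (smt (verit) powr_ge_zero)
    next
      case False
      then have "u powr x \<le> u powr (-1/2)" using that by (intro powr_mono') auto
      then show ?thesis by (smt (verit) powr_ge_zero)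
    qed
    then have "u powr x * \<bar>ln u\<bar> \<le> (u powr (1/2) + u powr (-1/2)) * (u powr (- (1/4)) / (1/4) + u)"
      using abs_ln_le[OF that(1), of "1/4"] by (intro mult_mono) auto
    also have "\<dots> = 4 * u powr (1/4) + u powr (3/2) + 4 * u powr (-3/4) + u powr (1/2)"
      using that powr_add[of u "1/2" "-1/4"] powr_add[of u "1/2" 1] powr_add[of u "-1/2" "-1/4"]
        powr_add[of u "-1/2" 1] by (simp add: algebra_simps)
    finally have "exp (- u) * (u powr x * \<bar>ln u\<bar>)
      \<le> exp (- u) * (4 * u powr (1/4) + u powr (3/2) + 4 * u powr (-3/4) + u powr (1/2))"
      by (intro mult_left_mono) auto
    then show ?thesis using that by (simp add: abs_mult algebra_simps)
  qed
  have cont: "continuous_on {0<..} (\<lambda>u::real. exp (- u) * ln u)"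
    by (intro continuous_intros) auto
  show "integrable halfline (\<lambda>u. exp (- u) * ln u)"
    using bnd[of _ 0] by (intro integrable_halfline_bound[OF maj cont]) auto
  have "((\<lambda>x. \<integral>u. exp (- u) * u powr x \<partial>halfline) has_vector_derivative
       (\<integral>u. exp (- u) * u powr 0 * ln u \<partial>halfline)) (at 0)"
  proof (rule has_vector_derivative_lebesgue_integral[where d = "1/2", OF _ _ _ _ maj])
    show "integrable halfline (\<lambda>u. exp (- u) * u powr x)" if "\<bar>x - 0\<bar> < 1/2" for x
      using that by (intro Gamma_halfline) auto
    show "((\<lambda>x. exp (- u) * u powr x) has_vector_derivative exp (- u) * u powr x * ln u) (at x)"
      if "u \<in> space halfline" for x u
      using that unfolding has_real_derivative_iff_has_vector_derivative[symmetric]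
      by (auto simp: space_restrict_space intro!: derivative_eq_intros)
    show "(\<lambda>u. exp (- u) * u powr 0 * ln u) \<in> borel_measurable halfline"
      by (intro continuous_on_measurable_halfline continuous_intros) auto
  qed (use bnd in \<open>auto simp: space_restrict_space\<close>)
  moreover have "(\<integral>u. exp (- u) * u powr 0 * ln u \<partial>halfline) = (\<integral>u. exp (- u) * ln u \<partial>halfline)"
    by (intro Bochner_Integration.integral_cong) (auto simp: space_restrict_space)
  ultimately have "((\<lambda>x. \<integral>u. exp (- u) * u powr x \<partial>halfline) has_real_derivative
       (\<integral>u. exp (- u) * ln u \<partial>halfline)) (at 0)"
    by (simp add: has_real_derivative_iff_has_vector_derivative)
  then have "((\<lambda>x. Gamma (x + 1)) has_real_derivative (\<integral>u. exp (- u) * ln u \<partial>halfline)) (at 0)"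
    by (rule has_field_derivative_transform_within[where d = 1]) (auto simp: Gamma_halfline(2))
  moreover have "((\<lambda>x. Gamma (x + 1)) has_real_derivative - euler_mascheroni) (at 0)"
    by (rule derivative_eq_intros refl | simp)+
  ultimately show "(\<integral>u. exp (- u) * ln u \<partial>halfline) = - euler_mascheroni"
    by (rule DERIV_unique)
qed


text \<open>An antiderivative of \<open>(u * (u - 2 \<i> x)) powr (- 1 / 2)\<close> in
  \<open>u\<close>. Integrating by parts against it isolates the logarithm of \<open>x\<close> in the boundary
  term at \<open>u = 0\<close> and leaves an integral that converges as \<open>x \<rightarrow> 0\<close>.\<close>

definition log_primitive :: "real \<Rightarrow> real \<Rightarrow> complex" where
  "log_primitive x u = 2 * Ln (of_real (sqrt u) + csqrt (of_real u - 2 * \<i> * of_real x))"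

text \<open>The argument of the logarithm in \<open>log_primitive\<close> lies in the right
  half-plane, with real part at least \<open>2 * sqrt u\<close>. This keeps it off the branch cut and bounds
  the logarithm from below.\<close>

lemma csqrt_shift_Re:
  assumes "x > 0" "u \<ge> 0"
  shows "sqrt u \<le> Re (csqrt (of_real u - 2 * \<i> * of_real x))"
    and "0 < Re (csqrt (of_real u - 2 * \<i> * of_real x))"
proof -
  define z where "z = of_real u - 2 * \<i> * of_real x"
  have "u < cmod z"
    using assms by (auto simp: z_def cmod_def intro!: real_less_rsqrt)
  then have "u < (cmod z + Re z) / 2" "0 < (cmod z + Re z) / 2" using assms by (auto simp: z_def)
  then show "sqrt u \<le> Re (csqrt z)" "0 < Re (csqrt z)" using assms by auto
qed

lemma norm_log_primitive_le:
  assumes x: "0 < x" "x < 1" and u: "u > 0"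
  shows "cmod (log_primitive x u) \<le> 2 * u powr (- 1/2) + 2 * u + 10"
proof -
  define q where "q = csqrt (of_real u - 2 * \<i> * of_real x)"
  define w where "w = of_real (sqrt u) + q"
  have Re: "2 * sqrt u \<le> Re w" using csqrt_shift_Re[of x u] x u by (simp add: w_def q_def)
  have su: "0 < sqrt u" using u by simp
  have w0: "w \<noteq> 0" using Re su by auto
  have low: "ln (sqrt u) \<le> ln (cmod w)"
  proof (rule ln_mono)
    show "sqrt u \<le> cmod w" using Re su complex_Re_le_cmod[of w] by linarith
  qed (use su w0 in auto)
  have "- (u powr (- 1/2)) \<le> ln (sqrt u)"
  proof -
    have "- ln (sqrt u) = ln (u powr (-1/2))" using u by (simp add: ln_sqrt ln_powr)
    also have "\<dots> \<le> u powr (-1/2)" using u ln_le_minus_one[of "u powr (-1/2)"] by simp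
    finally show ?thesis by simp
  qed
  with low have l: "- (u powr (- 1/2)) \<le> ln (cmod w)" by linarith
  have "cmod w \<le> sqrt u + sqrt (u + 2)"
  proof -
    have "cmod (of_real u - 2 * \<i> * of_real x) \<le> u + 2"
      using norm_triangle_ineq4[of "of_real u" "2 * \<i> * of_real x"] x u by (simp add: norm_mult)
    then have "cmod q \<le> sqrt (u + 2)" by (simp add: q_def norm_csqrt)
    then show ?thesis using norm_triangle_ineq[of "of_real (sqrt u)" q] u by (simp add: w_def)
  qed
  also have "\<dots> \<le> 2 * sqrt (u + 2)" by simp
  also have "\<dots> \<le> u + 3"
  proof -
    have "0 \<le> (sqrt (u + 2) - 1)\<^sup>2" by simp
    also have "(sqrt (u + 2) - 1)\<^sup>2 = u + 3 - 2 * sqrt (u + 2)" using u by (simp add: power2_eq_square algebra_simps)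
    finally show ?thesis by simp
  qed
  finally have "cmod w \<le> u + 3" .
  then have r: "ln (cmod w) \<le> u + 3" using ln_le_minus_one[of "cmod w"] w0 by simp
  have "\<bar>Im (Ln w)\<bar> \<le> 2"
    using Re_Ln_pos_le[OF w0] Re su pi_less_4 by auto
  moreover have "\<bar>Re (Ln w)\<bar> \<le> u powr (- 1/2) + u + 3"
    using l r u w0 by (smt (verit) Re_Ln powr_ge_zero)
  ultimately have "cmod (Ln w) \<le> u powr (- 1/2) + u + 5"
    using cmod_le[of "Ln w"] by linarith
  then show ?thesis by (simp add: log_primitive_def w_def q_def norm_mult)
qed

lemma continuous_on_log_primitive:
  assumes "x > 0" shows "continuous_on {0..} (log_primitive x)"
proof -
  have "csqrt (of_real u - 2 * \<i> * of_real x) + of_real (sqrt u) \<notin> \<real>\<^sub>\<le>\<^sub>0" if "u \<ge> 0" for u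
    using csqrt_shift_Re[of x u] assms that by (auto simp: complex_nonpos_Reals_iff)
  moreover have "continuous_on {0..} (\<lambda>u. csqrt (of_real u - 2 * \<i> * of_real x))"
    by (intro continuous_at_imp_continuous_on ballI
          isCont_o2[OF _ DERIV_isCont[OF has_field_derivative_csqrt]])
       (use assms in \<open>auto simp: complex_nonpos_Reals_iff\<close>)
  ultimately show ?thesis unfolding log_primitive_def
    by (intro continuous_intros) (auto simp: add.commute)
qed

lemma log_primitive_has_vector_derivative:
  assumes x: "x > 0" and u: "u > 0"
  shows "(log_primitive x has_vector_derivative
    of_real (u powr (-1/2)) * (of_real u - 2 * \<i> * of_real x) powr of_real (-1/2)) (at u)"
proof -
  define z where "z u = of_real u - 2 * \<i> * of_real x" for u :: real
  define q where "q = csqrt (z u)"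
  define p where "p = complex_of_real (sqrt u)"
  have z: "z u \<notin> \<real>\<^sub>\<le>\<^sub>0" using x by (auto simp: complex_nonpos_Reals_iff z_def)
  have "0 < Re q" using csqrt_shift_Re(2)[of x u] x u unfolding q_def z_def by simp
  then have Re: "0 < Re (p + q)" using u by (simp add: p_def add_pos_pos)
  have nz: "p \<noteq> 0" "q \<noteq> 0" "p + q \<noteq> 0" "p + q \<notin> \<real>\<^sub>\<le>\<^sub>0"
  proof -
    show "p \<noteq> 0" using u by (simp add: p_def)
    show "q \<noteq> 0" using \<open>0 < Re q\<close> by auto
    show "p + q \<noteq> 0" using Re by (metis less_irrefl zero_complex.sel(1))
    show "p + q \<notin> \<real>\<^sub>\<le>\<^sub>0" using Re by (simp add: complex_nonpos_Reals_iff)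
  qed
  have "(z has_vector_derivative 1) (at u)"
    unfolding z_def by (auto intro!: derivative_eq_intros)
  from field_vector_diff_chain_at[OF this has_field_derivative_csqrt[OF z]]
  have dq: "((\<lambda>u. csqrt (z u)) has_vector_derivative 1 / (2 * q)) (at u)"
    by (simp add: o_def q_def inverse_eq_divide)
  have "(sqrt has_real_derivative 1 / (2 * sqrt u)) (at u)"
    using u by (auto intro!: derivative_eq_intros simp: field_simps)
  from has_vector_derivative_add[OF has_vector_derivative_complex_of_real[OF this] dq]
  have "((\<lambda>u. of_real (sqrt u) + csqrt (z u)) has_vector_derivative 1 / (2 * p) + 1 / (2 * q)) (at u)"
    by (simp add: p_def)
  from has_vector_derivative_mult_right[OF field_vector_diff_chain_at[OF this has_field_derivative_Ln], of 2] nz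
  have "((\<lambda>u. 2 * Ln (of_real (sqrt u) + csqrt (z u))) has_vector_derivative
     2 * ((1 / (2 * p) + 1 / (2 * q)) * inverse (p + q))) (at u)"
    by (simp add: o_def p_def q_def)
  moreover have "2 * ((1 / (2 * p) + 1 / (2 * q)) * inverse (p + q)) = 1 / p * (1 / q)"
    using nz by (simp add: field_simps)
  moreover have "1 / p = of_real (u powr (-1/2))"
    using u by (simp add: p_def powr_minus powr_half_sqrt field_simps)
  moreover have "1 / q = z u powr of_real (-1/2)"
    using z by (simp add: q_def csqrt_conv_powr powr_minus field_simps)
  ultimately show ?thesis unfolding log_primitive_def z_def by simp
qed

lemma log_primitive_majorant:
  "integrable halfline (\<lambda>u. exp (- u) * (2 * u powr (- 1/2) + 2 * u + 10))"
proof -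
  have "integrable halfline (\<lambda>u. 2 * (exp (- u) * u powr (-1/2)) + 2 * (exp (- u) * u powr 1)
      + 10 * (exp (- u) * u powr 0))"
    by (intro Bochner_Integration.integrable_add integrable_mult_right Gamma_halfline) auto
  then show ?thesis
    by (rule Bochner_Integration.integrable_cong[THEN iffD1, rotated 2])
       (auto simp: space_restrict_space algebra_simps)
qed

lemma outgoing0_eq_log:
  assumes x: "0 < x" "x < 1"
  shows "outgoing0 x = exp (\<i> * of_real x) *
    ((\<integral>u. of_real (exp (- u)) * log_primitive x u \<partial>halfline) - of_real (ln (2 * x)) + \<i> * of_real (pi / 2))"
proof -
  define A where "A = log_primitive x"
  define f where "f u = of_real (u powr (-1/2)) * (of_real u - 2 * \<i> * of_real x) powr of_real (-1/2)" for u :: real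
  have eqf: "of_real (exp (- u)) * f u = of_real (1 / sqrt (2 * x)) *
      (of_real (exp (- u) * u powr (-1/2)) * (of_real (u * (1 / (2 * x))) - \<i>) powr of_real (-1/2))" for u
    unfolding f_def rescaled_shifted_powr[OF x(1), symmetric] using x
    by (simp add: powr_minus powr_half_sqrt field_simps)
  have intf: "integrable halfline (\<lambda>u. of_real (exp (- u)) * f u)"
    unfolding eqf by (intro integrable_mult_right hankel_laplace_integrable) auto
  have contA: "continuous_on {0<..} A"
    unfolding A_def using continuous_on_log_primitive[OF x(1)] by (rule continuous_on_subset) auto
  have contf: "continuous_on {0<..} f"
    unfolding f_def using x by (intro continuous_intros) (auto simp: complex_nonpos_Reals_iff complex_eq_iff)
  have bA: "cmod (of_real (exp (- u)) * A u) \<le> exp (- u) * (2 * u powr (- 1/2) + 2 * u + 10)" if "u > 0" for u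
    unfolding norm_mult norm_of_real A_def using norm_log_primitive_le[OF x that]
    by (intro mult_mono) auto
  have intA: "integrable halfline (\<lambda>u. of_real (exp (- u)) * A u)"
    by (rule integrable_halfline_bound[OF log_primitive_majorant _ bA])
       (intro continuous_intros contA)
  have A0: "A 0 = of_real (ln (2 * x)) - \<i> * of_real (pi / 2)"
  proof -
    define z where "z = of_real (2 * x) * (- \<i>)"
    have z: "z \<noteq> 0" using x by (simp add: z_def)
    have Lnz: "Ln z = of_real (ln (2 * x)) - \<i> * of_real (pi / 2)"
      unfolding z_def using x Ln_times_of_real[of "2 * x" "- \<i>"] Ln_of_real[of "2 * x"] by simp
    have "A 0 = 2 * Ln (csqrt z)" by (simp add: A_def log_primitive_def z_def mult_ac)
    also have "csqrt z = exp (Ln z / 2)" by (rule csqrt_exp_Ln[OF z])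
    also have "Ln (exp (Ln z / 2)) = Ln z / 2"
      by (rule Ln_exp; simp add: Lnz; use pi_gt_zero in linarith)
    finally have "A 0 = Ln z" by simp
    then show ?thesis unfolding Lnz .
  qed
  have "(\<integral>u. of_real (exp (- u)) * f u - of_real (exp (- u)) * A u \<partial>halfline) = 0 - 1 * A 0"
  proof (rule integral_halfline_FTC[where F = "\<lambda>u. of_real (exp (- u)) * A u"])
    fix u :: real assume u: "u > 0"
    have "((\<lambda>u. exp (- u)) has_real_derivative - exp (- u)) (at u)"
      by (auto intro!: derivative_eq_intros)
    from has_vector_derivative_mult[OF has_vector_derivative_complex_of_real[OF this]
        log_primitive_has_vector_derivative[OF x(1) u]]
    show "((\<lambda>u. of_real (exp (- u)) * A u) has_vector_derivative
        of_real (exp (- u)) * f u - of_real (exp (- u)) * A u) (at u)"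
      by (simp add: A_def f_def)
  next
    have "(A \<longlongrightarrow> A 0) (at_right 0)"
      using continuous_on_log_primitive[OF x(1)] unfolding A_def continuous_on
      by (auto intro: tendsto_within_subset[of _ _ 0 "{0..}"])
    moreover have "((\<lambda>u. complex_of_real (exp (- u))) \<longlongrightarrow> of_real (exp (- 0))) (at_right 0)"
      by (intro tendsto_intros)
    ultimately show "((\<lambda>u. of_real (exp (- u)) * A u) \<longlongrightarrow> 1 * A 0) (at_right 0)"
      by (intro tendsto_mult) auto
    have "((\<lambda>u::real. exp (- u) * (2 * u powr (- 1/2) + 2 * u + 10)) \<longlongrightarrow> 0) at_top"
      by real_asymp
    then show "((\<lambda>u. of_real (exp (- u)) * A u) \<longlongrightarrow> 0) at_top"
      by (rule Lim_null_comparison[rotated]) (rule eventually_mono[OF eventually_gt_at_top[of 0] bA])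
    show "continuous_on {0<..} (\<lambda>u. of_real (exp (- u)) * f u - of_real (exp (- u)) * A u)"
      by (intro continuous_intros contA contf)
    show "integrable halfline (\<lambda>u. of_real (exp (- u)) * f u - of_real (exp (- u)) * A u)"
      by (intro Bochner_Integration.integrable_diff intf intA)
  qed
  then have e1: "(\<integral>u. of_real (exp (- u)) * f u \<partial>halfline) = (\<integral>u. of_real (exp (- u)) * A u \<partial>halfline) - A 0"
    using Bochner_Integration.integral_diff[OF intf intA] by (simp add: algebra_simps)
  have e2: "outgoing0 x = exp (\<i> * of_real x) * (\<integral>u. of_real (exp (- u)) * f u \<partial>halfline)"
    unfolding eqf outgoing0_def hankel_laplace_def mult.assoc by (simp only: integral_mult_right_zero)
  show ?thesis unfolding e2 e1 A0 unfolding A_def by simp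
qed

text \<open>The constant \<open>\<i> pi / 2 - \<gamma>\<close> is what distinguishes the outgoing
  solution from all others with the same logarithmic singularity: it fixes the multiple of the
  regular solution \<open>J\<^sub>0\<close>.\<close>

lemma outgoing0_tendsto:
  "((\<lambda>x. outgoing0 x + of_real (ln (x / 2))) \<longlongrightarrow> \<i> * of_real (pi / 2) - of_real euler_mascheroni) (at_right 0)"
proof -
  define L where "L x = (\<integral>u. of_real (exp (- u)) * log_primitive x u \<partial>halfline)" for x
  define l where "l u = complex_of_real (exp (- u)) * of_real (2 * ln 2 + ln u)" for u :: real
  have "(L \<longlongrightarrow> (\<integral>u. l u \<partial>halfline)) (at_right 0)"
    unfolding L_def
  proof (rule tendsto_lebesgue_integral_at[OF _ _ _ _ log_primitive_majorant])
    show "\<forall>\<^sub>F x in at_right 0. (\<lambda>u. of_real (exp (- u)) * log_primitive x u) \<in> borel_measurable halfline"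
      by (rule eventually_mono[OF eventually_at_right_less])
         (auto intro!: continuous_on_measurable_halfline continuous_intros
            intro: continuous_on_subset[OF continuous_on_log_primitive])
    show "l \<in> borel_measurable halfline"
      unfolding l_def by (intro continuous_on_measurable_halfline continuous_intros) auto
    have "cmod (of_real (exp (- u)) * log_primitive x u) \<le> exp (- u) * (2 * u powr (- 1/2) + 2 * u + 10)"
      if "0 < x" "x < 1" "u > 0" for x u
      unfolding norm_mult norm_of_real using norm_log_primitive_le[OF that]
      by (intro mult_mono) auto
    then show "\<forall>\<^sub>F x in at_right 0. \<forall>u\<in>space halfline. cmod (of_real (exp (- u)) * log_primitive x u)
        \<le> exp (- u) * (2 * u powr (- 1/2) + 2 * u + 10)"
      unfolding eventually_at by (intro exI[of _ 1]) (auto simp: space_restrict_space)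
    show "((\<lambda>x. of_real (exp (- u)) * log_primitive x u) \<longlongrightarrow> l u) (at_right 0)" if "u \<in> space halfline" for u
    proof -
      have u: "u > 0" using that by (simp add: space_restrict_space)
      have csq: "((\<lambda>x. csqrt (of_real u - 2 * \<i> * of_real x)) \<longlongrightarrow> csqrt (of_real u - 2 * \<i> * of_real 0)) (at_right 0)"
      proof (rule isCont_tendsto_compose[OF DERIV_isCont[OF has_field_derivative_csqrt]])
        show "((\<lambda>x. of_real u - 2 * \<i> * of_real x) \<longlongrightarrow> of_real u - 2 * \<i> * of_real 0) (at_right 0)"
          by (intro tendsto_intros)
      qed (use u in \<open>auto simp: complex_nonpos_Reals_iff\<close>)
      have c: "csqrt (of_real u - 2 * \<i> * of_real 0) = of_real (sqrt u)" using u by simp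
      have "((\<lambda>x. of_real (exp (- u)) * log_primitive x u) \<longlongrightarrow>
        of_real (exp (- u)) * (2 * Ln (of_real (sqrt u) + of_real (sqrt u)))) (at_right 0)"
        unfolding log_primitive_def using csq unfolding c
        by (intro tendsto_intros) (use u in \<open>auto simp: complex_nonpos_Reals_iff add_nonneg_eq_0_iff\<close>)
      also have "2 * Ln (of_real (sqrt u) + of_real (sqrt u)) = of_real (2 * ln 2 + ln u)"
      proof -
        have "of_real (sqrt u) + of_real (sqrt u) = complex_of_real (2 * sqrt u)" by simp
        then have "Ln (of_real (sqrt u) + of_real (sqrt u)) = of_real (ln (2 * sqrt u))"
          using u Ln_of_real[of "2 * sqrt u"] by simp
        also have "ln (2 * sqrt u) = ln 2 + ln u / 2" using u by (simp add: ln_mult ln_sqrt)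
        finally show ?thesis by simp
      qed
      finally show ?thesis by (simp add: l_def)
    qed
  qed
  also have "(\<integral>u. l u \<partial>halfline) = of_real (2 * ln 2 - euler_mascheroni)"
  proof -
    have "(\<integral>u. 2 * ln 2 * (exp (- u) * u powr 0) + exp (- u) * ln u \<partial>halfline) = 2 * ln 2 * 1 + - euler_mascheroni"
      using Gamma_halfline[of 0] integral_exp_ln by (subst Bochner_Integration.integral_add) auto
    moreover have "(\<integral>u. l u \<partial>halfline) = of_real (\<integral>u. 2 * ln 2 * (exp (- u) * u powr 0) + exp (- u) * ln u \<partial>halfline)"
      unfolding integral_complex_of_real[symmetric] l_def
      by (intro Bochner_Integration.integral_cong) (auto simp: space_restrict_space algebra_simps)
    ultimately show ?thesis by simp
  qed
  finally have L: "(L \<longlongrightarrow> of_real (2 * ln 2 - euler_mascheroni)) (at_right 0)" .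
  \<comment> \<open>The exponential prefactor differs from 1 by \<open>O(x)\<close>, which beats the logarithm.\<close>
  have small: "((\<lambda>x. (1 - exp (\<i> * of_real x)) * of_real (ln (2 * x))) \<longlongrightarrow> 0) (at_right 0)"
  proof (rule Lim_null_comparison)
    have "cmod ((1 - exp (\<i> * of_real x)) * of_real (ln (2 * x))) \<le> x * \<bar>ln (2 * x)\<bar>" if "x > 0" for x
    proof -
      have "cmod (exp (\<i> * of_real x) - 1) \<le> \<bar>x\<bar>"
        using abs_sin_x_le_abs_x[of "x / 2"] by (simp add: dist_exp_i_1)
      then show ?thesis using that unfolding norm_mult norm_of_real by (intro mult_right_mono) (auto simp: norm_minus_commute)
    qed
    then show "\<forall>\<^sub>F x in at_right 0. cmod ((1 - exp (\<i> * of_real x)) * of_real (ln (2 * x))) \<le> x * \<bar>ln (2 * x)\<bar>"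
      by (auto intro: eventually_mono[OF eventually_at_right_less])
    show "((\<lambda>x::real. x * \<bar>ln (2 * x)\<bar>) \<longlongrightarrow> 0) (at_right 0)" by real_asymp
  qed
  have "((\<lambda>x. exp (\<i> * of_real x) * (L x + \<i> * of_real (pi / 2)) + (1 - exp (\<i> * of_real x)) * of_real (ln (2 * x))
      - of_real (2 * ln 2)) \<longlongrightarrow>
      exp (\<i> * of_real 0) * (of_real (2 * ln 2 - euler_mascheroni) + \<i> * of_real (pi / 2)) + 0 - of_real (2 * ln 2)) (at_right 0)"
    by (intro tendsto_intros L small)
  then have lim: "((\<lambda>x. exp (\<i> * of_real x) * (L x + \<i> * of_real (pi / 2)) + (1 - exp (\<i> * of_real x)) * of_real (ln (2 * x))
      - of_real (2 * ln 2)) \<longlongrightarrow> \<i> * of_real (pi / 2) - of_real euler_mascheroni) (at_right 0)"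
    by (simp add: algebra_simps)
  have eq: "exp (\<i> * of_real x) * (L x + \<i> * of_real (pi / 2)) + (1 - exp (\<i> * of_real x)) * of_real (ln (2 * x))
      - of_real (2 * ln 2) = outgoing0 x + of_real (ln (x / 2))" if "0 < x" "x < 1" for x
  proof -
    have "complex_of_real (ln (x / 2)) = of_real (ln (2 * x)) - of_real (2 * ln 2)"
      using that by (simp add: ln_div ln_mult)
    then show ?thesis unfolding outgoing0_eq_log[OF that] L_def by (simp add: algebra_simps)
  qed
  show ?thesis
    by (rule Lim_transform_eventually[OF lim])
       (use eq in \<open>auto simp: eventually_at intro!: exI[of _ 1]\<close>)
qed

section \<open>Bessel series and their derivatives with respect to the order\<close>

lemma rGamma_plus_nat_le:
  assumes s: "(s::real) > 0"
  shows "\<bar>rGamma (real m + s)\<bar> \<le> rGamma s / min 1 s"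
proof -
  have g: "rGamma s > 0" using s by (simp add: rGamma_inverse_Gamma Gamma_real_pos)
  have p: "min 1 s \<le> pochhammer s m"
  proof (induction m)
    case (Suc m)
    show ?case
    proof (cases m)
      case 0
      then show ?thesis by simp
    next
      case (Suc m')
      have "min 1 s * 1 \<le> pochhammer s m * (s + real m)"
        using Suc.IH s \<open>m = Suc m'\<close> by (intro mult_mono) auto
      then show ?thesis by (simp add: pochhammer_Suc)
    qed
  qed auto
  have pp: "pochhammer s m > 0" using p s by (smt (verit) min_less_iff_conj)
  have "rGamma s = pochhammer s m * rGamma (s + real m)"
    by (rule pochhammer_rGamma)
  then have "\<bar>rGamma (real m + s)\<bar> = rGamma s / pochhammer s m"
    using pp g by (simp add: field_simps zero_less_mult_iff)
  also have "\<dots> \<le> rGamma s / min 1 s" using p g s by (intro divide_left_mono) auto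
  finally show ?thesis .
qed

lemma abs_Digamma_plus_nat_le:
  assumes s: "(s::real) > 0"
  shows "\<bar>Digamma (real m + s)\<bar> \<le> \<bar>Digamma s\<bar> + real m / s"
proof (induction m)
  case (Suc m)
  have "Digamma (real (Suc m) + s) = Digamma (real m + s) + 1 / (real m + s)"
    using Digamma_plus1[of "real m + s"] s by (simp add: algebra_simps)
  moreover have "1 / (real m + s) \<le> 1 / s" using s by (intro divide_left_mono) auto
  moreover have "0 \<le> 1 / (real m + s)" using s by simp
  moreover have "real (Suc m) / s = real m / s + 1 / s" by (simp add: add_divide_distrib)
  ultimately show ?case using Suc by linarith
qed simp

text \<open>Termwise differentiation with respect to the order. On a compact
  interval of positive \<open>s\<close> the factors \<open>rGamma (m + s)\<close> are bounded uniformly in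
  \<open>m\<close>, and \<open>Digamma (m + s)\<close> grows at most linearly in \<open>m\<close>.\<close>

lemma rGamma_series_has_derivative:
  fixes c :: "nat \<Rightarrow> real"
  assumes c: "summable (\<lambda>m. \<bar>c m\<bar> * (real m + 1))" and s: "s > 0"
  shows "((\<lambda>s. \<Sum>m. c m * rGamma (real m + s)) has_real_derivative
           (\<Sum>m. - c m * rGamma (real m + s) * Digamma (real m + s))) (at s)"
    and "summable (\<lambda>m. c m * rGamma (real m + s))"
proof -
  define I where "I = {s/2..s+1}"
  have pos: "t > 0" if "t \<in> I" for t using that s by (simp add: I_def)
  have "bounded ((\<lambda>t. rGamma t / min 1 t) ` I)"
    by (intro compact_imp_bounded compact_continuous_image continuous_intros)
       (use pos s in \<open>auto simp: I_def min_def\<close>)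
  then obtain A where A: "\<And>t. t \<in> I \<Longrightarrow> \<bar>rGamma t / min 1 t\<bar> \<le> A"
    unfolding bounded_iff by auto
  have "bounded (Digamma ` I)"
    by (intro compact_imp_bounded compact_continuous_image continuous_on_Polygamma)
       (use pos in \<open>force simp: I_def elim!: nonpos_Ints_cases\<close>)+
  then obtain B where B: "\<And>t. t \<in> I \<Longrightarrow> \<bar>Digamma t\<bar> \<le> B"
    unfolding bounded_iff by auto
  have sI: "s \<in> I" using s by (simp add: I_def)
  have A0: "A \<ge> 0" using A[OF sI] by linarith
  have B0: "B \<ge> 0" using B[OF sI] by linarith
  define Q where "Q = B + 2 / s"
  have bnd: "\<bar>c m * rGamma (real m + t)\<bar> \<le> A * (\<bar>c m\<bar> * (real m + 1))"
       "\<bar>- c m * rGamma (real m + t) * Digamma (real m + t)\<bar> \<le> A * Q * (\<bar>c m\<bar> * (real m + 1))"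
     if t: "t \<in> I" for m t
  proof -
    have r: "\<bar>rGamma (real m + t)\<bar> \<le> A"
      using rGamma_plus_nat_le[OF pos[OF t], of m] A[OF t] by linarith
    have "real m / t \<le> real m / (s / 2)"
      using t s by (intro divide_left_mono) (auto simp: I_def)
    then have "\<bar>Digamma (real m + t)\<bar> \<le> B + real m * (2 / s)"
      using abs_Digamma_plus_nat_le[OF pos[OF t], of m] B[OF t] by simp
    also have "\<dots> \<le> B * (real m + 1) + (2 / s) * (real m + 1)"
    proof (rule add_mono)
      show "B \<le> B * (real m + 1)" using B0 by (simp add: algebra_simps)
      show "real m * (2 / s) \<le> (2 / s) * (real m + 1)"
        unfolding mult.commute[of "real m"] using s by (intro mult_left_mono) auto
    qed
    finally have d: "\<bar>Digamma (real m + t)\<bar> \<le> Q * (real m + 1)" by (simp add: Q_def algebra_simps)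
    show "\<bar>c m * rGamma (real m + t)\<bar> \<le> A * (\<bar>c m\<bar> * (real m + 1))"
    proof -
      have "\<bar>c m\<bar> * \<bar>rGamma (real m + t)\<bar> \<le> (\<bar>c m\<bar> * (real m + 1)) * A"
        using r by (intro mult_mono) (auto simp: algebra_simps)
      then show ?thesis by (simp add: abs_mult mult.commute)
    qed
    have "\<bar>c m\<bar> * (\<bar>rGamma (real m + t)\<bar> * \<bar>Digamma (real m + t)\<bar>) \<le> \<bar>c m\<bar> * (A * (Q * (real m + 1)))"
      using r d A0 by (intro mult_left_mono mult_mono) auto
    then show "\<bar>- c m * rGamma (real m + t) * Digamma (real m + t)\<bar> \<le> A * Q * (\<bar>c m\<bar> * (real m + 1))"
      by (simp add: abs_mult mult_ac)
  qed
  show sm: "summable (\<lambda>m. c m * rGamma (real m + s))"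
    using bnd(1)[OF sI] by (intro summable_comparison_test'[OF summable_mult[OF c, of A]]) auto
  show "((\<lambda>s. \<Sum>m. c m * rGamma (real m + s)) has_real_derivative
           (\<Sum>m. - c m * rGamma (real m + s) * Digamma (real m + s))) (at s)"
  proof (rule has_field_derivative_series'(2)[of I _ _ s])
    show "convex I" by (simp add: I_def)
    show "uniformly_convergent_on I (\<lambda>n x. \<Sum>i<n. - c i * rGamma (real i + x) * Digamma (real i + x))"
      using bnd(2) by (intro Weierstrass_m_test'[OF _ summable_mult[OF c, of "A * Q"]]) auto
    show "((\<lambda>s. c m * rGamma (real m + s)) has_real_derivative - c m * rGamma (real m + t) * Digamma (real m + t)) (at t within I)"
      if "t \<in> I" for m t
    proof -
      have "real m + t \<notin> \<int>\<^sub>\<le>\<^sub>0" using pos[OF that] by (auto elim!: nonpos_Ints_cases)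
      then show ?thesis by (auto intro!: derivative_eq_intros)
    qed
    show "s \<in> interior I" using s by (simp add: I_def)
  qed (use sI sm in auto)
qed

text \<open>Coefficients in the variable \<open>q = - x\<^sup>2 / 4\<close> of
  \<open>(x / 2) powr (- n) * J\<^sub>n (x)\<close>.\<close>

definition bessel_coeff :: "nat \<Rightarrow> nat \<Rightarrow> real" where
  "bessel_coeff n m = 1 / (fact m * fact (m + n))"

text \<open>The derivative of \<open>rGamma (m + \<nu> + 1) / fact m\<close> with respect to the
  order \<open>\<nu>\<close> at \<open>\<nu> = n\<close>.\<close>

definition bessel_dcoeff :: "nat \<Rightarrow> nat \<Rightarrow> real" where
  "bessel_dcoeff n m = - Digamma (real (m + n) + 1) / (fact m * fact (m + n))"

definition bessel_series :: "nat \<Rightarrow> real \<Rightarrow> real" where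
  "bessel_series n q = (\<Sum>m. bessel_coeff n m * q ^ m)"

definition bessel_dseries :: "nat \<Rightarrow> real \<Rightarrow> real" where
  "bessel_dseries n q = (\<Sum>m. bessel_dcoeff n m * q ^ m)"

lemma summable_of_fact_bound:
  fixes c :: "nat \<Rightarrow> real"
  assumes "\<And>m. \<bar>c m\<bar> \<le> B / fact m"
  shows "summable (\<lambda>m. c m * q ^ m)"
proof (rule summable_comparison_test'[OF summable_mult[OF summable_exp[of "\<bar>q\<bar>"], of B]])
  fix m
  have "\<bar>c m\<bar> * \<bar>q\<bar> ^ m \<le> B / fact m * \<bar>q\<bar> ^ m"
    using assms by (intro mult_right_mono) auto
  then show "norm (c m * q ^ m) \<le> B * (inverse (fact m) * \<bar>q\<bar> ^ m)"
    by (simp add: abs_mult power_abs field_simps)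
qed

lemma abs_bessel_coeff_le: "\<bar>bessel_coeff n m\<bar> \<le> 1 / fact m"
  unfolding bessel_coeff_def by (auto intro!: divide_left_mono mult_mono simp: fact_ge_1)

lemma abs_bessel_dcoeff_le: "\<bar>bessel_dcoeff n m\<bar> \<le> 2 / fact m"
proof -
  have "\<bar>Digamma (real (m + n) + 1)\<bar> \<le> 1 + real (m + n)"
    using abs_Digamma_plus_nat_le[of 1 "m + n"] euler_mascheroni_less_13_over_22 euler_mascheroni_pos by simp
  also have "\<dots> \<le> 2 * fact (m + n)"
  proof -
    have "real (m + n) \<le> fact (m + n)"
      using of_nat_mono[OF fact_ge_self[of "m + n"], where 'a = real] by (simp only: of_nat_fact)
    moreover have "(1::real) \<le> fact (m + n)" by (rule fact_ge_1)
    ultimately show ?thesis by linarith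
  qed
  finally have "\<bar>Digamma (real (m + n) + 1)\<bar> / (fact m * fact (m + n)) \<le> 2 * fact (m + n) / (fact m * fact (m + n))"
    by (intro divide_right_mono) auto
  then show ?thesis by (simp add: bessel_dcoeff_def abs_mult)
qed

lemma summable_bessel_series:
  "summable (\<lambda>m. bessel_coeff n m * q ^ m)" "summable (\<lambda>m. bessel_dcoeff n m * q ^ m)"
  by (rule summable_of_fact_bound[OF abs_bessel_coeff_le], rule summable_of_fact_bound[OF abs_bessel_dcoeff_le])

lemma shifted_power_series_has_derivative:
  fixes c :: "nat \<Rightarrow> real"
  assumes "\<And>q. summable (\<lambda>m. c m * q ^ m)"
  shows "((\<lambda>q. q * (\<Sum>m. c m * q ^ m)) has_real_derivative (\<Sum>m. (real m + 1) * c m * q ^ m)) (at q)"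
proof -
  define d where "d m = (case m of 0 \<Rightarrow> 0 | Suc k \<Rightarrow> c k)" for m
  have sd: "(\<lambda>m. d m * q ^ m) sums (q * (\<Sum>m. c m * q ^ m))" for q
  proof -
    have "(\<lambda>m. q * (c m * q ^ m)) sums (q * (\<Sum>m. c m * q ^ m))"
      using assms by (intro sums_mult summable_sums)
    then have "(\<lambda>m. d (Suc m) * q ^ Suc m) sums (q * (\<Sum>m. c m * q ^ m))"
      by (simp add: d_def mult_ac)
    then show ?thesis by (subst (asm) sums_Suc_iff) (simp add: d_def)
  qed
  have "((\<lambda>q. \<Sum>m. d m * q ^ m) has_real_derivative (\<Sum>m. diffs d m * q ^ m)) (at q)"
    by (rule termdiffs_strong_converges_everywhere) (use sd in \<open>blast intro: sums_summable\<close>)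
  moreover have "diffs d m = (real m + 1) * c m" for m by (simp add: diffs_def d_def)
  ultimately show ?thesis using sums_unique[OF sd] by simp
qed

lemma bessel_series_has_derivative:
  "(bessel_series 0 has_real_derivative bessel_series 1 q) (at q)"
  "(bessel_dseries 0 has_real_derivative bessel_dseries 1 q) (at q)"
  "((\<lambda>q. q * bessel_series 1 q) has_real_derivative bessel_series 0 q) (at q)"
  "((\<lambda>q. q * bessel_dseries 1 q) has_real_derivative bessel_dseries 0 q - bessel_series 1 q) (at q)"
proof -
  have pos: "real m + 1 \<noteq> 0" for m by simp
  have fact1: "fact (m + 1) = (real m + 1) * fact m" for m by simp
  have "diffs (bessel_coeff 0) = bessel_coeff 1" "diffs (bessel_dcoeff 0) = bessel_dcoeff 1"
    using pos by (auto simp: diffs_def bessel_coeff_def bessel_dcoeff_def fun_eq_iff divide_simps add_ac)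
  then show "(bessel_series 0 has_real_derivative bessel_series 1 q) (at q)"
       "(bessel_dseries 0 has_real_derivative bessel_dseries 1 q) (at q)"
    unfolding bessel_series_def bessel_dseries_def
    using termdiffs_strong_converges_everywhere[of "bessel_coeff 0" q]
      termdiffs_strong_converges_everywhere[of "bessel_dcoeff 0" q] by (auto simp: summable_bessel_series)
  have "(real m + 1) * bessel_coeff 1 m = bessel_coeff 0 m" for m
    using pos[of m] unfolding bessel_coeff_def fact1 by (simp add: divide_simps)
  then show "((\<lambda>q. q * bessel_series 1 q) has_real_derivative bessel_series 0 q) (at q)"
    using shifted_power_series_has_derivative[of "bessel_coeff 1" q] summable_bessel_series
    unfolding bessel_series_def by simp
  have dig: "Digamma (real m + 2) = Digamma (real m + 1) + 1 / (real m + 1)" for m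
    using Digamma_plus1[of "real m + 1"] by (simp add: algebra_simps)
  have "(real m + 1) * bessel_dcoeff 1 m = bessel_dcoeff 0 m - bessel_coeff 1 m" for m
    using dig[of m] pos[of m] unfolding bessel_coeff_def bessel_dcoeff_def fact1
    by (simp add: divide_simps) (simp add: algebra_simps)
  then have "(\<Sum>m. (real m + 1) * bessel_dcoeff 1 m * q ^ m) = bessel_dseries 0 q - bessel_series 1 q"
    unfolding bessel_series_def bessel_dseries_def
    by (simp add: left_diff_distrib suminf_diff[OF summable_bessel_series(2) summable_bessel_series(1)])
  then show "((\<lambda>q. q * bessel_dseries 1 q) has_real_derivative bessel_dseries 0 q - bessel_series 1 q) (at q)"
    using shifted_power_series_has_derivative[of "bessel_dcoeff 1" q] summable_bessel_series
    unfolding bessel_dseries_def by simp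
qed

lemma bessel_series_at_0: "bessel_series 0 0 = 1" "bessel_dseries 0 0 = euler_mascheroni"
  unfolding bessel_series_def bessel_dseries_def
  by (subst powser_zero, simp add: bessel_coeff_def bessel_dcoeff_def)+

text \<open>The energy \<open>k\<^sup>2 + (n / x)\<^sup>2\<close> has derivative
  \<open>- 2 n\<^sup>2 / x\<^sup>3 \<le> 0\<close> and tends to 0 at the origin; for \<open>n / x\<close> this follows from
  \<open>n' = x * k\<close> by the rule of l'Hospital. A nonincreasing nonnegative function with limit 0 at the
  left end vanishes, on the whole half-line at once.\<close>

lemma bessel_ode_unique:
  fixes k n :: "real \<Rightarrow> real"
  assumes k: "\<And>x. x > 0 \<Longrightarrow> (k has_real_derivative - n x / x) (at x)"
    and n: "\<And>x. x > 0 \<Longrightarrow> (n has_real_derivative x * k x) (at x)"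
    and lim: "(k \<longlongrightarrow> 0) (at_right 0)" "(n \<longlongrightarrow> 0) (at_right 0)"
    and x: "x > 0"
  shows "n x = 0"
proof -
  define E where "E x = (k x)\<^sup>2 + (n x / x)\<^sup>2" for x
  have E': "\<exists>y. (E has_real_derivative y) (at t) \<and> y \<le> 0" if "t > 0" for t
  proof (intro exI conjI)
    show "(E has_real_derivative - 2 * (n t)\<^sup>2 / t ^ 3) (at t)"
      unfolding E_def using that
      by (auto intro!: derivative_eq_intros k n simp: field_simps power2_eq_square power3_eq_cube)
    show "- 2 * (n t)\<^sup>2 / t ^ 3 \<le> 0" using that by simp
  qed
  have mono: "E x \<le> E y" if "0 < y" "y \<le> x" for y
    by (rule DERIV_nonpos_imp_nonincreasing[OF that(2)]) (use E' that in auto)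
  have "((\<lambda>x. n x / x) \<longlongrightarrow> 0) (at_right 0)"
  proof (rule lhopital_right_0)
    show "\<forall>\<^sub>F x::real in at_right 0. x \<noteq> 0"
      by (rule eventually_mono[OF eventually_at_right_less]) auto
    show "\<forall>\<^sub>F x in at_right 0. (n has_real_derivative x * k x) (at x)"
      using n by (auto intro: eventually_mono[OF eventually_at_right_less])
    have "((\<lambda>x. x * k x / 1) \<longlongrightarrow> 0 * 0 / 1) (at_right 0)" by (intro tendsto_intros lim) auto
    then show "((\<lambda>x. x * k x / 1) \<longlongrightarrow> 0) (at_right 0)" by simp
  qed (use lim in \<open>auto intro!: derivative_eq_intros tendsto_intros simp: eventually_at_right_less\<close>)
  then have "(E \<longlongrightarrow> 0\<^sup>2 + 0\<^sup>2) (at_right 0)"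
    unfolding E_def by (intro tendsto_intros lim)
  then have "E x \<le> 0\<^sup>2 + 0\<^sup>2"
    by (rule tendsto_lowerbound)
       (use mono x in \<open>auto simp: eventually_at intro!: exI[of _ x]\<close>)
  then show ?thesis using x by (simp add: E_def sum_power2_le_zero_iff)
qed

section \<open>The Bessel functions of order one as power series\<close>

text \<open>Summability is a hypothesis so that the formula serves positive and negative
  orders alike.\<close>

lemma Bessel_J_eq:
  assumes x: "x > 0" and sm: "summable (\<lambda>m. (- x\<^sup>2 / 4) ^ m / fact m * rGamma (real m + (\<nu> + 1)))"
  shows "Bessel_J \<nu> x = (x / 2) powr \<nu> *
    (\<Sum>m. (- x\<^sup>2 / 4) ^ m / fact m * rGamma (real m + (\<nu> + 1)))"
proof -
  have eq: "(-1) ^ m / fact m * rGamma (real m + \<nu> + 1) * (x / 2) powr (2 * real m + \<nu>)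
     = (x / 2) powr \<nu> * ((- x\<^sup>2 / 4) ^ m / fact m * rGamma (real m + (\<nu> + 1)))" for m
  proof -
    have "(x / 2) powr (2 * real m + \<nu>) = ((x / 2)\<^sup>2) ^ m * (x / 2) powr \<nu>"
      using x powr_realpow[of "x / 2" "2 * m"] by (simp add: powr_add power_mult)
    moreover have "(- x\<^sup>2 / 4) ^ m = (-1) ^ m * ((x / 2)\<^sup>2) ^ m"
      unfolding power_mult_distrib[symmetric] by (simp add: power_divide)
    ultimately show ?thesis by (simp only: add.assoc) (simp add: mult_ac)
  qed
  show ?thesis unfolding Bessel_J_def eq by (rule suminf_mult[OF sm])
qed

lemma summable_exp_linear: "summable (\<lambda>m. \<bar>q ^ m / fact m\<bar> * (real m + 1))" for q :: real
proof (rule summable_comparison_test'[OF summable_exp[of "2 * \<bar>q\<bar>"]])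
  fix m
  have "real m + 1 \<le> 2 ^ m"
    using of_nat_mono[of "Suc m" "2 ^ m", where 'a = real] less_exp[of m] by (simp add: Suc_le_eq add.commute)
  then have "\<bar>q\<bar> ^ m / fact m * (real m + 1) \<le> \<bar>q\<bar> ^ m / fact m * 2 ^ m"
    by (intro mult_left_mono) auto
  then show "norm (\<bar>q ^ m / fact m\<bar> * (real m + 1)) \<le> inverse (fact m) * (2 * \<bar>q\<bar>) ^ m"
    by (simp add: power_abs power_mult_distrib field_simps)
qed

text \<open>The coefficients of the series of order \<open>- \<mu>\<close> after its first term
  is split off.\<close>

lemma summable_exp_shifted: "summable (\<lambda>m. \<bar>q ^ Suc m / fact (Suc m)\<bar> * (real m + 1))" for q :: real
proof (rule summable_cong[THEN iffD1, OF _ summable_mult[OF summable_exp[of "\<bar>q\<bar>"], of "\<bar>q\<bar>"]])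
  have "\<bar>q\<bar> * (inverse (fact m) * \<bar>q\<bar> ^ m) = \<bar>q ^ Suc m / fact (Suc m)\<bar> * (real m + 1)" for m
  proof -
    define a where "a = real m + 1"
    have f: "fact (Suc m) = a * fact m" and a: "a > 0" by (simp_all add: a_def algebra_simps)
    show ?thesis unfolding f a_def[symmetric] using a by (simp add: abs_mult power_abs field_simps)
  qed
  then show "\<forall>\<^sub>F m in sequentially. \<bar>q\<bar> * (inverse (fact m) * \<bar>q\<bar> ^ m) = \<bar>q ^ Suc m / fact (Suc m)\<bar> * (real m + 1)"
    by simp
qed

lemma rGamma_nat_eq: "rGamma (real m + 1) = 1 / fact m" "rGamma (real m + 2) = 1 / fact (m + 1)"
  using Gamma_fact[of m, where 'a = real] Gamma_fact[of "m + 1", where 'a = real]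
  by (simp_all add: rGamma_inverse_Gamma inverse_eq_divide add_ac)

lemma Bessel_J_1:
  assumes "x > 0"
  shows "Bessel_J 1 x = (x / 2) * bessel_series 1 (- x\<^sup>2 / 4)"
proof -
  have eq: "(- x\<^sup>2 / 4) ^ m / fact m * rGamma (real m + (1 + 1)) = bessel_coeff 1 m * (- x\<^sup>2 / 4) ^ m" for m
    using rGamma_nat_eq(2)[of m] by (simp add: bessel_coeff_def)
  show ?thesis
    using Bessel_J_eq[OF assms, of 1] assms summable_bessel_series unfolding eq bessel_series_def by simp
qed

text \<open>The numerator in Weber's formula vanishes at order 1, and the limit is the
  quotient of derivatives with respect to the order. For orders near \<open>-1\<close> the first term
  of the series contains \<open>rGamma (1 - \<mu>)\<close> at a pole of Gamma. It is split off and written as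
  \<open>(1 - \<mu>) * rGamma (2 - \<mu>)\<close>, so that Digamma is evaluated only at positive arguments.\<close>

lemma Bessel_Y_1:
  assumes x: "x > 0"
  defines "q \<equiv> - x\<^sup>2 / 4"
  shows "Bessel_Y 1 x = (1 / pi) * (x * ln (x / 2) * bessel_series 1 q
           + x * bessel_dseries 1 q - 2 / x * bessel_series 0 q)"
proof -
  define y where "y = x / 2"
  have y: "y > 0" and qy: "q = - y\<^sup>2" using x by (auto simp: y_def q_def power_divide)
  define U1 where "U1 s = (\<Sum>m. q ^ m / fact m * rGamma (real m + s))" for s
  define U2 where "U2 s = (\<Sum>m. q ^ Suc m / fact (Suc m) * rGamma (real m + s))" for s
  define b0 where "b0 = bessel_series 0 q"
  define b1 where "b1 = bessel_series 1 q"
  define d1 where "d1 = bessel_dseries 1 q"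
  note U1s = rGamma_series_has_derivative[OF summable_exp_linear, of _ q]
  note U2s = rGamma_series_has_derivative[OF summable_exp_shifted, of _ q]
  have fact1: "fact (Suc m) = (real m + 1) * fact m" for m by (simp add: algebra_simps)

  have "U1 2 = b1"
    unfolding U1_def b1_def bessel_series_def
    by (rule suminf_cong) (simp only: rGamma_nat_eq, simp add: bessel_coeff_def)
  moreover have "(\<Sum>m. - (q ^ m / fact m) * rGamma (real m + 2) * Digamma (real m + 2)) = d1"
    unfolding d1_def bessel_dseries_def
    by (rule suminf_cong) (simp only: rGamma_nat_eq, simp add: bessel_dcoeff_def add_ac)
  ultimately have U1: "U1 2 = b1" "(U1 has_real_derivative d1) (at 2)"
    using U1s(1)[of 2] unfolding U1_def by simp_all

  have U2_1: "U2 1 = q * b1"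
  proof -
    have "U2 1 = (\<Sum>m. q * (bessel_coeff 1 m * q ^ m))"
      unfolding U2_def by (rule suminf_cong) (simp only: rGamma_nat_eq, simp add: bessel_coeff_def)
    then show ?thesis unfolding b1_def bessel_series_def by (simp add: suminf_mult summable_bessel_series)
  qed
  have U2': "(U2 has_real_derivative (q * d1 + (b0 - 1))) (at 1)"
  proof -
    have eq: "- (q ^ Suc m / fact (Suc m)) * rGamma (real m + 1) * Digamma (real m + 1)
      = q * (bessel_dcoeff 1 m * q ^ m) + bessel_coeff 0 (Suc m) * q ^ Suc m" for m
    proof -
      define a where "a = real m + 1"
      have a: "a > 0" by (simp add: a_def)
      have f: "fact (Suc m) = a * fact m" unfolding a_def by (rule fact1)
      have "Digamma (real (Suc m) + 1) = Digamma a + 1 / a"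
        using a Digamma_plus1[of a] by (simp add: a_def add_ac)
      then have d: "bessel_dcoeff 1 m = - (Digamma a + 1 / a) / (fact m * (a * fact m))"
        by (simp only: bessel_dcoeff_def f flip: Suc_eq_plus1)
      have c: "bessel_coeff 0 (Suc m) = 1 / ((a * fact m) * (a * fact m))"
        unfolding bessel_coeff_def using f by simp
      show ?thesis
        unfolding rGamma_nat_eq(1) unfolding c d f a_def[symmetric] using a by (simp add: field_simps)
    qed
    have "(\<lambda>m. bessel_coeff 0 (Suc m) * q ^ Suc m) sums (b0 - bessel_coeff 0 0 * q ^ 0)"
      unfolding b0_def bessel_series_def
      by (subst sums_Suc_iff) (simp add: summable_sums summable_bessel_series)
    moreover have "(\<lambda>m. q * (bessel_dcoeff 1 m * q ^ m)) sums (q * d1)"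
      unfolding d1_def bessel_dseries_def by (intro sums_mult summable_sums summable_bessel_series)
    ultimately have "(\<lambda>m. q * (bessel_dcoeff 1 m * q ^ m) + bessel_coeff 0 (Suc m) * q ^ Suc m) sums (q * d1 + (b0 - 1))"
      using sums_add by (fastforce simp: bessel_coeff_def)
    then have "(\<Sum>m. - (q ^ Suc m / fact (Suc m)) * rGamma (real m + 1) * Digamma (real m + 1)) = q * d1 + (b0 - 1)"
      unfolding eq by (rule sums_unique[symmetric])
    then show ?thesis using U2s(1)[of 1] unfolding U2_def by simp
  qed

  \<comment> \<open>Weber's numerator near order 1, with both Bessel series in differentiable form.\<close>
  define N where "N \<mu> = y powr \<mu> * U1 (\<mu> + 1) * cos (\<mu> * pi)
    - y powr (- \<mu>) * ((1 - \<mu>) * rGamma (2 - \<mu>) + U2 (2 - \<mu>))" for \<mu>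
  have N: "Bessel_J \<mu> x * cos (\<mu> * pi) - Bessel_J (- \<mu>) x = N \<mu>" if "0 < \<mu>" "\<mu> < 2" for \<mu>
  proof -
    have "Bessel_J \<mu> x = y powr \<mu> * U1 (\<mu> + 1)"
      using Bessel_J_eq[OF x, of \<mu>] U1s(2)[of "\<mu> + 1"] that
      unfolding U1_def q_def[symmetric] y_def by simp
    moreover have "Bessel_J (- \<mu>) x = y powr (- \<mu>) * ((1 - \<mu>) * rGamma (2 - \<mu>) + U2 (2 - \<mu>))"
    proof -
      define f where "f m = q ^ m / fact m * rGamma (real m + (- \<mu> + 1))" for m
      have fS: "f (Suc m) = q ^ Suc m / fact (Suc m) * rGamma (real m + (2 - \<mu>))" for m
      proof -
        have "real (Suc m) + (- \<mu> + 1) = real m + (2 - \<mu>)" by simp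
        then show ?thesis unfolding f_def by (simp only:)
      qed
      have sS: "summable (\<lambda>m. f (Suc m))" unfolding fS using U2s(2)[of "2 - \<mu>"] that by simp
      then have sf: "summable f" by (subst (asm) summable_Suc_iff)
      have "suminf f = U2 (2 - \<mu>) + f 0"
        using suminf_split_head[OF sf] unfolding fS U2_def by simp
      moreover have "f 0 = (1 - \<mu>) * rGamma (2 - \<mu>)"
        using rGamma_plus1[of "1 - \<mu>"] by (simp add: f_def)
      ultimately show ?thesis
        using Bessel_J_eq[OF x, of "- \<mu>"] sf unfolding f_def q_def[symmetric] y_def by (simp add: add.commute)
    qed
    ultimately show ?thesis by (simp add: N_def)
  qed
  define D where "D = - 2 * y * ln y * b1 - 2 * y * d1 + b0 / y"
  have N1: "N 1 = 0"
    using y by (simp add: N_def U1 U2_1 qy powr_minus field_simps power2_eq_square)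
  have N': "(N has_real_derivative D) (at 1)"
  proof -
    have c1: "((\<lambda>\<mu>. U1 (\<mu> + 1)) has_real_derivative d1) (at 1)"
      using U1(2) DERIV_shift[of U1 d1 1 1] by simp
    have c2: "((\<lambda>\<mu>. U2 (2 - \<mu>)) has_real_derivative - (q * d1 + (b0 - 1))) (at 1)"
    proof -
      have "((\<lambda>\<mu>. U2 (2 - \<mu>)) has_real_derivative (q * d1 + (b0 - 1)) * - 1) (at 1)"
        by (rule DERIV_chain2[where f = U2 and g = "\<lambda>\<mu>. 2 - \<mu>"])
           (use U2' in \<open>auto intro!: derivative_eq_intros\<close>)
      then show ?thesis by simp
    qed
    have c3: "((\<lambda>\<mu>::real. rGamma (2 - \<mu>)) has_real_derivative rGamma 1 * Digamma 1) (at 1)"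
      by (auto intro!: derivative_eq_intros)
    have "(N has_real_derivative (y powr 1 * ln y * U1 2 + d1 * y powr 1) * cos (1 * pi)
       - (- (y powr (-1) * ln y) * ((1 - 1) * rGamma 1 + U2 1)
          + y powr (-1) * (- 1 * rGamma 1 + - (q * d1 + (b0 - 1))))) (at 1)"
      unfolding N_def using y
      by (auto intro!: derivative_eq_intros c1 c2 c3 simp: algebra_simps)
    then show ?thesis
      by (rule DERIV_cong) (use y in \<open>simp add: U1 U2_1 D_def qy powr_minus field_simps power2_eq_square\<close>)
  qed
  have "((\<lambda>\<mu>. ((N \<mu> - N 1) / (\<mu> - 1)) / ((sin (\<mu> * pi) - sin (1 * pi)) / (\<mu> - 1))) \<longlongrightarrow> D / (cos (1 * pi) * pi)) (at 1)"
  proof (intro tendsto_divide)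
    show "((\<lambda>\<mu>. (N \<mu> - N 1) / (\<mu> - 1)) \<longlongrightarrow> D) (at 1)"
      using N' by (simp add: has_field_derivative_iff)
    have "((\<lambda>\<mu>. sin (\<mu> * pi)) has_real_derivative cos (1 * pi) * pi) (at 1)"
      by (auto intro!: derivative_eq_intros)
    then show "((\<lambda>\<mu>. (sin (\<mu> * pi) - sin (1 * pi)) / (\<mu> - 1)) \<longlongrightarrow> cos (1 * pi) * pi) (at 1)"
      unfolding has_field_derivative_iff .
  qed simp
  then have lim: "((\<lambda>\<mu>. N \<mu> / sin (\<mu> * pi)) \<longlongrightarrow> - D / pi) (at 1)"
    by (rule Lim_transform_eventually[THEN back_subst[of "\<lambda>l. (_ \<longlongrightarrow> l) _"]])
       (auto simp: N1 eventually_at intro!: exI[of _ 1])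
  have "((\<lambda>\<mu>. (Bessel_J \<mu> x * cos (\<mu> * pi) - Bessel_J (- \<mu>) x) / sin (\<mu> * pi)) \<longlongrightarrow> - D / pi) (at 1)"
    by (rule Lim_transform_eventually[OF lim])
       (auto simp: eventually_at N dist_real_def intro!: exI[of _ 1])
  then have "Bessel_Y 1 x = - D / pi"
    unfolding Bessel_Y_def Let_def by (simp add: tendsto_Lim)
  also have "\<dots> = (1 / pi) * (x * ln (x / 2) * b1 + x * d1 - 2 / x * b0)"
    using x by (simp add: D_def y_def field_simps)
  finally show ?thesis by (simp add: b0_def b1_def d1_def)
qed

section \<open>Identification of the Hankel function with the Laplace integral\<close>

text \<open>The series for \<open>\<i> pi / 2 * H\<^sub>0 (x)\<close>, the counterpart of
  \<open>outgoing0\<close>.\<close>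

definition hankel_series0 :: "real \<Rightarrow> complex" where
  "hankel_series0 x = (let q = - x\<^sup>2 / 4 in
     of_real (- ln (x / 2) * bessel_series 0 q - bessel_dseries 0 q) + \<i> * of_real (pi / 2 * bessel_series 0 q))"

text \<open>The series for \<open>\<i> pi / 2 * x * H\<^sub>1 (x)\<close>, the counterpart of
  \<open>outgoing1\<close>.\<close>

definition hankel_series1 :: "real \<Rightarrow> complex" where
  "hankel_series1 x = (let q = - x\<^sup>2 / 4 in
     of_real (2 * ln (x / 2) * (q * bessel_series 1 q) + 2 * (q * bessel_dseries 1 q) + bessel_series 0 q)
       - \<i> * of_real (pi * (q * bessel_series 1 q)))"

lemma hankel_series1_eq_Hankel1:
  assumes x: "x > 0"
  shows "hankel_series1 x = \<i> * of_real (pi / 2 * x) * Hankel1 1 x"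
proof -
  define y where "y = x / 2"
  have y: "y > 0" "x = 2 * y" using x by (auto simp: y_def)
  have q: "- x\<^sup>2 / 4 = - y\<^sup>2" by (simp add: y)
  have d: "2 * y / 2 = y" by simp
  show ?thesis
    unfolding hankel_series1_def Hankel1_def Bessel_J_1[OF x] Bessel_Y_1[OF x] q Let_def
    unfolding y(2) d using y(1)
    by (simp add: complex_eq_iff field_simps power2_eq_square)
qed

text \<open>The same system as for the outgoing pair. Real and imaginary parts are
  separated because the uniqueness lemma is about real functions.\<close>

lemma hankel_series_has_derivative:
  assumes x: "x > 0"
  shows "((\<lambda>x. Re (hankel_series0 x)) has_real_derivative - Re (hankel_series1 x) / x) (at x)"
    and "((\<lambda>x. Im (hankel_series0 x)) has_real_derivative - Im (hankel_series1 x) / x) (at x)"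
    and "((\<lambda>x. Re (hankel_series1 x)) has_real_derivative x * Re (hankel_series0 x)) (at x)"
    and "((\<lambda>x. Im (hankel_series1 x)) has_real_derivative x * Im (hankel_series0 x)) (at x)"
proof -
  have q': "((\<lambda>x::real. - x\<^sup>2 / 4) has_real_derivative - x / 2) (at x)"
    by (auto intro!: derivative_eq_intros)
  define B0 where "B0 = (\<lambda>x. bessel_series 0 (- x\<^sup>2 / 4))"
  define B1 where "B1 = (\<lambda>x. bessel_series 1 (- x\<^sup>2 / 4))"
  define D0 where "D0 = (\<lambda>x. bessel_dseries 0 (- x\<^sup>2 / 4))"
  define D1 where "D1 = (\<lambda>x. bessel_dseries 1 (- x\<^sup>2 / 4))"
  define P where "P = (\<lambda>x. - x\<^sup>2 / 4 * bessel_series 1 (- x\<^sup>2 / 4))"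
  define R where "R = (\<lambda>x. - x\<^sup>2 / 4 * bessel_dseries 1 (- x\<^sup>2 / 4))"
  have D: "(B0 has_real_derivative B1 x * (- x / 2)) (at x)"
    "(D0 has_real_derivative D1 x * (- x / 2)) (at x)"
    "(P has_real_derivative B0 x * (- x / 2)) (at x)"
    "(R has_real_derivative (D0 x - B1 x) * (- x / 2)) (at x)"
    unfolding B0_def B1_def D0_def D1_def P_def R_def
    using DERIV_chain2[OF bessel_series_has_derivative(1) q']
      DERIV_chain2[OF bessel_series_has_derivative(2) q']
      DERIV_chain2[OF bessel_series_has_derivative(3) q']
      DERIV_chain2[OF bessel_series_has_derivative(4) q'] by blast+
  have l: "((\<lambda>x. ln (x / 2)) has_real_derivative 1 / x) (at x)"
    using x by (auto intro!: derivative_eq_intros)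
  have PR: "P x = - x * x / 4 * B1 x" "R x = - x * x / 4 * D1 x"
    by (simp_all add: P_def R_def B1_def D1_def power2_eq_square)
  have eq: "Re (hankel_series0 x) = - ln (x / 2) * B0 x - D0 x" "Im (hankel_series0 x) = pi / 2 * B0 x"
    "Re (hankel_series1 x) = 2 * ln (x / 2) * P x + 2 * R x + B0 x" "Im (hankel_series1 x) = - pi * P x" for x
    by (simp_all add: hankel_series0_def hankel_series1_def Let_def B0_def D0_def P_def R_def)
  show "((\<lambda>x. Re (hankel_series0 x)) has_real_derivative - Re (hankel_series1 x) / x) (at x)"
    "((\<lambda>x. Im (hankel_series0 x)) has_real_derivative - Im (hankel_series1 x) / x) (at x)"
    "((\<lambda>x. Re (hankel_series1 x)) has_real_derivative x * Re (hankel_series0 x)) (at x)"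
    "((\<lambda>x. Im (hankel_series1 x)) has_real_derivative x * Im (hankel_series0 x)) (at x)"
    unfolding eq using x
    by (auto intro!: derivative_eq_intros D l simp: PR field_simps)
qed

lemma bessel_series_compose_tendsto:
  "((\<lambda>x. bessel_series n (- x\<^sup>2 / 4)) \<longlongrightarrow> bessel_series n 0) (at_right 0)"
  "((\<lambda>x. bessel_dseries n (- x\<^sup>2 / 4)) \<longlongrightarrow> bessel_dseries n 0) (at_right 0)"
proof -
  have cont: "isCont (bessel_series n) 0" "isCont (bessel_dseries n) 0"
    unfolding bessel_series_def bessel_dseries_def
    by (rule isCont_powser_converges_everywhere summable_bessel_series)+
  have q: "((\<lambda>x::real. - x\<^sup>2 / 4) \<longlongrightarrow> - 0\<^sup>2 / 4) (at_right 0)" by (intro tendsto_intros) auto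
  show "((\<lambda>x. bessel_series n (- x\<^sup>2 / 4)) \<longlongrightarrow> bessel_series n 0) (at_right 0)"
    using isCont_tendsto_compose[OF _ q, of "bessel_series n"] cont by simp
  show "((\<lambda>x. bessel_dseries n (- x\<^sup>2 / 4)) \<longlongrightarrow> bessel_dseries n 0) (at_right 0)"
    using isCont_tendsto_compose[OF _ q, of "bessel_dseries n"] cont by simp
qed

lemma hankel_series1_tendsto: "(hankel_series1 \<longlongrightarrow> 1) (at_right 0)"
proof -
  have ln0: "((\<lambda>x::real. ln (x / 2) * (- x\<^sup>2 / 4)) \<longlongrightarrow> 0) (at_right 0)" by real_asymp
  have q0: "((\<lambda>x::real. - x\<^sup>2 / 4) \<longlongrightarrow> 0) (at_right 0)" by real_asymp
  have "((\<lambda>x. of_real (2 * ((ln (x / 2) * (- x\<^sup>2 / 4)) * bessel_series 1 (- x\<^sup>2 / 4))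
      + 2 * (- x\<^sup>2 / 4 * bessel_dseries 1 (- x\<^sup>2 / 4)) + bessel_series 0 (- x\<^sup>2 / 4))
      - \<i> * of_real (pi * (- x\<^sup>2 / 4 * bessel_series 1 (- x\<^sup>2 / 4))))
     \<longlongrightarrow> of_real (2 * (0 * bessel_series 1 0) + 2 * (0 * bessel_dseries 1 0) + bessel_series 0 0)
        - \<i> * of_real (pi * (0 * bessel_series 1 0))) (at_right 0)"
    by (intro tendsto_intros ln0 q0 bessel_series_compose_tendsto)
  moreover have "hankel_series1 = (\<lambda>x. of_real (2 * ((ln (x / 2) * (- x\<^sup>2 / 4)) * bessel_series 1 (- x\<^sup>2 / 4))
      + 2 * (- x\<^sup>2 / 4 * bessel_dseries 1 (- x\<^sup>2 / 4)) + bessel_series 0 (- x\<^sup>2 / 4))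
      - \<i> * of_real (pi * (- x\<^sup>2 / 4 * bessel_series 1 (- x\<^sup>2 / 4))))"
    by (simp add: fun_eq_iff hankel_series1_def Let_def)
  ultimately show ?thesis by (simp add: bessel_series_at_0)
qed

text \<open>The logarithm is multiplied by \<open>1 - J\<^sub>0 (x)\<close>, which is of order
  \<open>x\<^sup>2\<close>, so that only the constant terms survive.\<close>

lemma hankel_series0_tendsto:
  "((\<lambda>x. hankel_series0 x + of_real (ln (x / 2))) \<longlongrightarrow> \<i> * of_real (pi / 2) - of_real euler_mascheroni) (at_right 0)"
proof -
  have slope: "((\<lambda>q. (bessel_series 0 q - 1) / q) \<longlongrightarrow> bessel_series 1 0) (at 0)"
    using bessel_series_has_derivative(1)[of 0] by (simp add: has_field_derivative_iff bessel_series_at_0)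
  have q: "filterlim (\<lambda>x::real. - x\<^sup>2 / 4) (at 0) (at_right 0)" by real_asymp
  have ln0: "((\<lambda>x::real. ln (x / 2) * (- x\<^sup>2 / 4)) \<longlongrightarrow> 0) (at_right 0)" by real_asymp
  have "((\<lambda>x. of_real (- ((ln (x / 2) * (- x\<^sup>2 / 4)) * ((bessel_series 0 (- x\<^sup>2 / 4) - 1) / (- x\<^sup>2 / 4)))
      - bessel_dseries 0 (- x\<^sup>2 / 4)) + \<i> * of_real (pi / 2 * bessel_series 0 (- x\<^sup>2 / 4))) \<longlongrightarrow>
      of_real (- (0 * bessel_series 1 0) - bessel_dseries 0 0) + \<i> * of_real (pi / 2 * bessel_series 0 0)) (at_right 0)"
    by (intro tendsto_intros ln0 filterlim_compose[OF slope q] bessel_series_compose_tendsto)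
  then have lim: "((\<lambda>x. of_real (- ((ln (x / 2) * (- x\<^sup>2 / 4)) * ((bessel_series 0 (- x\<^sup>2 / 4) - 1) / (- x\<^sup>2 / 4)))
      - bessel_dseries 0 (- x\<^sup>2 / 4)) + \<i> * of_real (pi / 2 * bessel_series 0 (- x\<^sup>2 / 4))) \<longlongrightarrow>
      \<i> * of_real (pi / 2) - of_real euler_mascheroni) (at_right 0)"
    by (simp add: bessel_series_at_0)
  show ?thesis
  proof (rule Lim_transform_eventually[OF lim])
    have "of_real (- ((ln (x / 2) * (- x\<^sup>2 / 4)) * ((bessel_series 0 (- x\<^sup>2 / 4) - 1) / (- x\<^sup>2 / 4)))
      - bessel_dseries 0 (- x\<^sup>2 / 4)) + \<i> * of_real (pi / 2 * bessel_series 0 (- x\<^sup>2 / 4))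
       = hankel_series0 x + of_real (ln (x / 2))" if "x > 0" for x
    proof -
      have "(ln (x / 2) * (- x\<^sup>2 / 4)) * ((bessel_series 0 (- x\<^sup>2 / 4) - 1) / (- x\<^sup>2 / 4))
         = ln (x / 2) * (bessel_series 0 (- x\<^sup>2 / 4) - 1)" using that by simp
      then show ?thesis unfolding hankel_series0_def Let_def by (simp only:) (simp add: algebra_simps)
    qed
    then show "\<forall>\<^sub>F x in at_right 0. of_real (- ((ln (x / 2) * (- x\<^sup>2 / 4)) * ((bessel_series 0 (- x\<^sup>2 / 4) - 1) / (- x\<^sup>2 / 4)))
      - bessel_dseries 0 (- x\<^sup>2 / 4)) + \<i> * of_real (pi / 2 * bessel_series 0 (- x\<^sup>2 / 4))
       = hankel_series0 x + of_real (ln (x / 2))"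
      by (rule eventually_mono[OF eventually_at_right_less])
  qed
qed

text \<open>The differences of the two pairs solve the system and tend to zero at the
  origin.\<close>

lemma Hankel1_1_eq_outgoing1:
  assumes x: "x > 0"
  shows "\<i> * of_real (pi / 2 * x) * Hankel1 1 x = outgoing1 x"
proof -
  have d: "((\<lambda>x. Re (f x)) has_real_derivative Re D) (at t)" "((\<lambda>x. Im (f x)) has_real_derivative Im D) (at t)"
    if "(f has_vector_derivative D) (at t)" for f D t
    using bounded_linear.has_vector_derivative[OF bounded_linear_Re that]
      bounded_linear.has_vector_derivative[OF bounded_linear_Im that]
    by (simp_all add: has_real_derivative_iff_has_vector_derivative)
  have lim1: "((\<lambda>x. outgoing1 x - hankel_series1 x) \<longlongrightarrow> 0) (at_right 0)"
    using tendsto_diff[OF outgoing1_tendsto hankel_series1_tendsto] by simp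
  have lim0: "((\<lambda>x. outgoing0 x - hankel_series0 x) \<longlongrightarrow> 0) (at_right 0)"
    using tendsto_diff[OF outgoing0_tendsto hankel_series0_tendsto] by simp
  have "Re (outgoing1 x) - Re (hankel_series1 x) = 0"
  proof (rule bessel_ode_unique[where k = "\<lambda>x. Re (outgoing0 x) - Re (hankel_series0 x)" and x = x])
    show "((\<lambda>x. Re (outgoing0 x) - Re (hankel_series0 x)) has_real_derivative - (Re (outgoing1 t) - Re (hankel_series1 t)) / t) (at t)"
      if "t > 0" for t
      using DERIV_diff[OF d(1)[OF outgoing_has_vector_derivative(2)[OF that]] hankel_series_has_derivative(1)[OF that]]
      by (simp add: diff_divide_distrib)
    show "((\<lambda>x. Re (outgoing1 x) - Re (hankel_series1 x)) has_real_derivative t * (Re (outgoing0 t) - Re (hankel_series0 t))) (at t)"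
      if "t > 0" for t
      using DERIV_diff[OF d(1)[OF outgoing_has_vector_derivative(1)[OF that]] hankel_series_has_derivative(3)[OF that]]
      by (simp add: right_diff_distrib)
  qed (use tendsto_Re[OF lim0] tendsto_Re[OF lim1] x in simp_all)
  moreover have "Im (outgoing1 x) - Im (hankel_series1 x) = 0"
  proof (rule bessel_ode_unique[where k = "\<lambda>x. Im (outgoing0 x) - Im (hankel_series0 x)" and x = x])
    show "((\<lambda>x. Im (outgoing0 x) - Im (hankel_series0 x)) has_real_derivative - (Im (outgoing1 t) - Im (hankel_series1 t)) / t) (at t)"
      if "t > 0" for t
      using DERIV_diff[OF d(2)[OF outgoing_has_vector_derivative(2)[OF that]] hankel_series_has_derivative(2)[OF that]]
      by (simp add: diff_divide_distrib)
    show "((\<lambda>x. Im (outgoing1 x) - Im (hankel_series1 x)) has_real_derivative t * (Im (outgoing0 t) - Im (hankel_series0 t))) (at t)"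
      if "t > 0" for t
      using DERIV_diff[OF d(2)[OF outgoing_has_vector_derivative(1)[OF that]] hankel_series_has_derivative(4)[OF that]]
      by (simp add: right_diff_distrib)
  qed (use tendsto_Im[OF lim0] tendsto_Im[OF lim1] x in simp_all)
  ultimately have "outgoing1 x = hankel_series1 x" by (simp add: complex_eq_iff)
  then show ?thesis using hankel_series1_eq_Hankel1[OF x] by simp
qed

section \<open>Integral operators whose kernel is supported near the diagonal\<close>

lemma window_kernel_integrable:
  fixes \<kappa> g :: "real \<Rightarrow> complex"
  assumes [measurable]: "\<kappa> \<in> borel_measurable borel" and g: "g \<in> L2_fun"
    and bound: "\<And>r. cmod (\<kappa> r) \<le> B" and supp: "\<And>r. r > 1 \<Longrightarrow> \<kappa> r = 0"
  shows "integrable lborel (\<lambda>y. \<kappa> \<bar>x - y\<bar> * g y)"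
proof -
  have [measurable]: "g \<in> borel_measurable lborel" and gi: "integrable lborel (\<lambda>y. (cmod (g y))\<^sup>2)"
    using g by (auto simp: L2_fun_def)
  have B: "B \<ge> 0" using bound[of 0] norm_ge_zero order_trans by blast
  have "integrable lborel (\<lambda>y. B * (indicator {x-1..x+1} y + (cmod (g y))\<^sup>2))"
    by (intro integrable_mult_right Bochner_Integration.integrable_add gi) auto
  then show ?thesis
  proof (rule Bochner_Integration.integrable_bound)
    have "cmod (\<kappa> \<bar>x - y\<bar> * g y) \<le> B * (indicator {x-1..x+1} y + (cmod (g y))\<^sup>2)" for y
    proof (cases "\<bar>x - y\<bar> > 1")
      case True
      then show ?thesis using supp B by simp
    next
      case False
      have "0 \<le> (cmod (g y) - 1 / 2)\<^sup>2" by simp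
      then have "cmod (g y) \<le> 1 + (cmod (g y))\<^sup>2" by (simp add: power2_eq_square algebra_simps)
      then have "cmod (\<kappa> \<bar>x - y\<bar>) * cmod (g y) \<le> B * (1 + (cmod (g y))\<^sup>2)"
        using bound B by (intro mult_mono) auto
      moreover have "y \<in> {x-1..x+1}" using False by auto
      ultimately show ?thesis by (simp add: norm_mult)
    qed
    then show "AE y in lborel. norm (\<kappa> \<bar>x - y\<bar> * g y)
        \<le> norm (B * (indicator {x-1..x+1} y + (cmod (g y))\<^sup>2))"
      by (intro AE_I2) (metis abs_ge_self order_trans real_norm_def)
  qed simp
qed

text \<open>Cauchy-Schwarz on the window \<open>{x-1..x+1}\<close> of length 2. Since the
  kernel is bounded, this crude form of Young's inequality loses only a constant.\<close>

lemma window_kernel_pointwise: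
  fixes \<kappa> g :: "real \<Rightarrow> complex"
  assumes [measurable]: "\<kappa> \<in> borel_measurable borel" and g: "g \<in> L2_fun"
    and M: "\<And>r. r \<ge> 0 \<Longrightarrow> cmod (\<kappa> r) \<le> M" "M \<ge> 0" and supp: "\<And>r. r > 1 \<Longrightarrow> \<kappa> r = 0"
  shows "ennreal ((cmod (kernel_op \<kappa> g x))\<^sup>2)
    \<le> ennreal (2 * M\<^sup>2) * (\<integral>\<^sup>+y. indicator {x-1..x+1} y * ennreal ((cmod (g y))\<^sup>2) \<partial>lborel)"
proof -
  have [measurable]: "g \<in> borel_measurable lborel" using g by (auto simp: L2_fun_def)
  define J where "J = (\<integral>\<^sup>+y. indicator {x-1..x+1} y * ennreal (cmod (g y)) \<partial>lborel)"
  have "ennreal (cmod (kernel_op \<kappa> g x)) \<le> (\<integral>\<^sup>+y. ennreal (cmod (\<kappa> \<bar>x - y\<bar> * g y)) \<partial>lborel)"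
    unfolding kernel_op_def
    by (cases "integrable lborel (\<lambda>y. \<kappa> \<bar>x - y\<bar> * g y)")
       (auto intro: integral_norm_bound_ennreal simp: not_integrable_integral_eq)
  also have "\<dots> \<le> (\<integral>\<^sup>+y. ennreal M * (indicator {x-1..x+1} y * ennreal (cmod (g y))) \<partial>lborel)"
  proof (rule nn_integral_mono)
    fix y
    show "ennreal (cmod (\<kappa> \<bar>x - y\<bar> * g y)) \<le> ennreal M * (indicator {x-1..x+1} y * ennreal (cmod (g y)))"
    proof (cases "\<bar>x - y\<bar> > 1")
      case True
      then show ?thesis using supp by simp
    next
      case False
      then have "y \<in> {x-1..x+1}" by auto
      moreover have "ennreal (cmod (\<kappa> \<bar>x - y\<bar> * g y)) \<le> ennreal (M * cmod (g y))"
        using M by (intro ennreal_leI) (simp add: norm_mult mult_right_mono)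
      ultimately show ?thesis using M by (simp add: ennreal_mult')
    qed
  qed
  also have "\<dots> = ennreal M * J"
    unfolding J_def by (rule nn_integral_cmult) simp
  finally have 1: "ennreal (cmod (kernel_op \<kappa> g x)) \<le> ennreal M * J" .
  have "J = (\<integral>\<^sup>+y. indicator {x-1..x+1} y * (indicator {x-1..x+1} y * ennreal (cmod (g y))) \<partial>lborel)"
    unfolding J_def by (intro nn_integral_cong) (auto simp: indicator_def)
  then have "J\<^sup>2 \<le> (\<integral>\<^sup>+y. (indicator {x-1..x+1} y)\<^sup>2 \<partial>lborel)
     * (\<integral>\<^sup>+y. (indicator {x-1..x+1} y * ennreal (cmod (g y)))\<^sup>2 \<partial>lborel)"
    using Cauchy_Schwarz_nn_integral[of "indicator {x-1..x+1}" lborel "\<lambda>y. indicator {x-1..x+1} y * ennreal (cmod (g y))"]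
    by simp
  also have "(\<integral>\<^sup>+y. (indicator {x-1..x+1} y)\<^sup>2 \<partial>lborel) = (\<integral>\<^sup>+y. indicator {x-1..x+1} y \<partial>lborel)"
    by (intro nn_integral_cong) (auto simp: indicator_def)
  also have "\<dots> = ennreal 2" by simp
  also have "(\<integral>\<^sup>+y. (indicator {x-1..x+1} y * ennreal (cmod (g y)))\<^sup>2 \<partial>lborel)
      = (\<integral>\<^sup>+y. indicator {x-1..x+1} y * ennreal ((cmod (g y))\<^sup>2) \<partial>lborel)"
    by (intro nn_integral_cong) (auto simp: indicator_def ennreal_power)
  finally have 2: "J\<^sup>2 \<le> ennreal 2 * (\<integral>\<^sup>+y. indicator {x-1..x+1} y * ennreal ((cmod (g y))\<^sup>2) \<partial>lborel)" .
  have "ennreal ((cmod (kernel_op \<kappa> g x))\<^sup>2) = (ennreal (cmod (kernel_op \<kappa> g x)))\<^sup>2"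
    by (simp add: ennreal_power)
  also have "\<dots> \<le> (ennreal M * J)\<^sup>2" by (intro power_mono 1) auto
  also have "\<dots> = ennreal (M\<^sup>2) * J\<^sup>2" using M by (simp add: power_mult_distrib ennreal_power)
  also have "\<dots> \<le> ennreal (M\<^sup>2) * (ennreal 2 * (\<integral>\<^sup>+y. indicator {x-1..x+1} y * ennreal ((cmod (g y))\<^sup>2) \<partial>lborel))"
    by (intro mult_left_mono 2) auto
  finally show ?thesis using M by (simp add: ennreal_mult mult_ac)
qed

text \<open>By Tonelli, each \<open>y\<close> is counted with the length of the set of windows
  that contain it.\<close>

lemma nn_integral_window:
  fixes h :: "real \<Rightarrow> ennreal"
  assumes [measurable]: "h \<in> borel_measurable lborel"
  shows "(\<integral>\<^sup>+x. (\<integral>\<^sup>+y. indicator {x-1..x+1} y * h y \<partial>lborel) \<partial>lborel) = 2 * (\<integral>\<^sup>+y. h y \<partial>lborel)"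
proof -
  have meas: "(\<lambda>(x, y). (if \<bar>x - y\<bar> \<le> 1 then 1 else 0) * h y) \<in> borel_measurable (lborel \<Otimes>\<^sub>M lborel)"
    by measurable
  have eq: "indicator {x-1..x+1} y * h y = (if \<bar>x - y\<bar> \<le> 1 then 1 else 0) * h y" for x y :: real
    by (auto simp: indicator_def)
  have "(\<integral>\<^sup>+x. (\<integral>\<^sup>+y. indicator {x-1..x+1} y * h y \<partial>lborel) \<partial>lborel)
      = (\<integral>\<^sup>+y. (\<integral>\<^sup>+x. indicator {x-1..x+1} y * h y \<partial>lborel) \<partial>lborel)"
    unfolding eq using lborel_pair.Fubini'[OF meas] by simp
  also have "\<dots> = (\<integral>\<^sup>+y. (\<integral>\<^sup>+x. h y * indicator {y-1..y+1} x \<partial>lborel) \<partial>lborel)"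
    by (intro nn_integral_cong) (auto simp: indicator_def)
  also have "\<dots> = (\<integral>\<^sup>+y. 2 * h y \<partial>lborel)"
  proof (rule nn_integral_cong)
    fix y
    have "(\<integral>\<^sup>+x. h y * indicator {y-1..y+1} x \<partial>lborel) = h y * emeasure lborel {y-1..y+1}"
      by (rule nn_integral_cmult_indicator) simp
    also have "emeasure lborel {y-1..y+1} = 2" by simp
    finally show "(\<integral>\<^sup>+x. h y * indicator {y-1..y+1} x \<partial>lborel) = 2 * h y"
      by (simp only: mult.commute)
  qed
  also have "\<dots> = 2 * (\<integral>\<^sup>+y. h y \<partial>lborel)" by (rule nn_integral_cmult) simp
  finally show ?thesis .
qed

lemma window_kernel_L2:
  fixes \<kappa> g :: "real \<Rightarrow> complex"
  assumes [measurable]: "\<kappa> \<in> borel_measurable borel" and g: "g \<in> L2_fun"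
    and M: "\<And>r. r \<ge> 0 \<Longrightarrow> cmod (\<kappa> r) \<le> M" "M \<ge> 0" and supp: "\<And>r. r > 1 \<Longrightarrow> \<kappa> r = 0"
  shows "kernel_op \<kappa> g \<in> L2_fun" "L2_norm (kernel_op \<kappa> g) \<le> 2 * M * L2_norm g"
proof -
  have [measurable]: "g \<in> borel_measurable lborel" and gi: "integrable lborel (\<lambda>y. (cmod (g y))\<^sup>2)"
    using g by (auto simp: L2_fun_def)
  have meas [measurable]: "kernel_op \<kappa> g \<in> borel_measurable lborel"
  proof -
    have "(\<lambda>x. \<integral>y. \<kappa> \<bar>x - y\<bar> * g y \<partial>lborel) \<in> borel_measurable lborel"
      by measurable
    then show ?thesis by (simp add: kernel_op_def[abs_def])
  qed
  define I where "I = (\<integral>y. (cmod (g y))\<^sup>2 \<partial>lborel)"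
  have I0: "I \<ge> 0" by (simp add: I_def)
  have "(\<integral>\<^sup>+x. ennreal ((cmod (kernel_op \<kappa> g x))\<^sup>2) \<partial>lborel)
    \<le> (\<integral>\<^sup>+x. ennreal (2 * M\<^sup>2) * (\<integral>\<^sup>+y. indicator {x-1..x+1} y * ennreal ((cmod (g y))\<^sup>2) \<partial>lborel) \<partial>lborel)"
    by (intro nn_integral_mono window_kernel_pointwise assms)
  also have "\<dots> = ennreal (2 * M\<^sup>2) * (\<integral>\<^sup>+x. (\<integral>\<^sup>+y. indicator {x-1..x+1} y * ennreal ((cmod (g y))\<^sup>2) \<partial>lborel) \<partial>lborel)"
  proof (rule nn_integral_cmult)
    have eq: "indicator {x-1..x+1} y * h = (if \<bar>x - y\<bar> \<le> 1 then 1 else 0) * h" for x y :: real and h :: ennreal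
      by (auto simp: indicator_def)
    show "(\<lambda>x. \<integral>\<^sup>+y. indicator {x-1..x+1} y * ennreal ((cmod (g y))\<^sup>2) \<partial>lborel) \<in> borel_measurable lborel"
      unfolding eq by measurable
  qed
  also have "\<dots> = ennreal (2 * M\<^sup>2) * (2 * ennreal I)"
    unfolding I_def by (subst nn_integral_window) (auto simp: nn_integral_eq_integral[OF gi])
  also have "\<dots> = ennreal ((2 * M)\<^sup>2 * I)"
    using I0 by (simp add: ennreal_mult'[symmetric] ennreal_numeral[symmetric] power2_eq_square mult_ac del: ennreal_numeral)
  finally have le: "(\<integral>\<^sup>+x. ennreal ((cmod (kernel_op \<kappa> g x))\<^sup>2) \<partial>lborel) \<le> ennreal ((2 * M)\<^sup>2 * I)" .
  then have fin: "(\<integral>\<^sup>+x. ennreal ((cmod (kernel_op \<kappa> g x))\<^sup>2) \<partial>lborel) < \<infinity>"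
    using le_less_trans ennreal_less_top by (metis infinity_ennreal_def)
  have int: "integrable lborel (\<lambda>x. (cmod (kernel_op \<kappa> g x))\<^sup>2)"
    using fin by (intro integrableI_nonneg) auto
  then show "kernel_op \<kappa> g \<in> L2_fun" using meas by (simp add: L2_fun_def)
  have "ennreal (\<integral>x. (cmod (kernel_op \<kappa> g x))\<^sup>2 \<partial>lborel) \<le> ennreal ((2 * M)\<^sup>2 * I)"
    using le nn_integral_eq_integral[OF int] by simp
  then have "(\<integral>x. (cmod (kernel_op \<kappa> g x))\<^sup>2 \<partial>lborel) \<le> (2 * M)\<^sup>2 * I"
    using I0 by (subst (asm) ennreal_le_iff) auto
  then have "L2_norm (kernel_op \<kappa> g) \<le> sqrt ((2 * M)\<^sup>2 * I)"
    unfolding L2_norm_def by (rule real_sqrt_le_mono)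
  also have "\<dots> = 2 * M * L2_norm g" using M by (simp add: real_sqrt_mult L2_norm_def I_def)
  finally show "L2_norm (kernel_op \<kappa> g) \<le> 2 * M * L2_norm g" .
qed

lemma L2_opnorm_kernel_diff_le:
  fixes \<kappa>1 \<kappa>2 :: "real \<Rightarrow> complex"
  assumes meas: "\<kappa>1 \<in> borel_measurable borel" "\<kappa>2 \<in> borel_measurable borel"
    and bound: "\<And>r. cmod (\<kappa>1 r) \<le> B1" "\<And>r. cmod (\<kappa>2 r) \<le> B2"
    and supp: "\<And>r. r > 1 \<Longrightarrow> \<kappa>1 r = 0" "\<And>r. r > 1 \<Longrightarrow> \<kappa>2 r = 0"
    and M: "\<And>r. r \<ge> 0 \<Longrightarrow> cmod (\<kappa>1 r - \<kappa>2 r) \<le> M" "M \<ge> 0"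
  shows "L2_opnorm (\<lambda>g x. kernel_op \<kappa>1 g x - kernel_op \<kappa>2 g x) \<le> ennreal (2 * M)"
proof -
  have diff: "(\<lambda>x. kernel_op \<kappa>1 g x - kernel_op \<kappa>2 g x) = kernel_op (\<lambda>r. \<kappa>1 r - \<kappa>2 r) g" if "g \<in> L2_fun" for g
  proof
    fix x
    show "kernel_op \<kappa>1 g x - kernel_op \<kappa>2 g x = kernel_op (\<lambda>r. \<kappa>1 r - \<kappa>2 r) g x"
      unfolding kernel_op_def left_diff_distrib
      using window_kernel_integrable[OF meas(1) that bound(1) supp(1), of x]
        window_kernel_integrable[OF meas(2) that bound(2) supp(2), of x]
      by (rule Bochner_Integration.integral_diff[symmetric])
  qed
  show ?thesis
    unfolding L2_opnorm_def
  proof (rule Inf_lower, intro CollectI exI conjI ballI)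
    fix g assume g: "g \<in> L2_fun"
    have m: "(\<lambda>r. \<kappa>1 r - \<kappa>2 r) \<in> borel_measurable borel" using meas by measurable
    show "(\<lambda>x. kernel_op \<kappa>1 g x - kernel_op \<kappa>2 g x) \<in> L2_fun"
      "L2_norm (\<lambda>x. kernel_op \<kappa>1 g x - kernel_op \<kappa>2 g x) \<le> 2 * M * L2_norm g"
      unfolding diff[OF g] using window_kernel_L2[OF m g M] supp by auto
  qed (use M in auto)
qed

section \<open>Approximation of smooth functions of a power\<close>

text \<open>For \<open>s \<ge> 0\<close> the square root of \<open>u s - \<i>\<close> has real part at least
  \<open>sqrt (1 / 2)\<close>, so the real part of the integral is positive.\<close>

lemma hankel_laplace_nonzero:
  assumes "s \<ge> 0"
  shows "hankel_laplace (1/2) (1/2) s \<noteq> 0"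
proof -
  define f where "f u = complex_of_real (exp (- u) * u powr (1/2)) * (of_real (u * s) - \<i>) powr of_real (1/2)" for u
  have int: "integrable halfline f"
    unfolding f_def by (rule hankel_laplace_integrable) auto
  have G: "integrable halfline (\<lambda>u. exp (- u) * u powr (1/2))" by (rule Gamma_halfline) simp
  have "0 < sqrt (1/2) * Gamma (1/2 + 1 :: real)" by (simp add: Gamma_real_pos)
  also have "\<dots> = (\<integral>u. sqrt (1/2) * (exp (- u) * u powr (1/2)) \<partial>halfline)"
    using Gamma_halfline(2)[of "1/2"] by simp
  also have "\<dots> \<le> (\<integral>u. Re (f u) \<partial>halfline)"
  proof (rule integral_mono)
    fix u assume "u \<in> space halfline"
    then have u: "u > 0" by (simp add: space_restrict_space)
    define z where "z = of_real (u * s) - \<i>"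
    have "1 \<le> cmod z" using abs_Im_le_cmod[of z] by (simp add: z_def)
    moreover have "0 \<le> Re z" using u assms by (simp add: z_def)
    ultimately have "sqrt (1/2) \<le> sqrt ((cmod z + Re z) / 2)" by (intro real_sqrt_le_mono) auto
    moreover have "z powr of_real (1/2) = csqrt z" by (simp add: z_def csqrt_conv_powr)
    ultimately have "sqrt (1/2) \<le> Re (z powr of_real (1/2))" by simp
    then have "exp (- u) * u powr (1/2) * sqrt (1/2) \<le> exp (- u) * u powr (1/2) * Re (z powr of_real (1/2))"
      by (intro mult_left_mono) auto
    moreover have "Re (f u) = exp (- u) * u powr (1/2) * Re (z powr of_real (1/2))"
      unfolding f_def z_def[symmetric] times_complex.sel(1) Re_complex_of_real Im_complex_of_real by simp
    ultimately show "sqrt (1/2) * (exp (- u) * u powr (1/2)) \<le> Re (f u)"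
      by (simp only: mult.commute)
  qed (use G int in auto)
  also have "\<dots> = Re (hankel_laplace (1/2) (1/2) s)"
    unfolding hankel_laplace_def f_def[symmetric] by (rule integral_Re[OF int])
  finally show ?thesis by auto
qed

text \<open>Infinite differentiability, expressed by the sequence of all derivatives.\<close>

definition smooth_curve :: "(real \<Rightarrow> complex) \<Rightarrow> bool" where
  "smooth_curve G \<longleftrightarrow> (\<exists>D. D 0 = G \<and> (\<forall>n x. (D n has_vector_derivative D (Suc n) x) (at x)))"

lemma smooth_curve_hankel_laplace: "smooth_curve (\<lambda>s. hankel_laplace (1/2) (1/2) (c * s))"
proof -
  define D where "D n s = of_real ((\<Prod>i<n. 1/2 - real i) * c ^ n)
     * hankel_laplace (1/2 + real n) (1/2 - real n) (c * s)" for n s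
  have "(D n has_vector_derivative D (Suc n) s) (at s)" for n s
  proof -
    have "((\<lambda>s. c * s) has_vector_derivative c) (at s)"
      by (auto intro!: derivative_eq_intros)
    from has_vector_derivative_mult_right[OF vector_diff_chain_at[OF this
        hankel_laplace_has_vector_derivative[of "1/2 + real n" "1/2 - real n" "c * s"]],
        of "of_real ((\<Prod>i<n. 1/2 - real i) * c ^ n)"]
    have "((\<lambda>s. of_real ((\<Prod>i<n. 1/2 - real i) * c ^ n) * hankel_laplace (1/2 + real n) (1/2 - real n) (c * s))
      has_vector_derivative of_real ((\<Prod>i<n. 1/2 - real i) * c ^ n) * (c *\<^sub>R (of_real (1/2 - real n)
        * hankel_laplace (1/2 + real n + 1) (1/2 - real n - 1) (c * s)))) (at s)"
      by (simp add: o_def)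
    moreover have "1/2 + real n + 1 = 1/2 + real (Suc n)" "1/2 - real n - 1 = 1/2 - real (Suc n)" by simp_all
    ultimately show ?thesis
      unfolding D_def by (simp only:) (simp add: scaleR_conv_of_real mult_ac)
  qed
  moreover have "D 0 = (\<lambda>s. hankel_laplace (1/2) (1/2) (c * s))" by (simp add: D_def fun_eq_iff)
  ultimately show ?thesis unfolding smooth_curve_def by blast
qed

text \<open>The operator \<open>G \<mapsto> c G + a s G'\<close> is what the derivative of
  \<open>t powr b * G (t powr \<alpha>)\<close> does to \<open>G\<close>; its \<open>n\<close>-th derivative is
  \<open>(c + a n) D n + a s D (n + 1)\<close> if \<open>D n\<close> is the one of \<open>G\<close>.\<close>

lemma smooth_curve_euler_step:
  assumes "smooth_curve G"
  shows "\<exists>G'. (\<forall>s. (G has_vector_derivative G' s) (at s)) \<and>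
    smooth_curve (\<lambda>s. of_real c * G s + of_real (a * s) * G' s)"
proof -
  from assms obtain D where D: "D 0 = G" "\<And>n x. (D n has_vector_derivative D (Suc n) x) (at x)"
    unfolding smooth_curve_def by blast
  define E where "E n s = of_real (c + a * real n) * D n s + of_real (a * s) * D (Suc n) s" for n s
  have "(E n has_vector_derivative E (Suc n) s) (at s)" for n s
  proof -
    have "((\<lambda>s. complex_of_real (a * s)) has_vector_derivative of_real a) (at s)"
      by (rule has_vector_derivative_complex_of_real) (auto intro!: derivative_eq_intros)
    from has_vector_derivative_add[OF has_vector_derivative_mult_right[OF D(2)[of n s]]
        has_vector_derivative_mult[OF this D(2)[of "Suc n" s]]]
    have "(E n has_vector_derivative of_real (c + a * real n) * D (Suc n) s +
       (of_real (a * s) * D (Suc (Suc n)) s + of_real a * D (Suc n) s)) (at s)"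
      unfolding E_def by simp
    then show ?thesis by (rule has_vector_derivative_eq_rhs) (simp add: E_def algebra_simps)
  qed
  moreover have "E 0 = (\<lambda>s. of_real c * G s + of_real (a * s) * D 1 s)"
    by (simp add: E_def fun_eq_iff D(1))
  ultimately have "smooth_curve (\<lambda>s. of_real c * G s + of_real (a * s) * D 1 s)"
    unfolding smooth_curve_def by blast
  moreover have "(G has_vector_derivative D 1 s) (at s)" for s using D(2)[of 0 s] D(1) by simp
  ultimately show ?thesis by blast
qed

lemma smooth_curve_bounded:
  assumes "smooth_curve G"
  obtains B where "\<And>s. s \<in> {0..1} \<Longrightarrow> cmod (G s) \<le> B"
proof -
  obtain G' where "\<And>s. (G has_vector_derivative G' s) (at s)"
    using smooth_curve_euler_step[OF assms] by blast
  then have "continuous_on {0..1} G"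
    by (intro continuous_at_imp_continuous_on ballI has_vector_derivative_continuous) 
  then have "bounded (G ` {0..1})" by (intro compact_imp_bounded compact_continuous_image) auto
  then show ?thesis using that unfolding bounded_iff by blast
qed

lemma powr_smooth_derivatives:
  assumes G: "smooth_curve G"
  obtains H where "H 0 = G" "\<And>j. smooth_curve (H j)"
    "\<And>j t. t > 0 \<Longrightarrow> ((\<lambda>t. of_real (t powr (\<beta> - real j)) * H j (t powr \<alpha>)) has_vector_derivative
        of_real (t powr (\<beta> - real (Suc j))) * H (Suc j) (t powr \<alpha>)) (at t)"
proof -
  have "\<exists>H. \<forall>j. (smooth_curve (H j) \<and> (j = 0 \<longrightarrow> H j = G)) \<and>
     (\<exists>H'. (\<forall>s. (H j has_vector_derivative H' s) (at s)) \<and>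
        H (Suc j) = (\<lambda>s. of_real (\<beta> - real j) * H j s + of_real (\<alpha> * s) * H' s))"
  proof (rule dependent_nat_choice)
    show "\<exists>x. smooth_curve x \<and> (0 = (0::nat) \<longrightarrow> x = G)" using G by blast
    fix x and j :: nat assume "smooth_curve x \<and> (j = 0 \<longrightarrow> x = G)"
    then show "\<exists>y. (smooth_curve y \<and> (Suc j = 0 \<longrightarrow> y = G)) \<and>
       (\<exists>H'. (\<forall>s. (x has_vector_derivative H' s) (at s)) \<and>
         y = (\<lambda>s. of_real (\<beta> - real j) * x s + of_real (\<alpha> * s) * H' s))"
      using smooth_curve_euler_step[of x "\<beta> - real j" \<alpha>] by auto
  qed
  then obtain H where "\<forall>j. (smooth_curve (H j) \<and> (j = 0 \<longrightarrow> H j = G)) \<and>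
     (\<exists>H'. (\<forall>s. (H j has_vector_derivative H' s) (at s)) \<and>
        H (Suc j) = (\<lambda>s. of_real (\<beta> - real j) * H j s + of_real (\<alpha> * s) * H' s))" ..
  then have H: "\<And>j. smooth_curve (H j)" "H 0 = G"
    "\<And>j. \<exists>H'. (\<forall>s. (H j has_vector_derivative H' s) (at s)) \<and>
        H (Suc j) = (\<lambda>s. of_real (\<beta> - real j) * H j s + of_real (\<alpha> * s) * H' s)"
    by blast+
  show ?thesis
  proof (rule that[of H])
    show "H 0 = G" "smooth_curve (H j)" for j using H by auto
    fix j and t :: real assume t: "t > 0"
    define b where "b = \<beta> - real j"
    obtain H' where H': "\<And>s. (H j has_vector_derivative H' s) (at s)"
      "H (Suc j) = (\<lambda>s. of_real b * H j s + of_real (\<alpha> * s) * H' s)"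
      unfolding b_def using H(3) by blast
    have p1: "((\<lambda>t. t powr \<alpha>) has_vector_derivative \<alpha> * t powr (\<alpha> - 1)) (at t)"
      using has_real_derivative_powr[OF t, of \<alpha>] by (simp add: has_real_derivative_iff_has_vector_derivative)
    have p2: "((\<lambda>t. complex_of_real (t powr b)) has_vector_derivative of_real (b * t powr (b - 1))) (at t)"
      by (intro has_vector_derivative_complex_of_real has_real_derivative_powr t)
    have "((\<lambda>t. of_real (t powr b) * H j (t powr \<alpha>)) has_vector_derivative
       of_real (t powr b) * ((\<alpha> * t powr (\<alpha> - 1)) *\<^sub>R H' (t powr \<alpha>))
        + of_real (b * t powr (b - 1)) * H j (t powr \<alpha>)) (at t)"
      using has_vector_derivative_mult[OF p2 vector_diff_chain_at[OF p1 H'(1)]] by (simp add: o_def)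
    moreover have "of_real (t powr b) * ((\<alpha> * t powr (\<alpha> - 1)) *\<^sub>R H' (t powr \<alpha>))
        + of_real (b * t powr (b - 1)) * H j (t powr \<alpha>)
       = of_real (t powr (b - 1)) * H (Suc j) (t powr \<alpha>)"
    proof -
      have "t powr b * t powr (\<alpha> - 1) = t powr (b - 1) * t powr \<alpha>"
        using t by (simp flip: powr_add add: algebra_simps)
      then have "complex_of_real (t powr b) * of_real (t powr (\<alpha> - 1)) = of_real (t powr (b - 1)) * of_real (t powr \<alpha>)"
        by (simp flip: of_real_mult)
      then have "of_real (t powr b) * ((\<alpha> * t powr (\<alpha> - 1)) *\<^sub>R H' (t powr \<alpha>))
        = of_real \<alpha> * (of_real (t powr (b - 1)) * of_real (t powr \<alpha>)) * H' (t powr \<alpha>)"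
        by (simp add: scaleR_conv_of_real mult_ac)
      then show ?thesis unfolding H'(2) by (simp add: algebra_simps)
    qed
    moreover have bs: "\<beta> - real (Suc j) = b - 1" by (simp add: b_def)
    ultimately show "((\<lambda>t. of_real (t powr (\<beta> - real j)) * H j (t powr \<alpha>)) has_vector_derivative
        of_real (t powr (\<beta> - real (Suc j))) * H (Suc j) (t powr \<alpha>)) (at t)"
      unfolding bs unfolding b_def[symmetric] by (simp only:)
  qed
qed

text \<open>The exponents \<open>\<beta> - j\<close> of the first \<open>m\<close> derivatives are
  nonnegative, so these derivatives are bounded on \<open>(0, 1]\<close> uniformly in the left end
  \<open>a\<close> of the interval. For \<open>p \<le> m\<close>, where Jackson's theorem gives nothing, the zero polynomial is good enough.\<close>

lemma powr_smooth_approximation: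
  assumes G: "smooth_curve G" and \<alpha>: "\<alpha> > 0" and m: "real m \<le> \<beta>"
  obtains c where "c > 0"
    "\<And>p a. p \<ge> 1 \<Longrightarrow> 0 < a \<Longrightarrow> a \<le> 1 \<Longrightarrow> \<exists>P. degree P \<le> p - 1 \<and>
      (\<forall>t\<in>{a..1}. cmod (of_real (t powr \<beta>) * G (t powr \<alpha>) - poly P (of_real t)) \<le> c / real p ^ m)"
proof -
  obtain H where H: "H 0 = G" "\<And>j. smooth_curve (H j)"
    "\<And>j t. t > 0 \<Longrightarrow> ((\<lambda>t. of_real (t powr (\<beta> - real j)) * H j (t powr \<alpha>)) has_vector_derivative
        of_real (t powr (\<beta> - real (Suc j))) * H (Suc j) (t powr \<alpha>)) (at t)"
    using powr_smooth_derivatives[OF G, of \<beta> \<alpha>] by blast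
  define F where "F j t = of_real (t powr (\<beta> - real j)) * H j (t powr \<alpha>)" for j t
  obtain B0 where B0: "\<And>s. s \<in> {0..1} \<Longrightarrow> cmod (H 0 s) \<le> B0" using smooth_curve_bounded[OF H(2)] by blast
  obtain Bm where Bm: "\<And>s. s \<in> {0..1} \<Longrightarrow> cmod (H m s) \<le> Bm" using smooth_curve_bounded[OF H(2)] by blast
  define B where "B = max 1 (max B0 Bm)"
  have F_le: "cmod (F j t) \<le> B" if "j = 0 \<or> j = m" "0 < t" "t \<le> 1" for j t
  proof -
    have "t powr \<alpha> \<in> {0..1}" using that \<alpha> powr_mono2[of \<alpha> t 1] by auto
    then have 1: "cmod (H j (t powr \<alpha>)) \<le> B" using that B0 Bm unfolding B_def by fastforce
    have "t powr (\<beta> - real j) \<le> 1 powr (\<beta> - real j)"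
      using that m by (intro powr_mono2) auto
    then have 2: "t powr (\<beta> - real j) \<le> 1" by simp
    have "cmod (F j t) = t powr (\<beta> - real j) * cmod (H j (t powr \<alpha>))" by (simp add: F_def norm_mult)
    also have "\<dots> \<le> 1 * B" using 1 2 by (intro mult_mono) auto
    finally show ?thesis by simp
  qed
  define c where "c = (130 * (8 + real m)) ^ m * B"
  have B1: "B \<ge> 1" by (simp add: B_def)
  have "c > 0" using B1 by (simp add: c_def)
  moreover have "\<exists>P. degree P \<le> p - 1 \<and> (\<forall>t\<in>{a..1}. cmod (F 0 t - poly P (of_real t)) \<le> c / real p ^ m)"
    if p: "p \<ge> 1" and a: "0 < a" "a \<le> 1" for p a
  proof (cases "p \<ge> m + 1")
    case True
    \<comment> \<open>The largest \<open>n\<close> for which the degree \<open>8 n + m\<close> of the Jackson approximation fits below \<open>p\<close>.\<close>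
    define n where "n = (p - 1 - m) div 8"
    have n: "8 * n + m \<le> p - 1" "p \<le> (8 + m) * (2 * n + 1)"
    proof -
      show "8 * n + m \<le> p - 1" using True unfolding n_def by linarith
      have "p \<le> 8 * n + 8 + m" using True unfolding n_def by linarith
      also have "\<dots> \<le> (8 + m) * (2 * n + 1)" by (simp add: algebra_simps)
      finally show "p \<le> (8 + m) * (2 * n + 1)" .
    qed
    have "\<exists>P. degree P \<le> 8 * n + m \<and>
      (\<forall>t\<in>{a..1}. cmod (F 0 t - poly P (of_real t)) \<le> (130 / real (2 * n + 1)) ^ m * B)"
    proof (rule jackson_smooth)
      fix t assume t: "t \<in> {a..1}"
      show "cmod (F m t) \<le> B" using F_le t a by auto
      show "(F j has_vector_derivative F (Suc j) t) (at t within {a..1})" for j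
        unfolding F_def using t a by (intro has_vector_derivative_at_within[OF H(3)]) auto
    qed (use a in auto)
    then obtain P where P: "degree P \<le> 8 * n + m"
      "\<And>t. t \<in> {a..1} \<Longrightarrow> cmod (F 0 t - poly P (of_real t)) \<le> (130 / real (2 * n + 1)) ^ m * B"
      by blast
    have "130 / real (2 * n + 1) \<le> 130 * (8 + real m) / real p"
      using n(2) p of_nat_mono[OF n(2), where 'a = real] by (simp add: field_simps)
    then have "(130 / real (2 * n + 1)) ^ m * B \<le> (130 * (8 + real m) / real p) ^ m * B"
      using B1 by (intro mult_right_mono power_mono) auto
    also have "\<dots> = c / real p ^ m" by (simp add: c_def power_divide)
    finally show ?thesis using P n(1) by (meson order_trans)
  next
    case False
    have "B \<le> c / real p ^ m"
    proof -
      have "real p ^ m \<le> (130 * (8 + real m)) ^ m" using False by (intro power_mono) auto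
      then have "B * real p ^ m \<le> B * (130 * (8 + real m)) ^ m" using B1 by (intro mult_left_mono) auto
      then show ?thesis using p by (simp add: c_def field_simps)
    qed
    then have "cmod (F 0 t) \<le> c / real p ^ m" if "t \<in> {a..1}" for t
      using F_le[of 0 t] that a by simp
    then show ?thesis by (intro exI[of _ 0]) simp
  qed
  ultimately show ?thesis using that unfolding F_def H(1) by simp
qed

section \<open>The truncated Dirichlet-to-Neumann kernel\<close>

text \<open>In \<open>exp (\<i> k r) * sqrt (2 k r) / (pi r\<^sup>2)\<close> times the Laplace integral at
  \<open>1 / (2 k r)\<close>, both \<open>1 / r\<close> and \<open>1 / (k r)\<close> are multiples of
  \<open>t powr \<alpha>\<close>, the former with the factor \<open>k / C\<close>; collecting powers leaves
  \<open>k\<^sup>2 * t powr (3 \<alpha> / 2)\<close>.\<close>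

lemma K_trunc_factor:
  assumes C: "C > 0" and k: "k > C" and \<alpha>: "\<alpha> > 0" and r: "r \<in> {C / k..1}"
  defines "t \<equiv> (C / (k * r)) powr (1 / \<alpha>)"
  shows "K_trunc k (C / k) r = exp (\<i> * of_real (k * r)) *
    (of_real (sqrt (2 * C) / (pi * C\<^sup>2) * k\<^sup>2) * (of_real (t powr (3 * \<alpha> / 2)) *
       hankel_laplace (1/2) (1/2) (1 / (2 * C) * t powr \<alpha>)))"
    and "0 < t" "t \<le> 1"
proof -
  have k0: "k > 0" using C k by simp
  then have "0 < C / k" using C by simp
  then have r0: "r > 0" using r by auto
  define s where "s = C / (k * r)"
  have s: "s > 0" "s \<le> 1" using C k0 r0 r by (auto simp: s_def field_simps)
  show "0 < t" using s by (simp add: t_def s_def[symmetric])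
  show "t \<le> 1" using s \<alpha> powr_mono2[of "1 / \<alpha>" s 1] by (simp add: t_def s_def[symmetric])
  have ta: "t powr \<alpha> = s" using s \<alpha> by (simp add: t_def s_def[symmetric] powr_powr)
  have t32: "t powr (3 * \<alpha> / 2) = s powr (3/2)" using s \<alpha> by (simp add: t_def s_def[symmetric] powr_powr)
  have arg: "1 / (2 * (k * r)) = 1 / (2 * C) * t powr \<alpha>"
    unfolding ta using C k0 r0 by (simp add: s_def)
  have coef: "sqrt (2 * (k * r)) / (pi * r\<^sup>2) = sqrt (2 * C) / (pi * C\<^sup>2) * k\<^sup>2 * t powr (3 * \<alpha> / 2)"
  proof -
    have kr: "k * r = C / s" using C k0 r0 by (simp add: s_def)
    have rr: "r = C / (k * s)" using C k0 r0 by (simp add: s_def)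
    have "s powr (3/2) = s\<^sup>2 / sqrt s"
      using s powr_diff[of s 2 "1/2"] by (simp add: powr_half_sqrt)
    then show ?thesis
      unfolding t32 unfolding kr rr using C k0 s by (simp add: real_sqrt_mult real_sqrt_divide field_simps power2_eq_square)
  qed
  have "K_trunc k (C / k) r = \<i> * of_real k / (2 * of_real r) * Hankel1 1 (k * r)"
    using r by (simp add: K_trunc_def zero_ext_def)
  also have "\<dots> = (\<i> * of_real (pi / 2 * (k * r)) * Hankel1 1 (k * r)) / of_real (pi * r\<^sup>2)"
    using r0 by (simp add: field_simps power2_eq_square)
  also have "\<dots> = outgoing1 (k * r) / of_real (pi * r\<^sup>2)"
    using k0 r0 by (subst Hankel1_1_eq_outgoing1) auto
  also have "\<dots> = exp (\<i> * of_real (k * r)) * (of_real (sqrt (2 * (k * r)) / (pi * r\<^sup>2))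
      * hankel_laplace (1/2) (1/2) (1 / (2 * (k * r))))"
    by (simp add: outgoing1_def)
  finally show "K_trunc k (C / k) r = exp (\<i> * of_real (k * r)) *
    (of_real (sqrt (2 * C) / (pi * C\<^sup>2) * k\<^sup>2) * (of_real (t powr (3 * \<alpha> / 2)) *
       hankel_laplace (1/2) (1/2) (1 / (2 * C) * t powr \<alpha>)))"
    unfolding coef arg by (simp add: mult_ac)
qed

lemma continuous_on_K_trunc:
  assumes "C > 0" "k > C"
  shows "continuous_on {C / k..1} (K_trunc k (C / k))"
proof -
  have k0: "k > 0" using assms by simp
  then have "0 < C / k" using assms by simp
  then have pos: "r > 0" if "r \<in> {C / k..1}" for r using that by auto
  have "isCont outgoing1 x" if "x > 0" for x
    using outgoing_has_vector_derivative(1)[OF that] by (rule has_vector_derivative_continuous)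
  then have "continuous_on {0<..} outgoing1" by (intro continuous_at_imp_continuous_on) auto
  then have "continuous_on {C / k..1} (\<lambda>r. outgoing1 (k * r))"
    by (rule continuous_on_compose2) (use pos k0 assms in \<open>auto intro!: continuous_intros\<close>)
  then have cont: "continuous_on {C / k..1} (\<lambda>r. outgoing1 (k * r) / of_real (pi * r\<^sup>2))"
    using pos by (intro continuous_intros) fastforce+
  have "K_trunc k (C / k) r = outgoing1 (k * r) / of_real (pi * r\<^sup>2)" if r: "r \<in> {C / k..1}" for r
    using r pos[OF r] k0 Hankel1_1_eq_outgoing1[of "k * r", symmetric]
    by (simp add: K_trunc_def zero_ext_def field_simps power2_eq_square)
  then show ?thesis using cont by (subst continuous_on_cong[OF refl]) auto
qed

lemma continuous_on_approx_space:
  assumes "F \<in> approx_space k \<alpha> p" "S \<subseteq> {0<..}"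
  shows "continuous_on S F"
  using assms unfolding approx_space_def by (auto intro!: continuous_intros simp: subset_iff)

lemma cmod_le_sup_norm_on:
  assumes "compact S" "continuous_on S f" "x \<in> S"
  shows "cmod (f x) \<le> sup_norm_on S f"
  unfolding sup_norm_on_def
proof (rule cSUP_upper[OF assms(3)])
  have "bounded ((\<lambda>x. cmod (f x)) ` S)"
    by (intro compact_imp_bounded compact_continuous_image continuous_intros assms)
  then show "bdd_above ((\<lambda>x. cmod (f x)) ` S)" by (rule bounded_imp_bdd_above)
qed

lemma zero_ext_measurable:
  assumes "continuous_on {a..b} f"
  shows "zero_ext {a..b} f \<in> borel_measurable borel"
proof -
  have "(\<lambda>x. indicator {a..b} x *\<^sub>R f x) \<in> borel_measurable borel"
    by (rule borel_measurable_continuous_on_indicator[OF _ assms]) simp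
  moreover have "(\<lambda>x. indicator {a..b} x *\<^sub>R f x) = zero_ext {a..b} f"
    by (auto simp: zero_ext_def fun_eq_iff indicator_def)
  ultimately show ?thesis by simp
qed

lemma zero_ext_bounded:
  assumes "continuous_on {a..b} f"
  obtains B where "\<And>r. cmod (zero_ext {a..b} f r) \<le> B"
proof -
  have "bounded (f ` {a..b})" using assms by (intro compact_imp_bounded compact_continuous_image) auto
  then obtain B where B: "B > 0" "\<And>r. r \<in> {a..b} \<Longrightarrow> cmod (f r) \<le> B" unfolding bounded_pos by auto
  have "cmod (zero_ext {a..b} f r) \<le> B" for r using B by (simp add: zero_ext_def)
  then show ?thesis by (rule that)
qed

lemma K_trunc_zero_ext: "zero_ext {a..1} (K_trunc k a) = K_trunc k a"
  by (auto simp: K_trunc_def zero_ext_def fun_eq_iff)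

lemma L2_opnorm_truncated_le:
  assumes a: "0 < a" "a \<le> 1"
    and cont: "continuous_on {a..1} f" "continuous_on {a..1} F"
  shows "L2_opnorm (\<lambda>g x. kernel_op (zero_ext {a..1} f) g x - kernel_op (zero_ext {a..1} F) g x)
      \<le> ennreal (2 * sup_norm_on {a..1} (\<lambda>r. f r - F r))"
proof -
  obtain B1 where B1: "\<And>r. cmod (zero_ext {a..1} f r) \<le> B1" using zero_ext_bounded[OF cont(1)] by blast
  obtain B2 where B2: "\<And>r. cmod (zero_ext {a..1} F r) \<le> B2" using zero_ext_bounded[OF cont(2)] by blast
  have le: "cmod (f r - F r) \<le> sup_norm_on {a..1} (\<lambda>r. f r - F r)" if "r \<in> {a..1}" for r
    using that cont by (intro cmod_le_sup_norm_on[where f = "\<lambda>r. f r - F r"] continuous_intros) auto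
  have M0: "0 \<le> sup_norm_on {a..1} (\<lambda>r. f r - F r)"
    using le[of 1] a norm_ge_zero order_trans by (metis atLeastAtMost_iff order_refl)
  show ?thesis
  proof (rule L2_opnorm_kernel_diff_le[OF zero_ext_measurable[OF cont(1)] zero_ext_measurable[OF cont(2)] B1 B2])
    show "cmod (zero_ext {a..1} f r - zero_ext {a..1} F r) \<le> sup_norm_on {a..1} (\<lambda>r. f r - F r)" for r
      using le[of r] M0 by (simp add: zero_ext_def)
  qed (use M0 in \<open>auto simp: zero_ext_def\<close>)
qed

text \<open>The ansatz contains the powers \<open>t\<close> to \<open>t ^ p\<close> but no constant,
  which is why the polynomial is multiplied by \<open>t\<close>.\<close>

lemma poly_times_var_in_approx_space:
  fixes P :: "complex poly"
  assumes C: "C > 0" and k: "k > 0" and p: "p \<ge> 1" "degree P \<le> p - 1"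
  obtains G where "G \<in> approx_space k \<alpha> p"
    "\<And>r. r > 0 \<Longrightarrow> G r = exp (\<i> * of_real (k * r)) *
       (A * (of_real ((C / (k * r)) powr (1 / \<alpha>)) * poly P (of_real ((C / (k * r)) powr (1 / \<alpha>)))))"
proof -
  define c where "c j = A * coeff P (j - 1) * of_real ((C / k) powr (real j / \<alpha>))" for j
  define G where "G r = (\<Sum>j=1..p. c j * (exp (\<i> * of_real (k * r)) / of_real (r powr (real j / \<alpha>))))" for r
  have "G r = exp (\<i> * of_real (k * r)) *
       (A * (of_real ((C / (k * r)) powr (1 / \<alpha>)) * poly P (of_real ((C / (k * r)) powr (1 / \<alpha>)))))"
    if r: "r > 0" for r
  proof -
    define t where "t = (C / (k * r)) powr (1 / \<alpha>)"
    have t0: "t > 0" using C k r by (simp add: t_def)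
    have tj: "t ^ j = (C / k) powr (real j / \<alpha>) / r powr (real j / \<alpha>)" for j
    proof -
      have "t ^ j = t powr real j" using t0 by (simp add: powr_realpow)
      also have "\<dots> = (C / k / r) powr (real j / \<alpha>)" by (simp add: t_def powr_powr)
      also have "\<dots> = (C / k) powr (real j / \<alpha>) / r powr (real j / \<alpha>)"
        by (rule powr_divide)
      finally show ?thesis .
    qed
    have "of_real t * poly P (of_real t) = (\<Sum>i\<le>p - 1. coeff P i * of_real t ^ Suc i)"
    proof -
      have "poly P (of_real t) = (\<Sum>i\<le>p - 1. coeff P i * of_real t ^ i)"
        unfolding poly_altdef using p(2)
        by (intro sum.mono_neutral_left) (auto simp: coeff_eq_0)
      then show ?thesis by (simp add: sum_distrib_left mult_ac)
    qed
    also have "\<dots> = (\<Sum>j=1..p. coeff P (j - 1) * of_real t ^ j)"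
      by (rule sum.reindex_bij_witness[of _ "\<lambda>j. j - 1" Suc]) (use p in auto)
    finally have "exp (\<i> * of_real (k * r)) * (A * (of_real t * poly P (of_real t)))
      = (\<Sum>j=1..p. exp (\<i> * of_real (k * r)) * (A * (coeff P (j - 1) * of_real t ^ j)))"
      by (simp only: sum_distrib_left)
    also have "\<dots> = G r"
      unfolding G_def c_def of_real_power[symmetric] tj by (intro sum.cong refl) simp
    finally show ?thesis by (simp add: t_def)
  qed
  moreover have "G \<in> approx_space k \<alpha> p"
    unfolding approx_space_def G_def by blast
  ultimately show ?thesis using that by blast
qed

theorem theorem1:
  fixes \<alpha> C :: real
  assumes "\<alpha> > 2 / 3" and "C > 0"
  shows "\<exists>C\<^sub>\<alpha> > 0. \<forall>k > C. \<forall>p::nat. p \<ge> 1 \<longrightarrow>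
    (\<forall>F. best_uniform_approx {C / k..1} (K_trunc k (C / k)) (approx_space k \<alpha> p) F \<longrightarrow>
      L2_opnorm (\<lambda>g x. kernel_op (K_trunc k (C / k)) g x
                      - kernel_op (zero_ext {C / k..1} F) g x)
        \<le> ennreal (C\<^sub>\<alpha> * real p powi (1 - \<lfloor>3 * \<alpha> / 2\<rfloor>)
                    * sup_norm_on {C / k..1} (K_trunc k (C / k))))"
proof -
  define \<beta> where "\<beta> = 3 * \<alpha> / 2 - 1"
  define m where "m = nat (\<lfloor>3 * \<alpha> / 2\<rfloor> - 1)"
  have fl: "\<lfloor>3 * \<alpha> / 2\<rfloor> \<ge> 1" using assms by (simp add: le_floor_iff)
  have mi: "\<lfloor>3 * \<alpha> / 2\<rfloor> = int m + 1" using fl by (simp add: m_def)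
  have m\<beta>: "real m \<le> \<beta>" using of_int_floor_le[of "3 * \<alpha> / 2"] unfolding mi \<beta>_def by simp
  define G where "G s = hankel_laplace (1/2) (1/2) (1 / (2 * C) * s)" for s
  have G: "smooth_curve G" unfolding G_def by (rule smooth_curve_hankel_laplace)
  have \<alpha>: "\<alpha> > 0" using assms by simp
  obtain c where c: "c > 0"
    "\<And>p a. p \<ge> 1 \<Longrightarrow> 0 < a \<Longrightarrow> a \<le> 1 \<Longrightarrow> \<exists>P. degree P \<le> p - 1 \<and>
      (\<forall>t\<in>{a..1}. cmod (of_real (t powr \<beta>) * G (t powr \<alpha>) - poly P (of_real t)) \<le> c / real p ^ m)"
    using powr_smooth_approximation[OF G \<alpha> m\<beta>] by blast
  define g where "g = cmod (G 1)"
  have g: "g > 0" using hankel_laplace_nonzero[of "1 / (2 * C)"] assms by (simp add: g_def G_def)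
  define Q where "Q = sqrt (2 * C) / (pi * C\<^sup>2)"
  have Q: "Q > 0" using assms by (simp add: Q_def)
  show ?thesis
  proof (intro exI[of _ "2 * c / g"] conjI allI impI)
    show "2 * c / g > 0" using c g by simp
    fix k :: real and p :: nat and F
    assume k: "k > C" and p: "p \<ge> 1"
      and F: "best_uniform_approx {C / k..1} (K_trunc k (C / k)) (approx_space k \<alpha> p) F"
    define r0 where "r0 = C / k"
    have k0: "k > 0" and r0: "0 < r0" "r0 < 1" using k assms by (auto simp: r0_def)
    define K where "K = K_trunc k r0"
    define \<tau> where "\<tau> r = (C / (k * r)) powr (1 / \<alpha>)" for r
    have Keq: "K r = exp (\<i> * of_real (k * r)) * (of_real (Q * k\<^sup>2) * (of_real (\<tau> r powr (3 * \<alpha> / 2)) * G (\<tau> r powr \<alpha>)))"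
      and \<tau>: "0 < \<tau> r" "\<tau> r \<le> 1" if "r \<in> {r0..1}" for r
      using K_trunc_factor[OF assms(2) k \<alpha>, of r] that
      unfolding K_def r0_def Q_def G_def \<tau>_def by auto
    have contK: "continuous_on {r0..1} K"
      unfolding K_def r0_def by (rule continuous_on_K_trunc[OF assms(2) k])
    have contV: "continuous_on {r0..1} H" if "H \<in> approx_space k \<alpha> p" for H
      using that by (rule continuous_on_approx_space) (use r0 in auto)
    have FV: "F \<in> approx_space k \<alpha> p"
      and best: "\<And>H. H \<in> approx_space k \<alpha> p \<Longrightarrow>
        sup_norm_on {r0..1} (\<lambda>r. K r - F r) \<le> sup_norm_on {r0..1} (\<lambda>r. K r - H r)"
      using F unfolding best_uniform_approx_def K_def r0_def by auto
    have lower: "Q * k\<^sup>2 * g \<le> sup_norm_on {r0..1} K"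
    proof -
      \<comment> \<open>The left end \<open>r = C / k\<close> corresponds to \<open>t = 1\<close>.\<close>
      have "\<tau> r0 = 1" using assms k0 by (simp add: \<tau>_def r0_def)
      then have "cmod (K r0) = Q * k\<^sup>2 * g"
        using Keq[of r0] r0 Q by (simp add: norm_mult norm_power g_def)
      then show ?thesis using cmod_le_sup_norm_on[OF compact_Icc contK, of r0] r0 by simp
    qed
    have upper: "sup_norm_on {r0..1} (\<lambda>r. K r - F r) \<le> Q * k\<^sup>2 * (c / real p ^ m)"
    proof -
      have "\<tau> 1 > 0" "\<tau> 1 \<le> 1" using \<tau>[of 1] r0 by auto
      then obtain P where P: "degree P \<le> p - 1"
        "\<And>t. t \<in> {\<tau> 1..1} \<Longrightarrow> cmod (of_real (t powr \<beta>) * G (t powr \<alpha>) - poly P (of_real t)) \<le> c / real p ^ m"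
        using c(2)[OF p] by blast
      obtain H where H: "H \<in> approx_space k \<alpha> p"
        "\<And>r. r > 0 \<Longrightarrow> H r = exp (\<i> * of_real (k * r)) * (of_real (Q * k\<^sup>2) * (of_real (\<tau> r) * poly P (of_real (\<tau> r))))"
        using poly_times_var_in_approx_space[OF assms(2) k0 p P(1)] unfolding \<tau>_def by blast
      have "cmod (K r - H r) \<le> Q * k\<^sup>2 * (c / real p ^ m)" if r: "r \<in> {r0..1}" for r
      proof -
        define t where "t = \<tau> r"
        have t: "0 < t" "t \<le> 1" using \<tau>[OF r] by (auto simp: t_def)
        have "\<tau> 1 \<le> t"
          unfolding \<tau>_def t_def using r r0 assms k0 \<alpha> by (intro powr_mono2) (auto simp: field_simps)
        then have err: "cmod (of_real (t powr \<beta>) * G (t powr \<alpha>) - poly P (of_real t)) \<le> c / real p ^ m"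
          using P(2) t by auto
        have "t powr (3 * \<alpha> / 2) = t * t powr \<beta>"
          using t powr_add[of t 1 \<beta>] by (simp add: \<beta>_def)
        then have "K r - H r = exp (\<i> * of_real (k * r)) * (of_real (Q * k\<^sup>2) * (of_real t *
            (of_real (t powr \<beta>) * G (t powr \<alpha>) - poly P (of_real t))))"
          using Keq[OF r] H(2)[of r] r r0 by (simp add: t_def[symmetric] algebra_simps)
        then have "cmod (K r - H r) = Q * k\<^sup>2 * (t * cmod (of_real (t powr \<beta>) * G (t powr \<alpha>) - poly P (of_real t)))"
          using Q t norm_exp_i_times[of "k * r"] by (simp only: norm_mult norm_of_real) simp
        also have "\<dots> \<le> Q * k\<^sup>2 * (1 * (c / real p ^ m))"
          using err t Q by (intro mult_left_mono mult_mono) auto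
        finally show ?thesis by simp
      qed
      then have "sup_norm_on {r0..1} (\<lambda>r. K r - H r) \<le> Q * k\<^sup>2 * (c / real p ^ m)"
        unfolding sup_norm_on_def using r0 by (intro cSUP_least) auto
      then show ?thesis using best[OF H(1)] by linarith
    qed
    have "2 * sup_norm_on {r0..1} (\<lambda>r. K r - F r) \<le> 2 * (Q * k\<^sup>2 * (c / real p ^ m))"
      using upper by simp
    also have "\<dots> = 2 * c / g * (1 / real p ^ m) * (Q * k\<^sup>2 * g)"
      using g by simp
    also have "\<dots> \<le> 2 * c / g * (1 / real p ^ m) * sup_norm_on {r0..1} K"
      using lower c g by (intro mult_left_mono) auto
    also have "1 / real p ^ m = real p powi (1 - \<lfloor>3 * \<alpha> / 2\<rfloor>)"
      unfolding mi by (simp add: power_int_minus inverse_eq_divide)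
    finally have final: "2 * sup_norm_on {r0..1} (\<lambda>r. K r - F r)
      \<le> 2 * c / g * real p powi (1 - \<lfloor>3 * \<alpha> / 2\<rfloor>) * sup_norm_on {r0..1} K" .
    have "L2_opnorm (\<lambda>g x. kernel_op (zero_ext {r0..1} K) g x - kernel_op (zero_ext {r0..1} F) g x)
      \<le> ennreal (2 * sup_norm_on {r0..1} (\<lambda>r. K r - F r))"
      using r0 by (intro L2_opnorm_truncated_le contK contV FV) auto
    also have "\<dots> \<le> ennreal (2 * c / g * real p powi (1 - \<lfloor>3 * \<alpha> / 2\<rfloor>) * sup_norm_on {r0..1} K)"
      by (rule ennreal_leI[OF final])
    finally show "L2_opnorm (\<lambda>g x. kernel_op (K_trunc k (C / k)) g x - kernel_op (zero_ext {C / k..1} F) g x)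
        \<le> ennreal (2 * c / g * real p powi (1 - \<lfloor>3 * \<alpha> / 2\<rfloor>) * sup_norm_on {C / k..1} (K_trunc k (C / k)))"
      unfolding K_def r0_def K_trunc_zero_ext .
  qed
qed

end
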